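(* Let $n\ge2$ and $d\ge1$ be integers. The stabilization map $$s_d:\mathrm{Hol}_d^*(S^2,\mathbb{C}\mathrm{P}^{n-1})\to\mathrm{Hol}_{d+1}^*(S^2,\mathbb{C}\mathrm{P}^{n-1})$$ is a homology equivalence through dimension $D^*(d,n)=(2n-3)(d+1)-1$.
   Context: $\mathrm{Hol}_d^*(S^2,\mathbb{C}\mathrm{P}^{n-1})$ is the space of based holomorphic maps $(S^2,\infty)\to(\mathbb{C}\mathrm{P}^{n-1},[1:\cdots:1])$ of degree $d$, where $S^2=\mathbb{C}\cup\{\infty\}$; it is identified with the space of $n$-tuples $(f_0,\dots,f_{n-1})$ of monic polynomials in $\mathbb{C}[z]$ of degree $d$ with no root common to all of them. Stabilization map. For a space $X$, $\mathrm{SP}^d(X)=X^d/S_d$ is the $d$-th symmetric product, whose elements are written as formal sums $\sum n_kx_k$ of distinct points with positive multiplicities summing to $d$. Let $E_d(X)=\{(\xi_0,\dots,\xi_{n-1})\in\mathrm{SP}^d(X)^n:\bigcap_{j=0}^{n-1}\xi_j=\emptyset\}$ (intersection of supports). Sending a monic polynomial $\prod(z-x_k)^{n_k}$ to $\sum n_kx_k$ gives a homeomorphism $\mathrm{Hol}_d^*(S^2,\mathbb{C}\mathrm{P}^{n-1})\cong E_d(\mathbb{C})$. Let $U_d=\{x\in\mathbb{C}:\mathrm{Re}(x)<d\}\cong\mathbb{C}$, choose $n$ distinct points $x_{0;d},\dots,x_{n-1;d}$ with $d<\mathrm{Re}(x_{k;d})<d+1$, and define $\hat s_d:E_d(U_d)\to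 E_{d+1}(U_{d+1})$ by $\hat s_d(\xi_0,\dots,\xi_{n-1})=(\xi_0+x_{0;d},\dots,\xi_{n-1}+x_{n-1;d})$. The map $s_d$ is the composite $\mathrm{Hol}_d^*(S^2,\mathbb{C}\mathrm{P}^{n-1})\cong E_d(\mathbb{C})\cong E_d(U_d)\xrightarrow{\hat s_d}E_{d+1}(U_{d+1})\cong E_{d+1}(\mathbb{C})\cong\mathrm{Hol}_{d+1}^*(S^2,\mathbb{C}\mathrm{P}^{n-1})$; its homotopy class does not depend on the choice of the points $x_{k;d}$. A map $f:X\to Y$ is a homology equivalence through dimension $D$ if $f_*:H_k(X,\mathbb{Z})\to H_k(Y,\mathbb{Z})$ is an isomorphism for every $k\le D$. *)

theory Defs
  imports
    "HOL-Homology.Homology"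
    "HOL-Computational_Algebra.Computational_Algebra"
begin

text \<open>
  \<open>n\<close>-tuples are functions on \<open>{..<n}\<close>, extended by \<open>undefined\<close> outside, as in
  \<^const>\<open>product_topology\<close>.
\<close>

text \<open>
  The monic polynomials of degree \<open>d\<close>, topologised as \<open>\<complex>\<^sup>d\<close> by the coefficients below the
  leading one.
\<close>

definition monic_polys :: "nat \<Rightarrow> complex poly topology" where
  "monic_polys d =
     pullback_topology {p. degree p = d \<and> lead_coeff p = 1}
       (\<lambda>p. \<lambda>i\<in>{..<d}. coeff p i)
       (product_topology (\<lambda>_. euclidean) {..<d})"

text \<open>
  The space of based holomorphic maps \<open>z \<mapsto> [f\<^sub>0(z) : \<dots> : f\<^sub>n\<^sub>-\<^sub>1(z)]\<close> of degree \<open>d\<close> from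
  the 2-sphere to complex projective \<open>(n-1)\<close>-space, under its identification with the space
  of tuples of monic polynomials of degree \<open>d\<close> having no root common to all of them.
\<close>

definition Hol :: "nat \<Rightarrow> nat \<Rightarrow> (nat \<Rightarrow> complex poly) topology" where
  "Hol d n =
     subtopology (product_topology (\<lambda>_. monic_polys d) {..<n})
       {f. \<not> (\<exists>z. \<forall>j<n. poly (f j) z = 0)}"

text \<open>
  Elements of symmetric products are multisets. Only the underlying sets of \<open>SP\<^sup>d(X)\<close> and
  \<open>E\<^sub>d(X)\<close> are introduced: the stabilization map starts and ends in \<^const>\<open>Hol\<close>, so the
  topologies of the intermediate spaces do not enter.
\<close>

definition SP :: "nat \<Rightarrow> 'a set \<Rightarrow> 'a multiset set" where
  "SP d X = {\<xi>. set_mset \<xi> \<subseteq> X \<and> size \<xi> = d}"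

definition E_space :: "nat \<Rightarrow> nat \<Rightarrow> 'a set \<Rightarrow> (nat \<Rightarrow> 'a multiset) set" where
  "E_space d n X = {\<xi> \<in> {..<n} \<rightarrow>\<^sub>E SP d X. (\<Inter>j<n. set_mset (\<xi> j)) = {}}"

definition U_half :: "nat \<Rightarrow> complex set" where
  "U_half d = {x. Re x < real d}"

definition roots :: "nat \<Rightarrow> (nat \<Rightarrow> complex poly) \<Rightarrow> (nat \<Rightarrow> complex multiset)" where
  "roots n f = (\<lambda>j\<in>{..<n}. proots (f j))"

definition from_roots :: "nat \<Rightarrow> (nat \<Rightarrow> complex multiset) \<Rightarrow> (nat \<Rightarrow> complex poly)" where
  "from_roots n \<xi> = (\<lambda>j\<in>{..<n}. \<Prod>x\<in>#\<xi> j. [:- x, 1:])"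

definition E_map :: "nat \<Rightarrow> ('a \<Rightarrow> 'b) \<Rightarrow> (nat \<Rightarrow> 'a multiset) \<Rightarrow> (nat \<Rightarrow> 'b multiset)" where
  "E_map n h \<xi> = (\<lambda>j\<in>{..<n}. image_mset h (\<xi> j))"

definition s_hat :: "nat \<Rightarrow> (nat \<Rightarrow> 'a) \<Rightarrow> (nat \<Rightarrow> 'a multiset) \<Rightarrow> (nat \<Rightarrow> 'a multiset)" where
  "s_hat n x \<xi> = (\<lambda>j\<in>{..<n}. add_mset (x j) (\<xi> j))"

text \<open>
  The stabilization map \<open>s\<^sub>d\<close>, depending on the homeomorphisms \<open>\<phi> : \<complex> \<cong> U\<^sub>d\<close> and
  \<open>\<psi> : \<complex> \<cong> U\<^sub>d\<^sub>+\<^sub>1\<close> and on the new points \<open>x\<close>. The degree \<open>d\<close> is determined by the argument.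
\<close>

definition stab ::
  "nat \<Rightarrow> (complex \<Rightarrow> complex) \<Rightarrow> (complex \<Rightarrow> complex) \<Rightarrow> (nat \<Rightarrow> complex) \<Rightarrow>
   (nat \<Rightarrow> complex poly) \<Rightarrow> (nat \<Rightarrow> complex poly)" where
  "stab n \<phi> \<psi> x =
     from_roots n \<circ> E_map n (inv_into UNIV \<psi>) \<circ> s_hat n x \<circ> E_map n \<phi> \<circ> roots n"

definition stab_data ::
  "nat \<Rightarrow> nat \<Rightarrow> (complex \<Rightarrow> complex) \<Rightarrow> (complex \<Rightarrow> complex) \<Rightarrow> (nat \<Rightarrow> complex) \<Rightarrow> bool" where
  "stab_data d n \<phi> \<psi> x \<longleftrightarrow>
     homeomorphic_map euclidean (top_of_set (U_half d)) \<phi> \<and>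
     homeomorphic_map euclidean (top_of_set (U_half (d + 1))) \<psi> \<and>
     inj_on x {..<n} \<and>
     (\<forall>k<n. real d < Re (x k) \<and> Re (x k) < real (d + 1))"

definition homology_equivalence_through ::
  "int \<Rightarrow> 'a topology \<Rightarrow> 'b topology \<Rightarrow> ('a \<Rightarrow> 'b) \<Rightarrow> bool" where
  "homology_equivalence_through D X Y f \<longleftrightarrow>
     continuous_map X Y f \<and>
     (\<forall>k::nat. int k \<le> D \<longrightarrow>
        hom_induced (int k) X {} Y {} f \<in> iso (homology_group (int k) X) (homology_group (int k) Y))"

text \<open>The arrows of the composite defining \<^const>\<open>stab\<close> have the expected sources and targets.\<close>

lemma topspace_monic_polys: "topspace (monic_polys d) = {p. degree p = d \<and> lead_coeff p = 1}"
  by (auto simp: monic_polys_def topspace_pullback_topology)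

lemma topspace_Hol:
  "topspace (Hol d n) =
     {f \<in> {..<n} \<rightarrow>\<^sub>E {p. degree p = d \<and> lead_coeff p = 1}. \<not> (\<exists>z. \<forall>j<n. poly (f j) z = 0)}"
  unfolding Hol_def by (auto simp: topspace_monic_polys)

lemma prod_roots:
  fixes M :: "complex multiset"
  defines "p \<equiv> \<Prod>x\<in>#M. [:- x, 1:]"
  shows "degree p = size M" "lead_coeff p = 1" "p \<noteq> 0" "proots p = M"
proof -
  have "degree p = size M \<and> lead_coeff p = 1 \<and> p \<noteq> 0 \<and> proots p = M"
    unfolding p_def
  proof (induction M)
    case (add a M)
    let ?q = "\<Prod>x\<in>#M. [:- x, 1:]"
    have q: "degree ?q = size M" "lead_coeff ?q = 1" "?q \<noteq> 0" "proots ?q = M"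
      using add by auto
    have "degree ([:- a, 1:] * ?q) = Suc (size M)"
      using q by (subst degree_mult_eq) auto
    moreover have "lead_coeff ([:- a, 1:] * ?q) = 1"
      using q by (subst lead_coeff_mult) auto
    moreover have "proots ([:- a, 1:] * ?q) = add_mset a M"
      using q by (subst proots_mult) (auto simp: proots_linear_factor)
    moreover have "[:- a, 1:] * ?q \<noteq> 0"
      using q(3) by (subst mult_eq_0_iff) auto
    ultimately show ?case
      using q(4) by (simp only: image_mset_add_mset prod_mset.add_mset size_add_mset simp_thms)
  qed auto
  then show "degree p = size M" "lead_coeff p = 1" "p \<noteq> 0" "proots p = M"
    by auto
qed

lemma bij_betw_roots:
  assumes "n > 0"
  shows "bij_betw (roots n) (topspace (Hol d n)) (E_space d n UNIV)"
    and "bij_betw (from_roots n) (E_space d n UNIV) (topspace (Hol d n))"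
proof -
  have *: "roots n f \<in> E_space d n UNIV" "from_roots n (roots n f) = f" if "f \<in> topspace (Hol d n)" for f
  proof -
    have f: "f \<in> {..<n} \<rightarrow>\<^sub>E {p. degree p = d \<and> lead_coeff p = 1}"
        "\<not> (\<exists>z. \<forall>j<n. poly (f j) z = 0)"
      using that by (auto simp: topspace_Hol)
    then have fj: "degree (f j) = d" "lead_coeff (f j) = 1" "f j \<noteq> 0" if "j < n" for j
    proof -
      have "f j \<in> {p. degree p = d \<and> lead_coeff p = 1}"
        using f(1) that by auto
      then show "degree (f j) = d" "lead_coeff (f j) = 1" "f j \<noteq> 0"
        by auto
    qed
    have "(\<Prod>x\<in>#proots (f j). [:- x, 1:]) = f j" if "j < n" for j
      using complex_poly_decompose_multiset[of "f j"] fj[OF that] by simp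
    then show "from_roots n (roots n f) = f"
      using f(1) by (auto simp: from_roots_def roots_def fun_eq_iff PiE_def extensional_def)
    show "roots n f \<in> E_space d n UNIV"
      using f(2) fj assms by (auto simp: E_space_def SP_def roots_def size_proots_complex)
  qed
  have **: "from_roots n \<xi> \<in> topspace (Hol d n)" "roots n (from_roots n \<xi>) = \<xi>"
    if "\<xi> \<in> E_space d n UNIV" for \<xi>
  proof -
    have \<xi>: "\<xi> \<in> {..<n} \<rightarrow>\<^sub>E SP d UNIV" "(\<Inter>j<n. set_mset (\<xi> j)) = {}"
      using that by (auto simp: E_space_def)
    have "poly (\<Prod>x\<in>#\<xi> j. [:- x, 1:]) z = 0 \<longleftrightarrow> z \<in># \<xi> j" for j z
      using prod_roots(3,4)[of "\<xi> j"] by (metis (mono_tags) mem_Collect_eq set_count_proots)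
    then show "from_roots n \<xi> \<in> topspace (Hol d n)"
      using \<xi> prod_roots(1,2) by (fastforce simp: topspace_Hol from_roots_def SP_def)
    show "roots n (from_roots n \<xi>) = \<xi>"
      using \<xi>(1) prod_roots(4)
      by (auto simp: from_roots_def roots_def fun_eq_iff PiE_def extensional_def)
  qed
  show "bij_betw (roots n) (topspace (Hol d n)) (E_space d n UNIV)"
    by (rule bij_betwI[where g = "from_roots n"]) (use * ** in auto)
  show "bij_betw (from_roots n) (E_space d n UNIV) (topspace (Hol d n))"
    by (rule bij_betwI[where g = "roots n"]) (use * ** in auto)
qed

lemma E_map_in_E:
  assumes "bij_betw h X Y" "\<xi> \<in> E_space d n X" "n > 0"
  shows "E_map n h \<xi> \<in> E_space d n Y"
proof -
  have \<xi>: "\<xi> \<in> {..<n} \<rightarrow>\<^sub>E SP d X" "(\<Inter>j<n. set_mset (\<xi> j)) = {}"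
    using assms by (auto simp: E_space_def)
  then have sub: "set_mset (\<xi> j) \<subseteq> X" if "j < n" for j
    using that by (auto simp: SP_def PiE_def Pi_def)
  have "(\<Inter>j<n. h ` set_mset (\<xi> j)) = h ` (\<Inter>j<n. set_mset (\<xi> j))"
    using image_INT[of h X "{..<n}" "\<lambda>j. set_mset (\<xi> j)" 0] assms sub by (auto simp: bij_betw_def)
  moreover have "h ` set_mset (\<xi> j) \<subseteq> Y" if "j < n" for j
    using sub[OF that] assms(1) by (auto simp: bij_betw_def)
  ultimately show ?thesis
    using \<xi> by (fastforce simp: E_space_def E_map_def SP_def)
qed

lemma s_hat_in_E:
  assumes "stab_data d n \<phi> \<psi> x" "\<xi> \<in> E_space d n (U_half d)" "n \<ge> 2"
  shows "s_hat n x \<xi> \<in> E_space (d + 1) n (U_half (d + 1))"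
proof -
  have \<xi>: "\<xi> \<in> {..<n} \<rightarrow>\<^sub>E SP d (U_half d)" "(\<Inter>j<n. set_mset (\<xi> j)) = {}"
    using assms by (auto simp: E_space_def)
  then have sub: "Re y < real d" if "j < n" "y \<in># \<xi> j" for j y
    using that by (fastforce simp: SP_def PiE_def Pi_def U_half_def)
  have x: "real d < Re (x k)" "Re (x k) < real (d + 1)" if "k < n" for k
    using assms(1) that by (auto simp: stab_data_def)
  have "x 0 \<noteq> x 1"
    using assms(1,3) inj_onD[of x "{..<n}" 0 1] by (auto simp: stab_data_def)
  have False if y: "\<And>j. j < n \<Longrightarrow> y = x j \<or> y \<in># \<xi> j" for y
  proof (cases "Re y < real d")
    case True
    then have "y \<in># \<xi> j" if "j < n" for j
      using x(1)[OF that] y[OF that] by auto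
    then show False
      using \<xi>(2) by auto
  next
    case False
    then have "y = x 0" "y = x 1"
      using y[of 0] y[of 1] sub[of 0 y] sub[of 1 y] assms(3) by auto
    then show False
      using \<open>x 0 \<noteq> x 1\<close> by simp
  qed
  then have "(\<Inter>j<n. insert (x j) (set_mset (\<xi> j))) = {}"
    by auto
  moreover have "add_mset (x j) (\<xi> j) \<in> SP (d + 1) (U_half (d + 1))" if "j < n" for j
  proof -
    have "\<xi> j \<in> SP d (U_half d)"
      using \<xi>(1) that by auto
    then show ?thesis
      using x[OF that] by (fastforce simp: SP_def U_half_def)
  qed
  ultimately show ?thesis
    by (auto simp: E_space_def s_hat_def)
qed

lemma stab_in_Hol:
  assumes "stab_data d n \<phi> \<psi> x" "f \<in> topspace (Hol d n)" "n \<ge> 2"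
  shows "stab n \<phi> \<psi> x f \<in> topspace (Hol (d + 1) n)"
proof -
  have n: "n > 0"
    using assms(3) by simp
  have \<phi>: "bij_betw \<phi> UNIV (U_half d)" and \<psi>: "bij_betw \<psi> UNIV (U_half (d + 1))"
    using assms(1) homeomorphic_imp_surjective_map[of euclidean "top_of_set (U_half d)" \<phi>]
      homeomorphic_imp_surjective_map[of euclidean "top_of_set (U_half (d + 1))" \<psi>]
    by (auto simp: stab_data_def homeomorphic_map_def bij_betw_def)
  have "roots n f \<in> E_space d n UNIV"
    using bij_betw_roots(1)[OF n] assms(2) by (rule bij_betwE[THEN bspec])
  then have "E_map n \<phi> (roots n f) \<in> E_space d n (U_half d)"
    by (rule E_map_in_E[OF \<phi> _ n])
  then have "s_hat n x (E_map n \<phi> (roots n f)) \<in> E_space (d + 1) n (U_half (d + 1))"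
    using assms by (intro s_hat_in_E)
  then have "E_map n (inv_into UNIV \<psi>) (s_hat n x (E_map n \<phi> (roots n f))) \<in> E_space (d + 1) n UNIV"
    by (rule E_map_in_E[OF bij_betw_inv_into[OF \<psi>] _ n])
  then show ?thesis
    using bij_betw_roots(2)[OF n] unfolding stab_def comp_def by (metis bij_betwE)
qed

end

theory Submission
  imports
    Defs
    "HOL-Analysis.Analysis"
    "HOL-Computational_Algebra.Field_as_Ring"
begin

text \<open>
  The proof follows Segal's stratification of the contractible space of all \<open>n\<close>-tuples of monic
  polynomials of degree \<open>e\<close> by the degree \<open>k\<close> of their greatest common divisor. Division by the
  greatest common divisor identifies the stratum with the product of the contractible space of
  monic polynomials of degree \<open>k\<close> and \<open>Hol (e - k) n\<close>, and it has complex codimension \<open>(n - 1) k\<close>.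

  The stabilization map thickens to an open inclusion: a tuple in its image has all roots in the
  half-plane \<open>U\<^sub>d\<close> except that the \<open>j\<close>-th polynomial has one root in a small disc around \<open>x\<^sub>j\<close>.
  This inclusion respects the strata, so by induction on \<open>e\<close> and the Thom isomorphism it is an
  isomorphism through dimension \<open>(2n - 3)(e - k) - 1 + 2(n - 1)k = (2n - 3)e - 1 + k\<close> on the pair
  belonging to the \<open>k\<close>-th stratum, \<open>k \<ge> 1\<close>. Removing the strata \<open>k = e, \<dots>, 1\<close> one after the
  other from contractible spaces loses one dimension each time, by the five lemma, which leaves
  \<open>(2n - 3)e - 1\<close> for the tuples without common root, where \<open>e = d + 1\<close>.

  The normal bundle of a stratum need not be explicitly trivial, but it is so stably: after
  multiplying by the space of monic polynomials of degree \<open>k\<close>, the stratum becomes the graph of the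
  greatest common divisor. On the one hand, quotients and remainders of division by the first
  component are coordinates in which this graph is a zero section. On the other hand, a Tietze
  extension of the greatest common divisor moves the graph to the original stratum times a point.
\<close>

section \<open>Relative homology isomorphisms\<close>

text \<open>The bound is forced by its start: for \<open>e = 0\<close> the thickened image
  \<open>small 0\<close> is empty while \<open>big 0\<close> is a point, so nothing beyond dimension
  -1 can hold. This is the final -1. The slope 2n - 3 is the real codimension 2(n-1) of the first
  stratum less the one dimension lost in passing from a pair to its subspace. The k-th stratum has a
  surplus of k, and the k removals from level k down to level 0 use it up. No Thom class and no
  tubular neighbourhood is constructed. Only inclusions have to be compared, so homeomorphisms,
  excisions and suspensions between pairs suffice. Suspension is proved as an equivalence: it is
  applied forwards for the remainders and backwards to remove the auxiliary factor again. The
  obstacle is continuity. The greatest common divisor jumps between strata and is continuous only on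
  each of them. This continuity, the openness of the filtration and the continuity of moving roots
  all rest on the properness of multiplication: bounded coefficients mean bounded roots, hence
  bounded divisors.\<close>

lemma five_lemma:
  assumes grp: "group G1" "group G2" "group G3" "group G4" "group G5"
      "group H1" "group H2" "group H3" "group H4" "group H5"
    and a: "a1 \<in> hom G1 G2" "a2 \<in> hom G2 G3" "a3 \<in> hom G3 G4" "a4 \<in> hom G4 G5"
    and b: "b1 \<in> hom H1 H2" "b2 \<in> hom H2 H3" "b3 \<in> hom H3 H4" "b4 \<in> hom H4 H5"
    and c: "c1 \<in> hom G1 H1" "c2 \<in> hom G2 H2" "c3 \<in> hom G3 H3" "c4 \<in> hom G4 H4" "c5 \<in> hom G5 H5"
    and sq: "\<And>x. x \<in> carrier G1 \<Longrightarrow> c2 (a1 x) = b1 (c1 x)"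
      "\<And>x. x \<in> carrier G2 \<Longrightarrow> c3 (a2 x) = b2 (c2 x)"
      "\<And>x. x \<in> carrier G3 \<Longrightarrow> c4 (a3 x) = b3 (c3 x)"
      "\<And>x. x \<in> carrier G4 \<Longrightarrow> c5 (a4 x) = b4 (c4 x)"
    and ex: "kernel G2 G3 a2 = a1 ` carrier G1" "kernel G3 G4 a3 = a2 ` carrier G2"
      "kernel G4 G5 a4 = a3 ` carrier G3"
    and ey: "kernel H2 H3 b2 = b1 ` carrier H1" "kernel H3 H4 b3 = b2 ` carrier H2"
      "kernel H4 H5 b4 = b3 ` carrier H3"
    and bij: "c1 ` carrier G1 = carrier H1" "bij_betw c2 (carrier G2) (carrier H2)"
      "bij_betw c4 (carrier G4) (carrier H4)" "inj_on c5 (carrier G5)"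
  shows "bij_betw c3 (carrier G3) (carrier H3)"
proof -
  interpret G1: group G1 by fact
  interpret G2: group G2 by fact
  interpret G3: group G3 by fact
  interpret G4: group G4 by fact
  interpret G5: group G5 by fact
  interpret H1: group H1 by fact
  interpret H2: group H2 by fact
  interpret H3: group H3 by fact
  interpret H4: group H4 by fact
  interpret H5: group H5 by fact
  interpret c3: group_hom G3 H3 c3 by (simp add: c group_hom_axioms_def group_hom_def grp)
  have one: "c4 \<one>\<^bsub>G4\<^esub> = \<one>\<^bsub>H4\<^esub>" "c5 \<one>\<^bsub>G5\<^esub> = \<one>\<^bsub>H5\<^esub>" "c3 \<one>\<^bsub>G3\<^esub> = \<one>\<^bsub>H3\<^esub>"
    using c grp hom_one by blast+
  have cl: "\<And>x. x \<in> carrier G1 \<Longrightarrow> a1 x \<in> carrier G2" "\<And>x. x \<in> carrier G2 \<Longrightarrow> a2 x \<in> carrier G3"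
    "\<And>x. x \<in> carrier G3 \<Longrightarrow> a3 x \<in> carrier G4" "\<And>x. x \<in> carrier G4 \<Longrightarrow> a4 x \<in> carrier G5"
    "\<And>x. x \<in> carrier G2 \<Longrightarrow> c2 x \<in> carrier H2" "\<And>x. x \<in> carrier G3 \<Longrightarrow> c3 x \<in> carrier H3"
    "\<And>x. x \<in> carrier H3 \<Longrightarrow> b3 x \<in> carrier H4"
    using a b c by (auto simp: hom_def)
  \<comment> \<open>Injectivity: an element killed by \<open>c3\<close> comes from
    \<open>G2\<close>, and there surjectivity of \<open>c1\<close> and injectivity of
    \<open>c2\<close> exhibit it as an image under \<open>a1\<close>.\<close>
  have "x = \<one>\<^bsub>G3\<^esub>" if x: "x \<in> carrier G3" "c3 x = \<one>\<^bsub>H3\<^esub>" for x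
  proof -
    have "c4 (a3 x) = c4 \<one>\<^bsub>G4\<^esub>"
      using sq(3) x one b hom_one grp by metis
    then have "a3 x = \<one>\<^bsub>G4\<^esub>"
      using bij(3) cl(3)[OF x(1)] by (auto simp: bij_betw_def inj_on_def)
    then obtain y where y: "y \<in> carrier G2" "x = a2 y"
      using ex(2) x by (auto simp: kernel_def)
    then have "c2 y \<in> kernel H2 H3 b2"
      using sq(2) x cl by (auto simp: kernel_def)
    then obtain z where z: "z \<in> carrier H1" "c2 y = b1 z"
      using ey by auto
    then obtain w where w: "w \<in> carrier G1" "z = c1 w"
      using bij(1) by blast
    then have "c2 (a1 w) = c2 y"
      using sq(1) z by auto
    then have "y = a1 w"
      using bij(2) w cl y by (auto simp: bij_betw_def inj_on_def)
    then have "y \<in> kernel G2 G3 a2"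
      using ex(1) w by auto
    then show ?thesis
      using y by (simp add: kernel_def)
  qed
  then have "inj_on c3 (carrier G3)"
    by (subst c3.inj_on_one_iff) auto
  \<comment> \<open>Surjectivity: lift \<open>b3 y\<close> through \<open>c4\<close>. Injectivity of
    \<open>c5\<close> makes the lift come from some \<open>v\<close>, and the quotient of
    \<open>y\<close> by \<open>c3 v\<close> then comes from \<open>H2\<close>.\<close>
  moreover have "y \<in> c3 ` carrier G3" if y: "y \<in> carrier H3" for y
  proof -
    have "b3 y \<in> carrier H4"
      using y cl by auto
    then obtain u where u: "u \<in> carrier G4" "b3 y = c4 u"
      using bij(3) by (auto simp: bij_betw_def)
    have "b3 y \<in> kernel H4 H5 b4"
      using ey(3) y by auto
    then have "c5 (a4 u) = c5 \<one>\<^bsub>G5\<^esub>"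
      using sq(4)[OF u(1)] u one by (simp add: kernel_def)
    then have "a4 u = \<one>\<^bsub>G5\<^esub>"
      using bij(4) u cl by (auto simp: inj_on_def)
    then obtain v where v: "v \<in> carrier G3" "u = a3 v"
      using ex(3) u by (auto simp: kernel_def)
    have "b3 (c3 v) = b3 y"
      using sq(3)[OF v(1)] u v by simp
    then have "y \<otimes>\<^bsub>H3\<^esub> inv\<^bsub>H3\<^esub> (c3 v) \<in> kernel H3 H4 b3"
    proof -
      interpret b3: group_hom H3 H4 b3 by (simp add: b group_hom_axioms_def group_hom_def grp)
      show ?thesis
        using y v \<open>b3 (c3 v) = b3 y\<close> cl by (auto simp: kernel_def)
    qed
    then obtain z where z: "z \<in> carrier H2" "y \<otimes>\<^bsub>H3\<^esub> inv\<^bsub>H3\<^esub> (c3 v) = b2 z"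
      using ey by auto
    obtain w where w: "w \<in> carrier G2" "z = c2 w"
      using bij(2) z by (auto simp: bij_betw_def)
    have "c3 (a2 w \<otimes>\<^bsub>G3\<^esub> v) = (y \<otimes>\<^bsub>H3\<^esub> inv\<^bsub>H3\<^esub> (c3 v)) \<otimes>\<^bsub>H3\<^esub> c3 v"
      using w v z sq(2)[OF w(1)] cl by simp
    also have "\<dots> = y"
      using y v by (simp add: H3.m_assoc)
    finally have "c3 (a2 w \<otimes>\<^bsub>G3\<^esub> v) = y" .
    moreover have "a2 w \<otimes>\<^bsub>G3\<^esub> v \<in> carrier G3"
      using w v cl by simp
    ultimately show ?thesis
      by force
  qed
  ultimately show ?thesis
    using cl by (auto simp: bij_betw_def)
qed

section \<open>Maps of pairs that induce isomorphisms in one degree\<close>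

definition pair_map :: "'a topology \<Rightarrow> 'a set \<Rightarrow> 'b topology \<Rightarrow> 'b set \<Rightarrow> ('a \<Rightarrow> 'b) \<Rightarrow> bool" where
  "pair_map X S Y T f \<longleftrightarrow> continuous_map X Y f \<and> f \<in> topspace X \<inter> S \<rightarrow> T"

text \<open>\<open>hom_induced\<close> is a constant default unless \<open>f\<close> is a map of
  pairs on the points of \<open>topspace X\<close>. Including \<open>pair_map\<close> excludes
  spurious isomorphisms between trivial groups.\<close>

definition hiso :: "int \<Rightarrow> 'a topology \<Rightarrow> 'a set \<Rightarrow> 'b topology \<Rightarrow> 'b set \<Rightarrow> ('a \<Rightarrow> 'b) \<Rightarrow> bool" where
  "hiso i X S Y T f \<longleftrightarrow> pair_map X S Y T f \<and>
     hom_induced i X S Y T f \<in> iso (relative_homology_group i X S) (relative_homology_group i Y T)"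

lemma hiso_pair_map: "hiso i X S Y T f \<Longrightarrow> pair_map X S Y T f"
  by (simp add: hiso_def)

lemma hiso_iff_bij:
  "hiso i X S Y T f \<longleftrightarrow> pair_map X S Y T f \<and>
     bij_betw (hom_induced i X S Y T f)
       (carrier (relative_homology_group i X S)) (carrier (relative_homology_group i Y T))"
  by (simp add: hiso_def iso_def hom_induced_hom)

lemma hom_induced_compose_pair:
  assumes "pair_map X S Y T f" "pair_map Y T Z U g"
  shows "hom_induced p X S Z U (g \<circ> f) = hom_induced p Y T Z U g \<circ> hom_induced p X S Y T f"
proof -
  have im: "f ` topspace X \<subseteq> topspace Y"
    using assms by (auto simp: pair_map_def continuous_map_def)
  \<comment> \<open>Passing to the traces of the subspaces makes the map conditions hold on the
    whole subspace, as the composition law asks.\<close>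
  have "hom_induced p X (topspace X \<inter> S) Z U (g \<circ> f) =
      hom_induced p Y (topspace Y \<inter> T) Z U g \<circ> hom_induced p X (topspace X \<inter> S) Y (topspace Y \<inter> T) f"
    by (rule hom_induced_compose) (use assms im in \<open>auto simp: pair_map_def\<close>)
  then show ?thesis
    by (metis hom_induced_restrict inf.left_idem)
qed

lemma pair_map_compose:
  assumes "pair_map X S Y T f" "pair_map Y T Z U g"
  shows "pair_map X S Z U (g \<circ> f)"
  using assms continuous_map_compose[of X Y f Z g]
  by (auto simp: pair_map_def continuous_map_def Pi_iff)

text \<open>Two isomorphic sides of a commutative square make the other two equivalent. This
  transports the comparison of two pairs along any natural replacement, in both directions.\<close>

lemma hiso_square:
  assumes "pair_map X S Y T f" "pair_map X' S' Y' T' g"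
    and "hiso i X S X' S' p" "hiso i Y T Y' T' q"
    and "\<And>x. x \<in> topspace X \<Longrightarrow> g (p x) = q (f x)"
  shows "hiso i X S Y T f \<longleftrightarrow> hiso i X' S' Y' T' g"
proof -
  let ?h = "\<lambda>A B C D. hom_induced i A B C D"
  let ?c = "\<lambda>A B. carrier (relative_homology_group i A B)"
  have p: "pair_map X S X' S' p" and q: "pair_map Y T Y' T' q"
    using assms(3,4) by (auto intro: hiso_pair_map)
  have "?h X S Y' T' (g \<circ> p) = ?h X S Y' T' (q \<circ> f)"
    by (rule hom_induced_eq) (use assms in auto)
  then have eq: "?h X' S' Y' T' g \<circ> ?h X S X' S' p = ?h Y T Y' T' q \<circ> ?h X S Y T f"
    using hom_induced_compose_pair[OF p assms(2), of i] hom_induced_compose_pair[OF assms(1) q, of i]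
    by simp
  have bp: "bij_betw (?h X S X' S' p) (?c X S) (?c X' S')" and bq: "bij_betw (?h Y T Y' T' q) (?c Y T) (?c Y' T')"
    using assms(3,4) by (auto simp: hiso_iff_bij)
  have "bij_betw (?h X' S' Y' T' g) (?c X' S') (?c Y' T') \<longleftrightarrow>
        bij_betw (?h X' S' Y' T' g \<circ> ?h X S X' S' p) (?c X S) (?c Y' T')"
    by (rule bij_betw_comp_iff[OF bp])
  also have "\<dots> \<longleftrightarrow> bij_betw (?h X S Y T f) (?c X S) (?c Y T)"
    unfolding eq by (rule bij_betw_comp_iff2[OF bq, symmetric]) (auto simp: hom_induced_carrier)
  finally show ?thesis
    using assms(1,2) by (simp add: hiso_iff_bij)
qed

lemma hiso_compose:
  assumes "hiso i X S Y T f" "hiso i Y T Z U g"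
  shows "hiso i X S Z U (g \<circ> f)"
  using assms hom_induced_compose_pair[of X S Y T f Z U g i] pair_map_compose[of X S Y T f Z U g]
  by (auto simp: hiso_iff_bij intro: bij_betw_trans)

lemma pair_map_eq:
  assumes "\<And>x. x \<in> topspace X \<Longrightarrow> f x = g x"
  shows "pair_map X S Y T f \<longleftrightarrow> pair_map X S Y T g"
proof -
  have "continuous_map X Y f \<longleftrightarrow> continuous_map X Y g"
    using assms continuous_map_eq by metis
  then show ?thesis
    using assms by (auto simp: pair_map_def Pi_iff)
qed

lemma hiso_eq:
  assumes "\<And>x. x \<in> topspace X \<Longrightarrow> f x = g x"
  shows "hiso i X S Y T f \<longleftrightarrow> hiso i X S Y T g"
  using pair_map_eq[of X f g] hom_induced_eq[of X f g] assms by (simp add: hiso_def)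

lemma hiso_homotopy_equivalence:
  assumes "continuous_map X Y f" "f \<in> S \<rightarrow> T" "continuous_map Y X g" "g \<in> T \<rightarrow> S"
      and "homotopic_with (\<lambda>h. h \<in> S \<rightarrow> S) X X (g \<circ> f) id"
      and "homotopic_with (\<lambda>k. k \<in> T \<rightarrow> T) Y Y (f \<circ> g) id"
  shows "hiso i X S Y T f"
  using homotopy_equivalence_relative_homology_group_isomorphism[OF assms] assms
  by (auto simp: hiso_def pair_map_def)

lemma hiso_homeomorphism:
  assumes "homeomorphic_map X Y f" "S \<subseteq> topspace X" "f ` S = T"
  shows "hiso i X S Y T f"
  using assms homeomorphic_map_relative_homology_iso[OF assms]
  by (auto simp: hiso_def pair_map_def homeomorphic_imp_continuous_map)

lemma hiso_id: "hiso i X S X S id"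
  by (auto simp: hiso_iff_bij pair_map_def bij_betw_def inj_on_def image_iff hom_induced_id)

lemma hiso_trivial:
  assumes "pair_map X S Y T f" "trivial_group (relative_homology_group i X S)"
    "trivial_group (relative_homology_group i Y T)"
  shows "hiso i X S Y T f"
proof -
  have "hom_induced i X S Y T f \<one>\<^bsub>relative_homology_group i X S\<^esub> = \<one>\<^bsub>relative_homology_group i Y T\<^esub>"
    by (rule hom_one[OF hom_induced_hom]) auto
  then show ?thesis
    using assms by (auto simp: hiso_iff_bij trivial_group_def bij_betw_def)
qed

text \<open>Homology vanishes below degree 0. This supplies the case \<open>e = 0\<close> of the
  main induction, where only negative degrees are claimed.\<close>

lemma hiso_negative:
  assumes "pair_map X S Y T f" "i < 0"
  shows "hiso i X S Y T f"
  using assms by (intro hiso_trivial) auto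

text \<open>Five lemma for the long exact sequences of the two pairs, with the homology of the
  subspace in the middle. The pair enters in degree \<open>i + 1\<close>: this is the dimension lost
  whenever a stratum is removed.\<close>

lemma hiso_subspace:
  assumes "hiso (i + 1) X {} Y {} f" "hiso i X {} Y {} f"
    and "hiso (i + 1) X S Y T f" "hiso i X S Y T f"
  shows "hiso i (subtopology X S) {} (subtopology Y T) {} f"
proof -
  \<comment> \<open>\<open>pair_map\<close> controls \<open>f\<close> only inside
    \<open>topspace X\<close>; after cutting down, \<open>f\<close> maps all of \<open>S'\<close>
    into \<open>T'\<close>, as naturality of the boundary requires.\<close>
  define S' where "S' = topspace X \<inter> S"
  define T' where "T' = topspace Y \<inter> T"
  have eqs: "subtopology X S = subtopology X S'" "subtopology Y T = subtopology Y T'"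
    by (simp_all add: S'_def T'_def subtopology_restrict)
  have f: "continuous_map X Y f" "f \<in> S' \<rightarrow> T'"
    using assms by (auto simp: hiso_def pair_map_def S'_def T'_def continuous_map_def)
  have cont: "continuous_map (subtopology X S') (subtopology Y T') f"
    using f by (auto simp: continuous_map_in_subtopology continuous_map_from_subtopology S'_def)
  have as: "hiso (i + 1) X S' Y T' f" "hiso i X S' Y T' f"
    using assms(3,4) by (simp_all add: hiso_def S'_def T'_def pair_map_def continuous_map_def Pi_iff)
  have n1: "hom_induced (i+1) X S' Y T' f (hom_induced (i+1) X {} X S' id x) =
        hom_induced (i+1) Y {} Y T' id (hom_induced (i+1) X {} Y {} f x)" for x
    using f by (subst (1 2) hom_induced_compose') auto
  have n4: "hom_induced i X S' Y T' f (hom_induced i X {} X S' id x) =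
        hom_induced i Y {} Y T' id (hom_induced i X {} Y {} f x)" for x
    using f by (subst (1 2) hom_induced_compose') auto
  have n3: "hom_induced i X {} Y {} f (hom_induced i (subtopology X S') {} X {} id x) =
        hom_induced i (subtopology Y T') {} Y {} id
          (hom_induced i (subtopology X S') {} (subtopology Y T') {} f x)" for x
    using f cont by (subst (1 2) hom_induced_compose') auto
  have n2: "hom_induced i (subtopology X S') {} (subtopology Y T') {} f (hom_boundary (i+1) X S' x) =
      hom_boundary (i+1) Y T' (hom_induced (i+1) X S' Y T' f x)" for x
    using fun_cong[OF naturality_hom_induced[OF f, of "i+1"], of x] by simp
  have "bij_betw (hom_induced i (subtopology X S') {} (subtopology Y T') {} f)
     (carrier (homology_group i (subtopology X S'))) (carrier (homology_group i (subtopology Y T')))"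
    proof (rule five_lemma[of "homology_group (i+1) X" "relative_homology_group (i+1) X S'"
           _ "homology_group i X" "relative_homology_group i X S'"
           "homology_group (i+1) Y" "relative_homology_group (i+1) Y T'"
           _ "homology_group i Y" "relative_homology_group i Y T'"
          "hom_induced (i+1) X {} X S' id" "hom_boundary (i+1) X S'"
          "hom_induced i (subtopology X S') {} X {} id" "hom_induced i X {} X S' id"
          "hom_induced (i+1) Y {} Y T' id" "hom_boundary (i+1) Y T'"
          "hom_induced i (subtopology Y T') {} Y {} id" "hom_induced i Y {} Y T' id"
          "hom_induced (i+1) X {} Y {} f" "hom_induced (i+1) X S' Y T' f" _
          "hom_induced i X {} Y {} f" "hom_induced i X S' Y T' f"])
    show "hom_induced (i+1) X {} Y {} f ` carrier (homology_group (i+1) X) = carrier (homology_group (i+1) Y)"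
      "inj_on (hom_induced i X S' Y T' f) (carrier (relative_homology_group i X S'))"
      "bij_betw (hom_induced (i+1) X S' Y T' f) (carrier (relative_homology_group (i+1) X S'))
         (carrier (relative_homology_group (i+1) Y T'))"
      "bij_betw (hom_induced i X {} Y {} f) (carrier (homology_group i X)) (carrier (homology_group i Y))"
      using assms(1,2) as by (auto simp: hiso_iff_bij bij_betw_def)
  qed (use homology_exactness_axiom_1[of "i+1" X S'] homology_exactness_axiom_2[of "i+1" X S']
      homology_exactness_axiom_3[of i X S'] homology_exactness_axiom_1[of "i+1" Y T']
      homology_exactness_axiom_2[of "i+1" Y T'] homology_exactness_axiom_3[of i Y T']
      in \<open>simp_all add: n1 n2 n3 n4 hom_induced_hom hom_boundary_hom\<close>)
  then show ?thesis
    using cont by (simp add: eqs hiso_iff_bij pair_map_def)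
qed

text \<open>In the exact sequence of the triple, the neighbours of this boundary map are groups of
  the pair \<open>(X, T)\<close>, which vanish.\<close>

lemma bij_hom_relboundary:
  assumes "T \<subseteq> S" and "trivial_group (relative_homology_group p X T)"
    and "trivial_group (relative_homology_group (p - 1) X T)"
  shows "bij_betw (hom_relboundary p X S T) (carrier (relative_homology_group p X S))
     (carrier (relative_homology_group (p - 1) (subtopology X S) T))"
proof -
  let ?A = "relative_homology_group p X S" and ?B = "relative_homology_group (p - 1) (subtopology X S) T"
  have h: "hom_relboundary p X S T \<in> hom ?A ?B"
    by (rule group_homomorphism_hom_relboundary)
  then interpret h: group_hom ?A ?B "hom_relboundary p X S T"
    by (simp add: group_hom_axioms_def group_hom_def)
  have 1: "kernel ?A ?B (hom_relboundary p X S T) =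
      hom_induced p X T X S id ` carrier (relative_homology_group p X T)"
    using homology_exactness_triple_1[OF assms(1), of p X] by simp
  have 2: "kernel ?B (relative_homology_group (p - 1) X T) (hom_induced (p - 1) (subtopology X S) T X T id) =
      hom_relboundary p X S T ` carrier ?A"
    using homology_exactness_triple_2[OF assms(1), of p X] by simp
  have "kernel ?B (relative_homology_group (p - 1) X T) (hom_induced (p - 1) (subtopology X S) T X T id)
      = carrier ?B"
    using assms(3) hom_induced_carrier[of "p-1" "subtopology X S" T X T id]
    by (auto simp: kernel_def trivial_group_def)
  moreover have "hom_induced p X T X S id ` carrier (relative_homology_group p X T) = {\<one>\<^bsub>?A\<^esub>}"
    using assms(2) hom_one[OF hom_induced_hom, of p X T X S id] by (simp add: trivial_group_def)
  ultimately show ?thesis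
    using 1 2 h.inj_on_one_iff by (auto simp: bij_betw_def kernel_def)
qed

text \<open>The two boundary maps are bijective and natural, so the comparison drops one degree
  without losing information. Here lies the degree shift of the suspension.\<close>

lemma hiso_triple:
  assumes f: "continuous_map X Y f" "f \<in> S \<rightarrow> U" "f \<in> T \<rightarrow> V" and "T \<subseteq> S" "V \<subseteq> U"
    and "\<And>p. trivial_group (relative_homology_group p X T)"
    and "\<And>p. trivial_group (relative_homology_group p Y V)"
  shows "hiso (i + 1) X S Y U f \<longleftrightarrow> hiso i (subtopology X S) T (subtopology Y U) V f"
proof -
  have nat: "hom_relboundary (i+1) Y U V \<circ> hom_induced (i+1) X S Y U f =
         hom_induced i (subtopology X S) T (subtopology Y U) V f \<circ> hom_relboundary (i+1) X S T"
    using naturality_hom_induced_relboundary[OF f, of "i+1"] by simp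
  have b1: "bij_betw (hom_relboundary (i+1) X S T) (carrier (relative_homology_group (i+1) X S))
      (carrier (relative_homology_group i (subtopology X S) T))"
    using bij_hom_relboundary[of T S "i+1" X] assms by simp
  have b2: "bij_betw (hom_relboundary (i+1) Y U V) (carrier (relative_homology_group (i+1) Y U))
      (carrier (relative_homology_group i (subtopology Y U) V))"
    using bij_hom_relboundary[of V U "i+1" Y] assms by simp
  have pm: "pair_map X S Y U f" "pair_map (subtopology X S) T (subtopology Y U) V f"
    using f by (auto simp: pair_map_def continuous_map_in_subtopology continuous_map_from_subtopology)
  have "bij_betw (hom_induced (i+1) X S Y U f) (carrier (relative_homology_group (i+1) X S)) (carrier (relative_homology_group (i+1) Y U))
     \<longleftrightarrow> bij_betw (hom_relboundary (i+1) Y U V \<circ> hom_induced (i+1) X S Y U f) (carrier (relative_homology_group (i+1) X S))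
      (carrier (relative_homology_group i (subtopology Y U) V))"
    by (rule bij_betw_comp_iff2[OF b2]) (auto simp: hom_induced_carrier)
  also have "\<dots> \<longleftrightarrow> bij_betw (hom_induced i (subtopology X S) T (subtopology Y U) V f)
     (carrier (relative_homology_group i (subtopology X S) T)) (carrier (relative_homology_group i (subtopology Y U) V))"
    unfolding nat by (rule bij_betw_comp_iff[OF b1, symmetric])
  finally show ?thesis
    using pm by (simp add: hiso_iff_bij)
qed

section \<open>Suspension\<close>

text \<open>
  The complement of \<open>(X - A) \<times> {z}\<close> in \<open>X \<times> V\<close>: for \<open>V = \<real>\<^sup>m\<close> and \<open>z = 0\<close> this makes
  \<open>(X \<times> V, nz X A V z)\<close> the \<open>m\<close>-fold suspension of \<open>(X, A)\<close>.
\<close>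

definition nz :: "'a topology \<Rightarrow> 'a set \<Rightarrow> 'b topology \<Rightarrow> 'b \<Rightarrow> ('a \<times> 'b) set" where
  "nz X A V z = {(x, v). x \<in> topspace X \<and> v \<in> topspace V \<and> (x \<in> A \<or> v \<noteq> z)}"

lemma nz_subset: "nz X A V z \<subseteq> topspace (prod_topology X V)"
  by (auto simp: nz_def)

lemma openin_nz:
  assumes "openin X A" "closedin V {z}"
  shows "openin (prod_topology X V) (nz X A V z)"
proof -
  have "nz X A V z = A \<times> topspace V \<union> topspace X \<times> (topspace V - {z})"
    using openin_subset[OF assms(1)] by (auto simp: nz_def)
  moreover have "openin V (topspace V - {z})"
    using assms by blast
  ultimately show ?thesis
    using assms by (auto intro!: openin_Un simp: openin_prod_Times_iff)
qed

lemma continuous_map_map_prod_id: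
  "continuous_map X X' f \<Longrightarrow> continuous_map (prod_topology X V) (prod_topology X' V) (map_prod f id)"
  by (simp add: map_prod_def case_prod_unfold continuous_map_paired continuous_map_fst_of[unfolded comp_def]
      continuous_map_snd continuous_map_of_fst[unfolded comp_def])

lemma pair_map_nz:
  assumes "continuous_map X X' f" "f \<in> A \<rightarrow> A'"
  shows "pair_map (prod_topology X V) (nz X A V z) (prod_topology X' V) (nz X' A' V z) (map_prod f id)"
  using assms continuous_map_map_prod_id[OF assms(1), of V]
  by (fastforce simp: pair_map_def nz_def continuous_map_def)

lemma homotopic_with_straight:
  fixes a b :: "'a \<times> real \<Rightarrow> real"
  assumes f: "continuous_map Y euclideanreal a" "continuous_map Y euclideanreal b"
    and Y: "Y = subtopology (prod_topology X euclideanreal) Z"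
    and Z: "\<And>z s. z \<in> topspace Y \<Longrightarrow> 0 \<le> s \<Longrightarrow> s \<le> 1 \<Longrightarrow> (fst z, (1 - s) * a z + s * b z) \<in> Z"
    and P: "\<And>s. 0 \<le> s \<Longrightarrow> s \<le> 1 \<Longrightarrow> P (\<lambda>z. (fst z, (1 - s) * a z + s * b z))"
  shows "homotopic_with P Y Y (\<lambda>z. (fst z, a z)) (\<lambda>z. (fst z, b z))"
proof -
  let ?h = "\<lambda>(s::real, z). (fst z, (1 - s) * a z + s * b z)"
  let ?T = "prod_topology (top_of_set {0..1::real}) Y"
  have s: "continuous_map ?T euclideanreal (\<lambda>p. fst p)"
    using continuous_map_fst[of "top_of_set {0..1::real}" Y] by (simp add: continuous_map_in_subtopology)
  have ab: "continuous_map ?T euclideanreal (\<lambda>p. a (snd p))" "continuous_map ?T euclideanreal (\<lambda>p. b (snd p))"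
    using f continuous_map_of_snd[of "top_of_set {0..1::real}" Y] by (auto simp: comp_def)
  have X: "continuous_map Y X fst"
    unfolding Y by (rule continuous_map_from_subtopology[OF continuous_map_fst])
  have "continuous_map ?T X (\<lambda>p. fst (snd p))"
    using X continuous_map_of_snd[of "top_of_set {0..1::real}" Y] by (auto simp: comp_def)
  then have "continuous_map ?T (prod_topology X euclideanreal) ?h"
    unfolding case_prod_unfold using s ab
    by (auto simp: continuous_map_paired intro!: continuous_map_add continuous_map_real_mult continuous_map_diff)
  then have "continuous_map ?T Y ?h"
    using Z unfolding Y by (auto simp: continuous_map_in_subtopology)
  then show ?thesis
    unfolding homotopic_with_def using P by (intro exI[of _ ?h]) auto
qed

text \<open>One family covers every piece of the suspension argument: \<open>t \<noteq> 0\<close>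
  gives the suspended subspace, \<open>t < 0\<close> and \<open>t > 0\<close> its two halves, and
  the predicate \<open>False\<close> the cylinder over \<open>A\<close>.\<close>

definition wedge :: "(real \<Rightarrow> bool) \<Rightarrow> 'a topology \<Rightarrow> 'a set \<Rightarrow> ('a \<times> real) set" where
  "wedge P X A = {(x, t). x \<in> topspace X \<and> (x \<in> A \<or> P t)}"

lemma wedge_eq_nz: "wedge (\<lambda>t. t \<noteq> 0) X A = nz X A euclideanreal 0"
  by (auto simp: wedge_def nz_def)

lemma openin_wedge:
  assumes "openin X A" "open (Collect P)"
  shows "openin (prod_topology X euclideanreal) (wedge P X A)"
proof -
  have "wedge P X A = A \<times> UNIV \<union> topspace X \<times> Collect P"
    using openin_subset[OF assms(1)] by (auto simp: wedge_def)
  then show ?thesis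
    using assms by (auto intro!: openin_Un simp: openin_prod_Times_iff)
qed

lemma homotopic_wedge:
  fixes a :: "real \<Rightarrow> real"
  assumes "continuous_on UNIV a" and T: "\<And>x. T x \<Longrightarrow> Q x"
    and a: "\<And>s t. 0 \<le> s \<Longrightarrow> s \<le> 1 \<Longrightarrow> Q t \<Longrightarrow> Q ((1 - s) * a t + s * t)"
      "\<And>s t. 0 \<le> s \<Longrightarrow> s \<le> 1 \<Longrightarrow> T t \<Longrightarrow> T ((1 - s) * a t + s * t)"
  shows "homotopic_with (\<lambda>h. h \<in> wedge T X A \<rightarrow> wedge T X A)
     (subtopology (prod_topology X euclideanreal) (wedge Q X A))
     (subtopology (prod_topology X euclideanreal) (wedge Q X A)) (\<lambda>(x, t). (x, a t)) id"
proof -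
  let ?Y = "subtopology (prod_topology X euclideanreal) (wedge Q X A)"
  have snd: "continuous_map ?Y euclideanreal snd"
    by (rule continuous_map_from_subtopology[OF continuous_map_snd])
  have "homotopic_with (\<lambda>h. h \<in> wedge T X A \<rightarrow> wedge T X A) ?Y ?Y (\<lambda>z. (fst z, a (snd z))) (\<lambda>z. (fst z, snd z))"
  proof (rule homotopic_with_straight[OF _ snd refl])
    show "continuous_map ?Y euclideanreal (\<lambda>z. a (snd z))"
      using continuous_map_compose[OF snd, of euclidean a] assms(1) by (simp add: comp_def)
  qed (use a in \<open>auto simp: wedge_def\<close>)
  then show ?thesis
    by (simp add: case_prod_unfold id_def)
qed

text \<open>Lowering all heights to at most -1 carries the whole space into the lower half. The
  straight homotopy back to the identity keeps negative heights negative, so it also deforms the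
  subspace within itself.\<close>

lemma trivial_wedge:
  "trivial_group (relative_homology_group p (prod_topology X euclideanreal) (wedge (\<lambda>t. t < 0) X A))"
proof (rule trivial_relative_homology_group_gen)
  let ?Y = "prod_topology X euclideanreal" and ?Z = "wedge (\<lambda>t. t < 0) X A"
  let ?a = "\<lambda>t::real. min t (- 1)"
  let ?f = "\<lambda>(x, t). (x, ?a t)"
  have c: "continuous_on UNIV ?a"
    by (intro continuous_intros)
  have neg: "(1 - s) * min t (- 1) + s * t < 0" if "0 \<le> s" "s \<le> 1" "t < 0" for s t :: real
  proof -
    have "(1 - s) * min t (- 1) \<le> (1 - s) * t"
      using that by (intro mult_left_mono) auto
    then show ?thesis
      using that by (auto simp: algebra_simps)
  qed
  have "homotopic_with (\<lambda>h. h \<in> ?Z \<rightarrow> ?Z) (subtopology ?Y ?Z) (subtopology ?Y ?Z) ?f id"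
    using homotopic_wedge[OF c, of "\<lambda>t. t < 0" "\<lambda>t. t < 0" X A] neg by simp
  then show "homotopic_with (\<lambda>h. True) (subtopology ?Y ?Z) (subtopology ?Y ?Z) ?f id"
    by (rule homotopic_with_mono) auto
  have top: "subtopology ?Y (wedge (\<lambda>t. True) X A) = ?Y"
    by (rule subtopology_superset) (auto simp: wedge_def)
  have "homotopic_with (\<lambda>h. h \<in> ?Z \<rightarrow> ?Z) ?Y ?Y ?f id"
    using homotopic_wedge[OF c, of "\<lambda>t. t < 0" "\<lambda>t. True" X A] neg by (simp add: top)
  then show 2: "homotopic_with (\<lambda>h. True) ?Y ?Y ?f id"
    by (rule homotopic_with_mono) auto
  show "continuous_map ?Y (subtopology ?Y ?Z) ?f"
    using homotopic_with_imp_continuous_maps[OF 2]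
    by (auto simp: continuous_map_in_subtopology wedge_def)
qed

text \<open>The part of the lower half off \<open>A\<close> is excised. Openness of \<open>A\<close>
  makes this part closed in the ambient piece and the lower half open, so that closure and interior
  need no shrinking.\<close>

lemma hiso_wedge_excision:
  assumes "openin X A"
  shows "hiso i (subtopology (prod_topology X euclideanreal) (wedge (\<lambda>t. t > 0) X A)) (wedge (\<lambda>t. False) X A)
     (subtopology (prod_topology X euclideanreal) (wedge (\<lambda>t. t \<noteq> 0) X A)) (wedge (\<lambda>t. t < 0) X A) id"
proof -
  let ?Y = "prod_topology X euclideanreal"
  let ?N = "wedge (\<lambda>t. t \<noteq> 0) X A" and ?L = "wedge (\<lambda>t. t < 0) X A"
  let ?Z = "subtopology ?Y ?N"
  define U where "U = (topspace X - A) \<times> {t::real. t < 0}"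
  have top: "topspace ?Z = ?N"
    by (auto simp: wedge_def)
  have "closedin ?Y ((topspace X - A) \<times> {..0})"
    using assms closedin_diff[OF closedin_topspace assms] by (simp add: closedin_prod_Times_iff)
  then have "closedin ?Z (?N \<inter> ((topspace X - A) \<times> {..0}))"
    by (rule closedin_subtopology_Int_closed)
  \<comment> \<open>Off \<open>A\<close> the height 0 is missing, so the closed and the open lower
    half-line have the same trace.\<close>
  moreover have "?N \<inter> ((topspace X - A) \<times> {..0}) = U"
    by (auto simp: wedge_def U_def)
  ultimately have U: "?Z closure_of U = U"
    by (simp add: closure_of_closedin)
  have "openin ?Y ?L"
    using openin_wedge[OF assms, of "\<lambda>t. t < 0"] by (simp add: open_Collect_less)
  then have "openin ?Z (?N \<inter> ?L)"
    by (rule openin_subtopology_Int2)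
  moreover have NL: "?N \<inter> ?L = ?L"
    by (auto simp: wedge_def)
  ultimately have L: "?Z interior_of ?L = ?L"
    by (simp add: interior_of_openin)
  have "U \<subseteq> ?L"
    by (auto simp: wedge_def U_def)
  then have *: "hom_induced i (subtopology ?Z (?N - U)) (?L - U) (subtopology ?Z ?N) ?L id
    \<in> iso (relative_homology_group i (subtopology ?Z (?N - U)) (?L - U))
          (relative_homology_group i (subtopology ?Z ?N) ?L)"
    using NL by (intro homology_excision_axiom) (auto simp: U L)
  have eq: "?N - U = wedge (\<lambda>t. t > 0) X A" "?L - U = wedge (\<lambda>t. False) X A"
    "?N \<inter> wedge (\<lambda>t. t > 0) X A = wedge (\<lambda>t. t > 0) X A"
    using openin_subset[OF assms] by (auto simp: wedge_def U_def)
  have "hom_induced i (subtopology ?Y (wedge (\<lambda>t. t > 0) X A)) (wedge (\<lambda>t. False) X A) ?Z ?L id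
    \<in> iso (relative_homology_group i (subtopology ?Y (wedge (\<lambda>t. t > 0) X A)) (wedge (\<lambda>t. False) X A))
          (relative_homology_group i ?Z ?L)"
    using * by (simp add: eq subtopology_subtopology)
  then show ?thesis
    using eq by (auto simp: hiso_def pair_map_def continuous_map_in_subtopology
        continuous_map_from_subtopology wedge_def)
qed

text \<open>The upper half deforms to height 1 along vertical segments, which stay at positive
  height.\<close>

lemma hiso_wedge_level:
  "hiso i X A (subtopology (prod_topology X euclideanreal) (wedge (\<lambda>t. t > 0) X A)) (wedge (\<lambda>t. False) X A)
     (\<lambda>x. (x, 1))" if A: "A \<subseteq> topspace X"
proof (rule hiso_homotopy_equivalence[where g = fst])
  let ?Z = "subtopology (prod_topology X euclideanreal) (wedge (\<lambda>t. t > 0) X A)"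
  show "continuous_map X ?Z (\<lambda>x. (x, 1))"
    by (auto simp: continuous_map_in_subtopology continuous_map_paired wedge_def)
  show "continuous_map ?Z X fst"
    by (rule continuous_map_from_subtopology[OF continuous_map_fst])
  show "homotopic_with (\<lambda>k. k \<in> wedge (\<lambda>t. False) X A \<rightarrow> wedge (\<lambda>t. False) X A) ?Z ?Z ((\<lambda>x. (x, 1)) \<circ> fst) id"
  proof -
    have "0 < 1 - s + s * t" if "0 \<le> s" "s \<le> 1" "0 < t" for s t :: real
      using that by (cases "s = 0") (auto intro: add_nonneg_pos)
    then have "homotopic_with (\<lambda>k. k \<in> wedge (\<lambda>t. False) X A \<rightarrow> wedge (\<lambda>t. False) X A) ?Z ?Z (\<lambda>(x,t). (x, 1)) id"
      using homotopic_wedge[of "\<lambda>t. 1" "\<lambda>t. False" "\<lambda>t. t > 0" X A] by simp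
    then show ?thesis
      by (simp add: comp_def case_prod_unfold)
  qed
  show "homotopic_with (\<lambda>h. h \<in> A \<rightarrow> A) X X (fst \<circ> (\<lambda>x. (x, 1))) id"
    by (rule homotopic_with_equal) (auto simp: comp_def)
qed (use A in \<open>auto simp: wedge_def\<close>)

text \<open>A triple boundary, an excision and a retraction lead from the suspended pair to
  \<open>(X, A)\<close>. All three are natural in \<open>f\<close>; only the first changes the
  degree.\<close>

lemma susp_real:
  assumes A: "openin X A" "openin X' A'" and f: "continuous_map X X' f" "f \<in> A \<rightarrow> A'"
  shows "hiso (i + 1) (prod_topology X euclideanreal) (nz X A euclideanreal 0)
      (prod_topology X' euclideanreal) (nz X' A' euclideanreal 0) (map_prod f id) \<longleftrightarrow> hiso i X A X' A' f"
proof -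
  let ?R = "\<lambda>X. prod_topology X euclideanreal"
  let ?F = "map_prod f (id :: real \<Rightarrow> real)"
  have sub: "A \<subseteq> topspace X" "A' \<subseteq> topspace X'"
    using A by (simp_all add: openin_subset)
  have fX: "f x \<in> topspace X'" if "x \<in> topspace X" for x
    using f(1) that by (auto simp: continuous_map_def)
  have F: "continuous_map (?R X) (?R X') ?F"
    by (rule continuous_map_map_prod_id[OF f(1)])
  have FW: "?F \<in> wedge P X A \<rightarrow> wedge P X' A'" for P
    using f fX by (auto simp: wedge_def)
  have pm: "pair_map (subtopology (?R X) (wedge P X A)) (wedge Q X A)
       (subtopology (?R X') (wedge P X' A')) (wedge Q X' A') ?F" for P Q
    using F FW[of P] FW[of Q]
    by (auto simp: pair_map_def continuous_map_in_subtopology continuous_map_from_subtopology)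
  have "hiso (i + 1) (?R X) (wedge (\<lambda>t. t \<noteq> 0) X A) (?R X') (wedge (\<lambda>t. t \<noteq> 0) X' A') ?F \<longleftrightarrow>
     hiso i (subtopology (?R X) (wedge (\<lambda>t. t \<noteq> 0) X A)) (wedge (\<lambda>t. t < 0) X A)
       (subtopology (?R X') (wedge (\<lambda>t. t \<noteq> 0) X' A')) (wedge (\<lambda>t. t < 0) X' A') ?F"
    by (rule hiso_triple[OF F FW FW _ _ trivial_wedge trivial_wedge]) (auto simp: wedge_def)
  also have "\<dots> \<longleftrightarrow> hiso i (subtopology (?R X) (wedge (\<lambda>t. t > 0) X A)) (wedge (\<lambda>t. False) X A)
       (subtopology (?R X') (wedge (\<lambda>t. t > 0) X' A')) (wedge (\<lambda>t. False) X' A') ?F"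
    by (rule hiso_square[symmetric, OF pm pm hiso_wedge_excision hiso_wedge_excision]) (use A in auto)
  also have "\<dots> \<longleftrightarrow> hiso i X A X' A' f"
    by (rule hiso_square[symmetric, OF _ pm hiso_wedge_level hiso_wedge_level])
      (use f sub in \<open>auto simp: pair_map_def\<close>)
  finally show ?thesis
    by (simp add: wedge_eq_nz)
qed

text \<open>A point of a product differs from \<open>(z1, z2)\<close> exactly if one of its
  coordinates does. Hence \<open>nz\<close> over a product is an iterated \<open>nz\<close>, and
  suspensions can be taken one coordinate at a time.\<close>

lemma hiso_nz_split:
  assumes h: "homeomorphic_map V (prod_topology V1 V2) h" and z: "z \<in> topspace V" "h z = (z1, z2)"
    and f: "continuous_map X X' f" "f \<in> A \<rightarrow> A'" "A \<subseteq> topspace X" "A' \<subseteq> topspace X'"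
  shows "hiso i (prod_topology X V) (nz X A V z) (prod_topology X' V) (nz X' A' V z) (map_prod f id) \<longleftrightarrow>
     hiso i (prod_topology (prod_topology X V1) V2) (nz (prod_topology X V1) (nz X A V1 z1) V2 z2)
       (prod_topology (prod_topology X' V1) V2) (nz (prod_topology X' V1) (nz X' A' V1 z1) V2 z2)
       (map_prod (map_prod f id) id)"
proof -
  obtain g where g: "homeomorphic_maps V (prod_topology V1 V2) h g"
    using h homeomorphic_map_maps by blast
  have hc: "continuous_map V (prod_topology V1 V2) h" "continuous_map (prod_topology V1 V2) V g"
    and gh: "\<And>v. v \<in> topspace V \<Longrightarrow> g (h v) = v" "\<And>w. w \<in> topspace (prod_topology V1 V2) \<Longrightarrow> h (g w) = w"
    using g by (auto simp: homeomorphic_maps_def)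
  have hV: "v \<in> topspace V \<Longrightarrow> h v \<in> topspace V1 \<times> topspace V2"
    "w \<in> topspace V1 \<times> topspace V2 \<Longrightarrow> g w \<in> topspace V" for v w
    using hc by (auto simp: continuous_map_def Pi_iff)
  have key: "hiso i (prod_topology X V) (nz X A V z) (prod_topology (prod_topology X V1) V2)
     (nz (prod_topology X V1) (nz X A V1 z1) V2 z2) (\<lambda>(x, v). ((x, fst (h v)), snd (h v)))"
    if sub: "A \<subseteq> topspace X" for X :: "'x topology" and A
  proof (rule hiso_homeomorphism)
    let ?P = "\<lambda>(x, v). ((x, fst (h v)), snd (h v))" and ?Q = "\<lambda>((x, v1), v2). (x, g (v1, v2))"
    let ?S = "prod_topology X V" and ?T = "prod_topology (prod_topology X V1) V2"
    have "homeomorphic_maps ?S ?T ?P ?Q"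
      unfolding homeomorphic_maps_def
    proof (intro conjI ballI)
      have "continuous_map ?S (prod_topology V1 V2) (\<lambda>p. h (snd p))"
        using continuous_map_compose[OF continuous_map_snd hc(1)] by (simp add: comp_def)
      then have "continuous_map ?S V1 (\<lambda>p. fst (h (snd p)))" "continuous_map ?S V2 (\<lambda>p. snd (h (snd p)))"
        using continuous_map_compose[OF _ continuous_map_fst] continuous_map_compose[OF _ continuous_map_snd]
        unfolding comp_def by blast+
      then show "continuous_map ?S ?T ?P"
        by (simp add: case_prod_unfold continuous_map_paired continuous_map_fst)
      have c1: "continuous_map ?T X (\<lambda>p. fst (fst p))" "continuous_map ?T V1 (\<lambda>p. snd (fst p))"
        using continuous_map_compose[OF continuous_map_fst continuous_map_fst]
          continuous_map_compose[OF continuous_map_fst continuous_map_snd]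
        unfolding comp_def by blast+
      have c2: "continuous_map ?T V (\<lambda>p. g (snd (fst p), snd p))"
        by (rule continuous_map_compose[OF _ hc(2), unfolded comp_def])
          (simp add: continuous_map_paired c1 continuous_map_snd)
      show "continuous_map ?T ?S ?Q"
        using c1 c2 by (simp add: case_prod_unfold continuous_map_paired)
    qed (use gh hV in \<open>auto simp: \<close>)
    then show "homeomorphic_map ?S ?T ?P"
      using homeomorphic_map_maps by blast
    show "?P ` nz X A V z = nz (prod_topology X V1) (nz X A V1 z1) V2 z2"
    proof safe
      fix x v assume "(x, v) \<in> nz X A V z"
      then have *: "x \<in> topspace X" "v \<in> topspace V" "x \<in> A \<or> v \<noteq> z"
        by (auto simp: nz_def)
      moreover have "x \<in> A \<or> h v \<noteq> (z1, z2)"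
        using * gh(1) z by metis
      ultimately show "((x, fst (h v)), snd (h v)) \<in> nz (prod_topology X V1) (nz X A V1 z1) V2 z2"
        using hV(1)[of v] by (auto simp: nz_def mem_Times_iff prod_eq_iff)
    next
      fix x v1 v2 assume "((x, v1), v2) \<in> nz (prod_topology X V1) (nz X A V1 z1) V2 z2"
      then have "x \<in> topspace X" "v1 \<in> topspace V1" "v2 \<in> topspace V2" "x \<in> A \<or> (v1, v2) \<noteq> (z1, z2)"
        by (auto simp: nz_def)
      then have "(x, g (v1, v2)) \<in> nz X A V z" "?P (x, g (v1, v2)) = ((x, v1), v2)"
        using hV(2)[of "(v1, v2)"] gh(2)[of "(v1, v2)"] z by (auto simp: nz_def)
      from this(2)[symmetric] this(1) show "((x, v1), v2) \<in> ?P ` nz X A V z"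
        by (rule image_eqI)
    qed
  qed (rule nz_subset)
  show ?thesis
  proof (rule hiso_square[OF _ _ key key])
    show "pair_map (prod_topology X V) (nz X A V z) (prod_topology X' V) (nz X' A' V z) (map_prod f id)"
      by (rule pair_map_nz[OF f(1,2)])
    have "map_prod f id \<in> nz X A V1 z1 \<rightarrow> nz X' A' V1 z1"
      using pair_map_nz[OF f(1,2), of V1 z1] nz_subset[of X A V1 z1] by (auto simp: pair_map_def)
    then show "pair_map (prod_topology (prod_topology X V1) V2) (nz (prod_topology X V1) (nz X A V1 z1) V2 z2)
       (prod_topology (prod_topology X' V1) V2) (nz (prod_topology X' V1) (nz X' A' V1 z1) V2 z2)
       (map_prod (map_prod f id) id)"
      by (intro pair_map_nz continuous_map_map_prod_id f)
  qed (use f in auto)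
qed

lemma homeomorphic_map_Re_Im:
  "homeomorphic_map (euclidean :: complex topology) (prod_topology euclideanreal euclideanreal) (\<lambda>w. (Re w, Im w))"
proof -
  have "homeomorphic_maps (euclidean :: complex topology) (prod_topology euclideanreal euclideanreal)
     (\<lambda>w. (Re w, Im w)) (\<lambda>(a, b). Complex a b)"
    unfolding homeomorphic_maps_def
    by (auto simp: continuous_map_paired case_prod_unfold euclidean_product_topology complex_eq_iff Complex_eq
        intro!: continuous_intros)
  then show ?thesis
    using homeomorphic_map_maps by blast
qed

lemma susp_complex:
  assumes A: "openin X A" "openin X' A'" and f: "continuous_map X X' f" "f \<in> A \<rightarrow> A'"
  shows "hiso (i + 2) (prod_topology X (euclidean :: complex topology)) (nz X A euclidean 0)
      (prod_topology X' euclidean) (nz X' A' euclidean 0) (map_prod f id) \<longleftrightarrow> hiso i X A X' A' f"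
proof -
  have "map_prod f id \<in> nz X A euclideanreal 0 \<rightarrow> nz X' A' euclideanreal 0"
    using pair_map_nz[OF f, of euclideanreal 0] nz_subset[of X A euclideanreal 0] by (auto simp: pair_map_def)
  moreover have "A \<subseteq> topspace X" "A' \<subseteq> topspace X'"
    using A by (simp_all add: openin_subset)
  ultimately show ?thesis
    using susp_real[of "prod_topology X euclideanreal" "nz X A euclideanreal 0" "prod_topology X' euclideanreal"
        "nz X' A' euclideanreal 0" "map_prod f id" "i + 1"] susp_real[OF assms, of i]
    by (subst hiso_nz_split[OF homeomorphic_map_Re_Im])
      (auto simp: f A openin_nz continuous_map_map_prod_id add.commute)
qed

text \<open>Start of the inductions over coordinates: over a single point, \<open>nz\<close> is just
  a copy of \<open>A\<close>.\<close>

lemma susp_point: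
  assumes V: "topspace V = {z}" and f: "continuous_map X X' f" "f \<in> A \<rightarrow> A'"
    and sub: "A \<subseteq> topspace X" "A' \<subseteq> topspace X'"
  shows "hiso i (prod_topology X V) (nz X A V z) (prod_topology X' V) (nz X' A' V z) (map_prod f id)
     \<longleftrightarrow> hiso i X A X' A' f"
proof (rule hiso_square)
  have key: "hiso i (prod_topology X V) (nz X A V z) X A fst"
    if "A \<subseteq> topspace X" for X :: "'x topology" and A
  proof (rule hiso_homeomorphism)
    have "homeomorphic_maps (prod_topology X V) X fst (\<lambda>x. (x, z))"
      using V by (auto simp: homeomorphic_maps_def continuous_map_fst continuous_map_paired)
    then show "homeomorphic_map (prod_topology X V) X fst"
      using homeomorphic_map_maps by blast
    show "fst ` nz X A V z = A"
      using that V by (force simp: nz_def)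
  qed (rule nz_subset)
  show "hiso i (prod_topology X V) (nz X A V z) X A fst" "hiso i (prod_topology X' V) (nz X' A' V z) X' A' fst"
    using key sub by auto
  show "pair_map X A X' A' f"
    using f by (auto simp: pair_map_def)
qed (use pair_map_nz[OF f] in auto)

section \<open>Spaces of monic polynomials\<close>

text \<open>One ambient space for all degrees: arithmetic of polynomials becomes continuous
  coefficient by coefficient, with degrees treated separately as subsets.\<close>

definition poly_topology :: "complex poly topology" where
  "poly_topology = pullback_topology UNIV coeff (product_topology (\<lambda>_. euclidean) UNIV)"

lemma topspace_poly_topology [simp]: "topspace poly_topology = UNIV"
  by (auto simp: poly_topology_def topspace_pullback_topology)

lemma continuous_map_coeff: "continuous_map poly_topology euclidean (\<lambda>p. coeff p i)"
proof -
  have "continuous_map poly_topology euclidean ((\<lambda>c. c i) \<circ> coeff)"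
    unfolding poly_topology_def
    by (rule continuous_map_pullback) (rule continuous_map_product_projection, simp)
  then show ?thesis
    by (simp add: comp_def)
qed

lemma continuous_map_into_poly:
  "continuous_map X poly_topology f \<longleftrightarrow> (\<forall>i. continuous_map X euclidean (\<lambda>x. coeff (f x) i))"
proof
  assume "continuous_map X poly_topology f"
  then show "\<forall>i. continuous_map X euclidean (\<lambda>x. coeff (f x) i)"
    using continuous_map_compose[OF _ continuous_map_coeff] by (auto simp: comp_def)
next
  assume "\<forall>i. continuous_map X euclidean (\<lambda>x. coeff (f x) i)"
  then show "continuous_map X poly_topology f"
    unfolding poly_topology_def
    by (intro continuous_map_pullback') (auto simp: continuous_map_componentwise_UNIV comp_def)
qed

lemma continuous_map_complex_mult:
  fixes f g :: "'a \<Rightarrow> complex"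
  shows "continuous_map X euclidean f \<Longrightarrow> continuous_map X euclidean g \<Longrightarrow>
    continuous_map X euclidean (\<lambda>x. f x * g x)"
  by (simp add: continuous_map_atin tendsto_mult)

lemma continuous_map_complex_sum:
  fixes f :: "'i \<Rightarrow> 'a \<Rightarrow> complex"
  shows "finite I \<Longrightarrow> (\<And>i. i \<in> I \<Longrightarrow> continuous_map X euclidean (f i)) \<Longrightarrow>
    continuous_map X euclidean (\<lambda>x. \<Sum>i\<in>I. f i x)"
  by (induction rule: finite_induct) (auto intro: continuous_map_add)

lemma continuous_map_poly_mult:
  "continuous_map X poly_topology f \<Longrightarrow> continuous_map X poly_topology g \<Longrightarrow>
    continuous_map X poly_topology (\<lambda>x. f x * g x)"
  by (auto simp: continuous_map_into_poly coeff_mult intro!: continuous_map_complex_sum continuous_map_complex_mult)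

lemma continuous_map_poly_add:
  "continuous_map X poly_topology f \<Longrightarrow> continuous_map X poly_topology g \<Longrightarrow>
    continuous_map X poly_topology (\<lambda>x. f x + g x)"
  by (auto simp: continuous_map_into_poly intro!: continuous_map_add)

lemma continuous_map_poly_diff:
  "continuous_map X poly_topology f \<Longrightarrow> continuous_map X poly_topology g \<Longrightarrow>
    continuous_map X poly_topology (\<lambda>x. f x - g x)"
  by (auto simp: continuous_map_into_poly intro!: continuous_map_diff)

lemma continuous_map_poly_sum:
  "finite I \<Longrightarrow> (\<And>i. i \<in> I \<Longrightarrow> continuous_map X poly_topology (f i)) \<Longrightarrow>
    continuous_map X poly_topology (\<lambda>x. \<Sum>i\<in>I. f i x)"
  by (auto simp: continuous_map_into_poly coeff_sum intro!: continuous_map_complex_sum)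

lemma continuous_map_monom:
  "continuous_map X euclidean c \<Longrightarrow> continuous_map X poly_topology (\<lambda>x. monom (c x) k)"
  by (auto simp: continuous_map_into_poly)

definition monic :: "nat \<Rightarrow> complex poly set" where
  "monic d = {p. degree p = d \<and> lead_coeff p = 1}"

lemma topspace_monic [simp]: "topspace (monic_polys d) = monic d"
  by (simp add: topspace_monic_polys monic_def)

lemma monic_nonzero: "p \<in> monic d \<Longrightarrow> p \<noteq> 0"
  by (auto simp: monic_def)

lemma coeff_monic: "p \<in> monic d \<Longrightarrow> coeff p d = 1" "p \<in> monic d \<Longrightarrow> i > d \<Longrightarrow> coeff p i = 0"
  by (auto simp: monic_def coeff_eq_0)

lemma monic_mult: "p \<in> monic a \<Longrightarrow> q \<in> monic b \<Longrightarrow> p * q \<in> monic (a + b)"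
  by (cases "p = 0 \<or> q = 0") (auto simp: monic_def degree_mult_eq coeff_mult_degree_sum)

lemma monic_mult_cancel:
  assumes "p \<in> monic a" "p * q \<in> monic (a + b)"
  shows "q \<in> monic b"
proof -
  have p: "degree p = a" "lead_coeff p = 1" "p \<noteq> 0" and pq: "degree (p * q) = a + b" "lead_coeff (p * q) = 1"
    using assms monic_nonzero by (auto simp: monic_def)
  then have q: "q \<noteq> 0"
    by auto
  then have "degree q = b"
    using p pq degree_mult_eq[of p q] by simp
  moreover have "lead_coeff q = 1"
    using pq(2) p(2) by (simp only: lead_coeff_mult mult_1)
  ultimately show ?thesis
    by (simp add: monic_def)
qed

lemma monic_linear: "[:-a, 1:] \<in> monic 1"
  by (simp add: monic_def)

lemma monic_0: "monic 0 = {1}"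
proof -
  have "p = 1" if "degree p = 0" "lead_coeff p = 1" for p :: "complex poly"
    using that degree_0_id[of p] by (simp add: one_pCons)
  then show ?thesis
    by (auto simp: monic_def)
qed

lemma monic_eqI:
  assumes "p \<in> monic d" "q \<in> monic d" "\<And>i. i < d \<Longrightarrow> coeff p i = coeff q i"
  shows "p = q"
proof (rule poly_eqI)
  fix i show "coeff p i = coeff q i"
    using assms coeff_monic[of p d] coeff_monic[of q d] by (cases "i < d"; cases "i = d") auto
qed

lemma monicI:
  assumes "coeff p d = 1" "\<And>i. i > d \<Longrightarrow> coeff p i = 0"
  shows "p \<in> monic d"
proof -
  have "degree p \<le> d"
    using assms(2) by (intro degree_le) auto
  moreover have "d \<le> degree p"
    using assms(1) by (intro le_degree) auto
  ultimately show ?thesis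
    using assms(1) by (simp add: monic_def)
qed

text \<open>On monic polynomials of degree \<open>d\<close> the coefficients from \<open>d\<close>
  on are constant, so the lower ones alone already give the subspace topology.\<close>

lemma continuous_map_into_monic:
  "continuous_map X (monic_polys d) f \<longleftrightarrow> f \<in> topspace X \<rightarrow> monic d \<and> continuous_map X poly_topology f"
proof safe
  assume f: "continuous_map X (monic_polys d) f"
  then show fm: "f x \<in> monic d" if "x \<in> topspace X" for x
    using that by (force simp: continuous_map_def)
  have c: "continuous_map (monic_polys d) euclidean (\<lambda>p. coeff p i)" if "i < d" for i
  proof -
    have "continuous_map (product_topology (\<lambda>_. euclidean) {..<d}) (euclidean :: complex topology) (\<lambda>c. c i)"
      using that by (intro continuous_map_product_coordinates) auto
    then have "continuous_map (monic_polys d) (euclidean :: complex topology) ((\<lambda>c. c i) \<circ> (\<lambda>p. \<lambda>i\<in>{..<d}. coeff p i))"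
      unfolding monic_polys_def by (rule continuous_map_pullback)
    then show ?thesis
      using that by (simp add: comp_def)
  qed
  show "continuous_map X poly_topology f"
    unfolding continuous_map_into_poly
  proof
    fix i
    consider "i < d" | "i = d" | "i > d" by linarith
    then show "continuous_map X euclidean (\<lambda>x. coeff (f x) i)"
    proof cases
      case 1
      then show ?thesis
        using continuous_map_compose[OF f c] by (simp add: comp_def)
    next
      case 2
      show ?thesis
        by (rule continuous_map_eq[of X euclidean "\<lambda>x. 1"]) (simp_all add: 2 coeff_monic(1)[OF fm])
    next
      case 3
      show ?thesis
        by (rule continuous_map_eq[of X euclidean "\<lambda>x. 0"]) (simp_all add: 3 coeff_monic(2)[OF fm])
    qed
  qed
next
  assume f: "f \<in> topspace X \<rightarrow> monic d" "continuous_map X poly_topology f"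
  then have c: "continuous_map X euclidean (\<lambda>x. coeff (f x) i)" for i
    by (simp add: continuous_map_into_poly)
  have "continuous_map X (product_topology (\<lambda>_. euclidean) {..<d}) ((\<lambda>p. \<lambda>i\<in>{..<d}. coeff p i) \<circ> f)"
    unfolding continuous_map_componentwise by (auto simp: c)
  moreover have "topspace X \<subseteq> f -` {p. degree p = d \<and> lead_coeff p = 1}"
    using f(1) unfolding monic_def by blast
  ultimately show "continuous_map X (monic_polys d) f"
    unfolding monic_polys_def by (rule continuous_map_pullback')
qed

lemma topology_eq_id:
  assumes "continuous_map X Y id" "continuous_map Y X id"
  shows "X = Y"
proof -
  have "topspace X = topspace Y"
    using assms by (auto simp: continuous_map_def)
  moreover have "openin Y U \<Longrightarrow> openin X U" "openin X U \<Longrightarrow> openin Y U" for U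
    using openin_continuous_map_preimage[OF assms(1), of U] openin_continuous_map_preimage[OF assms(2), of U]
      openin_subset[of Y U] openin_subset[of X U] calculation by (auto simp: Int_def[symmetric] Int_absorb1 Collect_conj_eq)
  ultimately show ?thesis
    unfolding topology_eq by blast
qed

lemma monic_polys_eq: "monic_polys d = subtopology poly_topology (monic d)"
proof (rule topology_eq_id)
  have "continuous_map (monic_polys d) (monic_polys d) id"
    by (rule continuous_map_id)
  then show "continuous_map (monic_polys d) (subtopology poly_topology (monic d)) id"
    unfolding continuous_map_in_subtopology continuous_map_into_monic by auto
  show "continuous_map (subtopology poly_topology (monic d)) (monic_polys d) id"
    by (simp add: continuous_map_into_monic continuous_map_from_subtopology)
qed

lemma homeomorphic_map_monic_coeffs:
  "homeomorphic_map (monic_polys d) (product_topology (\<lambda>_. euclidean) {..<d}) (\<lambda>p. \<lambda>i\<in>{..<d}. coeff p i)"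
proof (rule homeomorphic_maps_imp_map)
  let ?g = "\<lambda>c::nat \<Rightarrow> complex. monom 1 d + (\<Sum>i<d. monom (c i) i)"
  have coeff_g: "coeff (?g c) i = (if i < d then c i else if i = d then 1 else 0)" for c i
    by (simp add: coeff_sum)
  show "homeomorphic_maps (monic_polys d) (product_topology (\<lambda>_. euclidean) {..<d}) (\<lambda>p. \<lambda>i\<in>{..<d}. coeff p i) ?g"
    unfolding homeomorphic_maps_def
  proof (intro conjI ballI)
    have "continuous_map (monic_polys d) poly_topology id"
      unfolding monic_polys_eq by (simp add: continuous_map_from_subtopology)
    then show "continuous_map (monic_polys d) (product_topology (\<lambda>_. euclidean) {..<d}) (\<lambda>p. \<lambda>i\<in>{..<d}. coeff p i)"
      by (auto simp: continuous_map_componentwise continuous_map_into_poly)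
    have gm: "?g c \<in> monic d" for c
      by (rule monicI) (simp_all only: coeff_g, auto)
    show "continuous_map (product_topology (\<lambda>_. euclidean) {..<d}) (monic_polys d) ?g"
      unfolding continuous_map_into_monic using gm
      by (intro conjI continuous_map_poly_add continuous_map_poly_sum continuous_map_monom)
        (auto intro: continuous_map_product_projection)
    show "?g (\<lambda>i\<in>{..<d}. coeff p i) = p" if "p \<in> topspace (monic_polys d)" for p
      using that by (intro monic_eqI[OF gm]) (simp_all only: coeff_g topspace_monic, auto)
    show "(\<lambda>i\<in>{..<d}. coeff (?g c) i) = c" if "c \<in> topspace (product_topology (\<lambda>_. euclidean) {..<d})" for c
      using that unfolding coeff_g by (auto simp: PiE_def extensional_def fun_eq_iff)
  qed
qed

lemma metrizable_monic_polys: "metrizable_space (monic_polys d)"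
proof -
  have "metrizable_space (product_topology (\<lambda>_. euclidean :: complex topology) {..<d})"
    by (auto simp: metrizable_space_product_topology countable_finite metrizable_space_euclidean)
  then show ?thesis
    using homeomorphic_metrizable_space homeomorphic_map_imp_homeomorphic_space[OF homeomorphic_map_monic_coeffs]
    by blast
qed

lemma locally_compact_monic_polys: "locally_compact_space (monic_polys d)"
proof -
  have "locally_compact_space (product_topology (\<lambda>_. euclidean :: complex topology) {..<d})"
    by (auto simp: locally_compact_space_product_topology locally_compact_space_euclidean)
  then show ?thesis
    using homeomorphic_locally_compact_space homeomorphic_map_imp_homeomorphic_space[OF homeomorphic_map_monic_coeffs]
    by blast
qed

abbreviation tuples :: "nat \<Rightarrow> nat \<Rightarrow> (nat \<Rightarrow> complex poly) topology" where
  "tuples e n \<equiv> product_topology (\<lambda>_. monic_polys e) {..<n}"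

lemma metrizable_tuples: "metrizable_space (tuples e n)"
  by (auto simp: metrizable_space_product_topology metrizable_monic_polys countable_finite)

lemma k_space_tuples: "k_space (tuples e n)"
  by (rule locally_compact_imp_k_space)
    (simp add: locally_compact_space_product_topology locally_compact_monic_polys)

section \<open>Bounds for roots and coefficients, and properness of multiplication\<close>

lemma compactin_monic_box: "compactin (monic_polys d) {p \<in> monic d. \<forall>i<d. norm (coeff p i) \<le> B}"
proof -
  let ?f = "\<lambda>p. \<lambda>i\<in>{..<d}. coeff p i"
  let ?S = "{p \<in> monic d. \<forall>i<d. norm (coeff p i) \<le> B}"
  have im: "?f ` topspace (monic_polys d) = topspace (product_topology (\<lambda>_. euclidean) {..<d})"
    using homeomorphic_imp_surjective_map[OF homeomorphic_map_monic_coeffs] .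
  have "?f ` ?S = PiE {..<d} (\<lambda>_. cball 0 B)"
  proof safe
    fix c :: "nat \<Rightarrow> complex" assume c: "c \<in> PiE {..<d} (\<lambda>_. cball 0 B)"
    then have "c \<in> topspace (product_topology (\<lambda>_. euclidean) {..<d})"
      by auto
    then obtain p where p: "p \<in> monic d" "c = ?f p"
      using im by (metis (no_types, lifting) imageE topspace_monic)
    have "norm (coeff p i) \<le> B" if "i < d" for i
      using c that unfolding p(2) by (auto simp: PiE_def Pi_def)
    with p show "c \<in> ?f ` ?S"
      by auto
  qed (auto split: if_splits)
  moreover have "compactin (product_topology (\<lambda>_. euclidean) {..<d}) (PiE {..<d} (\<lambda>_. cball (0::complex) B))"
    by (simp add: compactin_PiE)
  ultimately show ?thesis
    using homeomorphic_map_compactness[OF homeomorphic_map_monic_coeffs, of ?S d] by auto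
qed

text \<open>Cauchy's bound: at a root outside the unit disc, \<open>z ^ d\<close> equals minus the
  sum of \<open>d\<close> lower terms, each of norm at most
  \<open>B * norm z ^ (d - 1)\<close>.\<close>

lemma monic_root_bound:
  assumes p: "p \<in> monic d" and B: "\<And>i. i < d \<Longrightarrow> norm (coeff p i) \<le> B" and z: "poly p z = 0"
  shows "norm z \<le> 1 + real d * B"
proof (cases "norm z \<le> 1")
  case True
  have "0 \<le> real d * B"
  proof (cases d)
    case (Suc m)
    then have "0 \<le> B"
      using order_trans[OF norm_ge_zero B[of 0]] Suc by simp
    then show ?thesis by simp
  qed simp
  with True show ?thesis by linarith
next
  case False
  then have z1: "norm z > 1" by simp
  have deg: "degree p = d"
    using p by (simp add: monic_def)
  have "poly p z = (\<Sum>i<d. coeff p i * z ^ i) + z ^ d"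
    using coeff_monic(1)[OF p] by (simp add: poly_altdef deg lessThan_Suc_atMost[symmetric])
  then have "z ^ d = - (\<Sum>i<d. coeff p i * z ^ i)"
    using z by (simp add: eq_neg_iff_add_eq_0 add.commute)
  then have "norm z ^ d = norm (\<Sum>i<d. coeff p i * z ^ i)"
    by (metis norm_minus_cancel norm_power)
  also have "\<dots> \<le> (\<Sum>i<d. B * norm z ^ (d - 1))"
  proof (rule sum_norm_le)
    fix i assume "i \<in> {..<d}"
    then have "norm z ^ i \<le> norm z ^ (d - 1)"
      using z1 by (intro power_increasing) auto
    moreover have "norm (coeff p i) \<le> B" "0 \<le> norm z ^ i"
      using B \<open>i \<in> {..<d}\<close> by auto
    ultimately show "norm (coeff p i * z ^ i) \<le> B * norm z ^ (d - 1)"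
      unfolding norm_mult norm_power
      using order_trans[OF norm_ge_zero[of "coeff p i"]] by (intro mult_mono) auto
  qed
  finally have le: "norm z ^ d \<le> real d * B * norm z ^ (d - 1)"
    by (simp add: mult.assoc)
  have "d \<noteq> 0"
    using le by (intro notI) simp
  then have "norm z ^ d = norm z * norm z ^ (d - 1)"
    by (cases d) auto
  then have "norm z * norm z ^ (d - 1) \<le> (real d * B) * norm z ^ (d - 1)"
    using le by simp
  then have "norm z \<le> real d * B"
    by (rule mult_right_le_imp_le) (use z1 in \<open>intro zero_less_power, linarith\<close>)
  then show ?thesis by simp
qed

lemma monic_factor:
  assumes "p \<in> monic (Suc d)"
  obtains a q where "p = [:-a, 1:] * q" "q \<in> monic d"
proof -
  have "\<not> constant (poly p)"
    using assms by (auto simp: monic_def constant_degree)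
  then obtain a where "poly p a = 0"
    using fundamental_theorem_of_algebra by blast
  then obtain q where q: "p = [:-a, 1:] * q"
    by (metis dvdE poly_eq_0_iff_dvd)
  then have "q \<in> monic d"
    using assms monic_mult_cancel[OF monic_linear, of a q d] by simp
  with q that show ?thesis by blast
qed

text \<open>A linear factor with root of norm at most \<open>R\<close> multiplies a common bound on
  all coefficients by at most \<open>1 + R\<close>.\<close>

lemma monic_coeff_bound:
  assumes "p \<in> monic d" "R \<ge> 0" "\<And>z. poly p z = 0 \<Longrightarrow> norm z \<le> R"
  shows "norm (coeff p i) \<le> (1 + R) ^ d"
  using assms
proof (induction d arbitrary: p i)
  case 0
  then show ?case
    by (auto simp: monic_0)
next
  case (Suc d)
  obtain a q where pq: "p = [:-a, 1:] * q" "q \<in> monic d"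
    using monic_factor[OF Suc.prems(1)] by blast
  have R: "norm a \<le> R" "\<And>z. poly q z = 0 \<Longrightarrow> norm z \<le> R"
    using Suc.prems(3) unfolding pq by (simp_all)
  have q: "norm (coeff q j) \<le> (1 + R) ^ d" for j
    using Suc.IH[OF pq(2) \<open>R \<ge> 0\<close>] R(2) by blast
  have pos: "0 \<le> (1 + R) ^ d"
    using \<open>R \<ge> 0\<close> by simp
  have "coeff p i = (case i of 0 \<Rightarrow> 0 | Suc j \<Rightarrow> coeff q j) - a * coeff q i"
    unfolding pq by (cases i) simp_all
  also have "norm \<dots> \<le> (1 + R) ^ d + R * (1 + R) ^ d"
  proof (rule order_trans[OF norm_triangle_ineq4], rule add_mono)
    show "norm (case i of 0 \<Rightarrow> 0 | Suc j \<Rightarrow> coeff q j) \<le> (1 + R) ^ d"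
      using q pos by (cases i) auto
    show "norm (a * coeff q i) \<le> R * (1 + R) ^ d"
      unfolding norm_mult using R q \<open>R \<ge> 0\<close> by (intro mult_mono) auto
  qed
  finally show ?case
    by (simp add: algebra_simps)
qed

text \<open>Bounded coefficients of the product bound its roots, which include the roots of both
  factors, and these bound the coefficients of the factors. The base of the powers is 1 plus the
  root bound.\<close>

lemma monic_divisor_coeff_bound:
  assumes "p \<in> monic a" "q \<in> monic b" and B: "\<And>i. i < a + b \<Longrightarrow> norm (coeff (p * q) i) \<le> B" "B \<ge> 0"
  shows "norm (coeff p i) \<le> (2 + real (a + b) * B) ^ a" "norm (coeff q i) \<le> (2 + real (a + b) * B) ^ b"
proof -
  have pq: "p * q \<in> monic (a + b)"
    using assms by (simp add: monic_mult)
  have r: "norm z \<le> 1 + real (a + b) * B" if "poly p z = 0 \<or> poly q z = 0" for z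
    using monic_root_bound[OF pq B(1), of z] that by auto
  have nn: "0 \<le> 1 + real (a + b) * B"
    using B(2) by simp
  show "norm (coeff p i) \<le> (2 + real (a + b) * B) ^ a"
    using monic_coeff_bound[OF assms(1) nn] r by simp
  show "norm (coeff q i) \<le> (2 + real (a + b) * B) ^ b"
    using monic_coeff_bound[OF assms(2) nn] r by simp
qed

definition tup_mult :: "nat \<Rightarrow> complex poly \<times> (nat \<Rightarrow> complex poly) \<Rightarrow> nat \<Rightarrow> complex poly" where
  "tup_mult n = (\<lambda>(g, h). \<lambda>j\<in>{..<n}. g * h j)"

lemma continuous_map_from_monic:
  "continuous_map X (monic_polys d) f \<Longrightarrow> continuous_map X poly_topology f"
  by (simp add: continuous_map_into_monic)

lemma continuous_map_snd_component:
  assumes "j \<in> I"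
  shows "continuous_map (prod_topology X (product_topology Y I)) (Y j) (\<lambda>p. snd p j)"
  using continuous_map_compose[OF continuous_map_snd continuous_map_product_projection[OF assms]]
  by (simp add: comp_def)

lemma continuous_map_tup_mult:
  "continuous_map (prod_topology (monic_polys k) (tuples m n)) (tuples (k + m) n) (tup_mult n)"
proof -
  let ?X = "prod_topology (monic_polys k) (tuples m n)"
  have "continuous_map ?X (monic_polys (k + m)) (\<lambda>p. fst p * snd p j)" if "j < n" for j
  proof -
    have 1: "continuous_map ?X (monic_polys k) fst"
      by (rule continuous_map_fst)
    have 2: "continuous_map ?X (monic_polys m) (\<lambda>p. snd p j)"
      using that by (intro continuous_map_snd_component) simp
    show ?thesis
      unfolding continuous_map_into_monic
    proof
      show "continuous_map ?X poly_topology (\<lambda>p. fst p * snd p j)"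
        using 1 2 by (intro continuous_map_poly_mult) (auto dest: continuous_map_from_monic)
      show "(\<lambda>p. fst p * snd p j) \<in> topspace ?X \<rightarrow> monic (k + m)"
        using that by (auto intro!: monic_mult simp: PiE_def Pi_def)
    qed
  qed
  then show ?thesis
    by (auto simp: continuous_map_componentwise tup_mult_def case_prod_unfold)
qed

lemma Hausdorff_tuples: "Hausdorff_space (tuples e n)"
  by (rule metrizable_imp_Hausdorff_space[OF metrizable_tuples])

text \<open>Into a Hausdorff k-space, compact preimages of compact sets suffice for properness. They
  lie in a compact box of coefficients because divisors of bounded polynomials are bounded; one
  existing component is enough to bound the common factor.\<close>

lemma proper_map_tup_mult:
  assumes "n > 0"
  shows "proper_map (prod_topology (monic_polys k) (tuples m n)) (tuples (k + m) n) (tup_mult n)"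
proof (rule compact_imp_proper_map)
  let ?X = "prod_topology (monic_polys k) (tuples m n)" and ?Y = "tuples (k + m) n"
  show "k_space ?Y" "kc_space ?Y"
    by (simp_all add: k_space_tuples Hausdorff_imp_kc_space Hausdorff_tuples)
  show c: "continuous_map ?X ?Y (tup_mult n) \<or> kc_space ?X"
    by (simp add: continuous_map_tup_mult)
  show "tup_mult n \<in> topspace ?X \<rightarrow> topspace ?Y"
    using continuous_map_tup_mult by (auto simp: continuous_map_def)
  fix K assume K: "compactin ?Y K"
  have "\<exists>B\<ge>0. \<forall>f\<in>K. \<forall>j<n. \<forall>i<k+m. norm (coeff (f j) i) \<le> B"
  proof -
    have "\<exists>B. \<forall>f\<in>K. norm (coeff (f j) i) \<le> B" if "j < n" for j i
    proof -
      have "continuous_map ?Y poly_topology (\<lambda>f. f j)"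
        using that by (intro continuous_map_from_monic[of _ "k + m"] continuous_map_product_projection) auto
      then have "continuous_map ?Y euclidean (\<lambda>f. coeff (f j) i)"
        by (simp add: continuous_map_into_poly)
      then have "compactin euclidean ((\<lambda>f. coeff (f j) i) ` K)"
        using K image_compactin by blast
      then have "bounded ((\<lambda>f. coeff (f j) i) ` K)"
        by (simp add: compact_imp_bounded)
      then show ?thesis
        by (auto simp: bounded_iff)
    qed
    then obtain b where b: "\<And>j i f. j < n \<Longrightarrow> f \<in> K \<Longrightarrow> norm (coeff (f j) i) \<le> b j i"
      by metis
    \<comment> \<open>Summing the individual bounds gives a single bound for all components and
      coefficients.\<close>
    let ?B = "\<Sum>j<n. \<Sum>i<k+m. \<bar>b j i\<bar>"
    have "norm (coeff (f j) i) \<le> ?B" if "f \<in> K" "j < n" "i < k + m" for f j i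
    proof -
      have "norm (coeff (f j) i) \<le> \<bar>b j i\<bar>"
        using b[OF that(2,1), of i] by linarith
      also have "\<dots> \<le> (\<Sum>i<k+m. \<bar>b j i\<bar>)"
        using that by (intro member_le_sum) auto
      also have "\<dots> \<le> ?B"
        using that by (intro member_le_sum[of j _ "\<lambda>j. \<Sum>i<k+m. \<bar>b j i\<bar>"]) (auto intro: sum_nonneg)
      finally show ?thesis .
    qed
    then show ?thesis
      by (intro exI[of _ ?B]) (auto intro!: sum_nonneg)
  qed
  then obtain B where B: "B \<ge> 0" "\<And>f j i. f \<in> K \<Longrightarrow> j < n \<Longrightarrow> i < k + m \<Longrightarrow> norm (coeff (f j) i) \<le> B"
    by metis
  define C where "C = 2 + real (k + m) * B"
  let ?G = "{p \<in> monic k. \<forall>i<k. norm (coeff p i) \<le> C ^ k}"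
  let ?H = "{p \<in> monic m. \<forall>i<m. norm (coeff p i) \<le> C ^ m}"
  have "compactin (tuples m n) (PiE {..<n} (\<lambda>_. ?H))"
    using compactin_monic_box by (simp add: compactin_PiE)
  then have "compactin ?X (?G \<times> PiE {..<n} (\<lambda>_. ?H))"
    using compactin_monic_box by (simp add: compactin_Times)
  moreover have "{x \<in> topspace ?X. tup_mult n x \<in> K} \<subseteq> ?G \<times> PiE {..<n} (\<lambda>_. ?H)"
  proof clarify
    fix g h assume gh: "(g, h) \<in> topspace ?X" "tup_mult n (g, h) \<in> K"
    then have m: "g \<in> monic k" "\<And>j. j < n \<Longrightarrow> h j \<in> monic m" "h \<in> extensional {..<n}"
      by (auto simp: PiE_def Pi_def)
    have "norm (coeff (g * h j) i) \<le> B" if "j < n" "i < k + m" for i j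
      using B(2)[OF gh(2) that] that by (simp add: tup_mult_def)
    then have *: "norm (coeff g i) \<le> C ^ k" "norm (coeff (h j) i) \<le> C ^ m" if "j < n" for i j
      using monic_divisor_coeff_bound[OF m(1) m(2)[OF that] _ B(1)] that unfolding C_def by blast+
    then show "g \<in> ?G \<and> h \<in> PiE {..<n} (\<lambda>_. ?H)"
      using m assms by (auto simp: PiE_def)
  qed
  moreover have "closedin ?X {x \<in> topspace ?X. tup_mult n x \<in> K}"
    using closedin_continuous_map_preimage[OF continuous_map_tup_mult]
      compactin_imp_closedin[OF Hausdorff_tuples K] by blast
  ultimately show "compactin ?X {x \<in> topspace ?X. tup_mult n x \<in> K}"
    by (rule closed_compactin)
qed

lemma closed_map_tup_mult:
  "n > 0 \<Longrightarrow> closed_map (prod_topology (monic_polys k) (tuples m n)) (tuples (k + m) n) (tup_mult n)"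
  by (intro proper_imp_closed_map proper_map_tup_mult)

section \<open>Greatest common divisors and division with remainder\<close>

text \<open>\<open>Gcd_fin\<close> is normalised, which for a nonzero complex polynomial means
  monic. No unit has to be chosen.\<close>

definition tgcd :: "nat \<Rightarrow> (nat \<Rightarrow> complex poly) \<Rightarrow> complex poly" where
  "tgcd n f = Gcd_fin (f ` {..<n})"

lemma tuples_monic: "f \<in> topspace (tuples e n) \<Longrightarrow> j < n \<Longrightarrow> f j \<in> monic e"
  by (auto simp: PiE_def Pi_def)

lemma tgcd_dvd: "j < n \<Longrightarrow> tgcd n f dvd f j"
  unfolding tgcd_def by (rule Gcd_fin_dvd) auto

lemma dvd_tgcd_iff: "q dvd tgcd n f \<longleftrightarrow> (\<forall>j<n. q dvd f j)"
  unfolding tgcd_def by (subst dvd_Gcd_fin_iff) auto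

lemma normalize_monic: "p \<in> monic d \<Longrightarrow> normalize p = p"
  by (rule unit_factor_1_imp_normalized) (auto simp: monic_def unit_factor_poly_def)

lemma normalized_imp_monic:
  fixes p :: "complex poly"
  assumes "normalize p = p" "p \<noteq> 0"
  shows "p \<in> monic (degree p)"
proof -
  have "unit_factor p = 1"
    using normalize_mult_unit_factor[of p] assms by simp
  then show ?thesis
    using assms(2) by (auto simp: monic_def unit_factor_poly_def one_pCons)
qed

lemma tgcd_monic:
  assumes "f \<in> topspace (tuples e n)" "n > 0"
  shows "tgcd n f \<in> monic (degree (tgcd n f))"
proof (rule normalized_imp_monic)
  show "normalize (tgcd n f) = tgcd n f"
    unfolding tgcd_def by simp
  have "tgcd n f dvd f 0" "f 0 \<noteq> 0"
    using assms tgcd_dvd tuples_monic[of f e n 0] monic_nonzero by auto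
  then show "tgcd n f \<noteq> 0"
    by auto
qed

lemma degree_tgcd_le:
  assumes "f \<in> topspace (tuples e n)" "n > 0"
  shows "degree (tgcd n f) \<le> e"
proof -
  have "f 0 \<in> monic e"
    using tuples_monic[OF assms(1)] assms(2) by auto
  then show ?thesis
    using dvd_imp_degree_le[OF tgcd_dvd[of 0 n f]] assms(2) monic_nonzero[of "f 0" e] by (auto simp: monic_def)
qed

lemma tgcd_tup_mult:
  assumes g: "g \<in> monic k" and h: "h \<in> topspace (tuples m n)" and n: "n > 0"
  shows "tgcd n (tup_mult n (g, h)) = g * tgcd n h"
proof -
  have "tgcd n (tup_mult n (g, h)) = Gcd_fin ((*) g ` (h ` {..<n}))"
    unfolding tgcd_def tup_mult_def by (rule arg_cong[of _ _ Gcd_fin]) (auto simp: image_iff)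
  also have "\<dots> = normalize (g * Gcd_fin (h ` {..<n}))"
    by (rule Gcd_fin_mult) (use n in auto)
  also have "\<dots> = normalize (g * tgcd n h)"
    by (simp add: tgcd_def)
  also have "\<dots> = g * tgcd n h"
    using monic_mult[OF g tgcd_monic[OF h n]] by (rule normalize_monic)
  finally show ?thesis .
qed

text \<open>Stated through the degree of the gcd instead of common roots, so that it is the lowest
  level of the filtration \<open>gcd_le\<close>.\<close>

definition hol :: "nat \<Rightarrow> nat \<Rightarrow> (nat \<Rightarrow> complex poly) set" where
  "hol e n = {f \<in> topspace (tuples e n). degree (tgcd n f) = 0}"

lemma hol_tgcd:
  assumes "f \<in> hol e n" "n > 0"
  shows "tgcd n f = 1"
  using assms tgcd_monic[of f e n] by (simp add: hol_def monic_0)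

text \<open>The roots of the gcd are the common roots, and by the fundamental theorem of algebra a
  gcd of positive degree has one.\<close>

lemma degree_tgcd_0_iff:
  assumes "f \<in> topspace (tuples e n)" "n > 0"
  shows "degree (tgcd n f) = 0 \<longleftrightarrow> \<not> (\<exists>z. \<forall>j<n. poly (f j) z = 0)"
proof -
  have "degree (tgcd n f) \<noteq> 0 \<longleftrightarrow> (\<exists>z. poly (tgcd n f) z = 0)"
  proof
    assume "degree (tgcd n f) \<noteq> 0"
    then show "\<exists>z. poly (tgcd n f) z = 0"
      by (intro fundamental_theorem_of_algebra) (simp add: constant_degree)
  next
    assume z: "\<exists>z. poly (tgcd n f) z = 0"
    show "degree (tgcd n f) \<noteq> 0"
    proof
      assume "degree (tgcd n f) = 0"
      then have "tgcd n f \<in> monic 0"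
        using tgcd_monic[OF assms] by simp
      with z show False
        by (simp add: monic_0)
    qed
  qed
  also have "\<dots> \<longleftrightarrow> (\<exists>z. \<forall>j<n. poly (f j) z = 0)"
    by (simp add: poly_eq_0_iff_dvd dvd_tgcd_iff)
  finally show ?thesis by blast
qed

lemma Hol_eq:
  assumes "n > 0"
  shows "Hol e n = subtopology (tuples e n) (hol e n)"
proof -
  have *: "topspace (tuples e n) \<inter> {f. \<not> (\<exists>z. \<forall>j<n. poly (f j) z = 0)} = topspace (tuples e n) \<inter> hol e n"
    using degree_tgcd_0_iff[OF _ assms, of _ e] by (auto simp: hol_def)
  show ?thesis
    unfolding Hol_def using arg_cong[OF *, of "subtopology (tuples e n)"] by (simp only: subtopology_restrict)
qed

lemma tup_mult_in:
  "g \<in> monic k \<Longrightarrow> h \<in> topspace (tuples m n) \<Longrightarrow> tup_mult n (g, h) \<in> topspace (tuples (k + m) n)"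
  using continuous_map_tup_mult[of k m n] by (auto simp: continuous_map_def Pi_iff)

lemma tup_mult_divisor:
  assumes f: "f \<in> topspace (tuples e n)" and g: "g \<in> monic k" "g dvd tgcd n f" and n: "n > 0"
  obtains h where "h \<in> topspace (tuples (e - k) n)" "f = tup_mult n (g, h)" "k \<le> e"
proof -
  have gf: "g dvd f j" if "j < n" for j
    using g(2) that by (simp add: dvd_tgcd_iff)
  define h where "h = (\<lambda>j\<in>{..<n}. f j div g)"
  have fj: "f j = g * h j" if "j < n" for j
    using gf[OF that] that by (simp add: h_def)
  have "k \<le> e"
    using dvd_imp_degree_le[OF gf[OF n]] tuples_monic[OF f n] g(1) monic_nonzero[of "f 0" e]
    by (auto simp: monic_def)
  then have "h j \<in> monic (e - k)" if "j < n" for j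
    using monic_mult_cancel[OF g(1), of "h j" "e - k"] fj[OF that] tuples_monic[OF f that] by simp
  then have "h \<in> topspace (tuples (e - k) n)"
    by (auto simp: h_def)
  moreover have "f = tup_mult n (g, h)"
    using fj f by (auto simp: tup_mult_def fun_eq_iff PiE_def extensional_def)
  ultimately show ?thesis
    using \<open>k \<le> e\<close> that by blast
qed

text \<open>Over the complex numbers some of the linear factors can be collected into a divisor of
  any smaller degree. Thus a gcd of degree above \<open>k\<close> has a monic divisor of degree
  exactly \<open>Suc k\<close>.\<close>

lemma monic_split:
  "p \<in> monic d \<Longrightarrow> k \<le> d \<Longrightarrow> \<exists>g\<in>monic k. g dvd p"
proof (induction d arbitrary: p k)
  case 0
  then show ?case by (auto simp: monic_0)
next
  case (Suc d)
  obtain a q where pq: "p = [:-a, 1:] * q" "q \<in> monic d"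
    using monic_factor[OF Suc.prems(1)] by blast
  show ?case
  proof (cases k)
    case 0
    then show ?thesis by (auto simp: monic_0)
  next
    case (Suc k')
    then obtain g where g: "g \<in> monic k'" "g dvd q"
      using Suc.IH[OF pq(2), of k'] Suc.prems(2) by auto
    then have "[:-a, 1:] * g \<in> monic k"
      using monic_mult[OF monic_linear g(1), of a] Suc by simp
    moreover have "[:-a, 1:] * g dvd p"
      unfolding pq(1) by (rule mult_dvd_mono[OF dvd_refl g(2)])
    ultimately show ?thesis by blast
  qed
qed

definition gcd_le :: "nat \<Rightarrow> nat \<Rightarrow> nat \<Rightarrow> (nat \<Rightarrow> complex poly) set" where
  "gcd_le e n k = {f \<in> topspace (tuples e n). degree (tgcd n f) \<le> k}"

definition gcd_eq :: "nat \<Rightarrow> nat \<Rightarrow> nat \<Rightarrow> (nat \<Rightarrow> complex poly) set" where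
  "gcd_eq e n k = {f \<in> topspace (tuples e n). degree (tgcd n f) = k}"

text \<open>For \<open>k < e\<close> the complement consists of the multiples of monic polynomials
  of degree \<open>Suc k\<close>. It is the image of a proper, hence closed, multiplication
  map.\<close>

lemma openin_gcd_le:
  assumes "n > 0"
  shows "openin (tuples e n) (gcd_le e n k)"
proof (cases "k < e")
  case False
  then have "gcd_le e n k = topspace (tuples e n)"
    using degree_tgcd_le[OF _ assms, of _ e] by (fastforce simp: gcd_le_def)
  then show ?thesis
    by (metis openin_topspace)
next
  case True
  let ?P = "prod_topology (monic_polys (Suc k)) (tuples (e - Suc k) n)"
  have e: "e = Suc k + (e - Suc k)"
    using True by simp
  have "closedin (tuples e n) (tup_mult n ` topspace ?P)"
    using closed_map_tup_mult[OF assms, of "Suc k" "e - Suc k"] e closedin_topspace[of ?P] unfolding closed_map_def by metis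
  moreover have "tup_mult n ` topspace ?P = topspace (tuples e n) - gcd_le e n k"
  proof (intro equalityI subsetI)
    fix f assume "f \<in> tup_mult n ` topspace ?P"
    then obtain g h where gh: "g \<in> monic (Suc k)" "h \<in> topspace (tuples (e - Suc k) n)" "f = tup_mult n (g, h)"
      by auto
    have "tgcd n f = g * tgcd n h"
      using tgcd_tup_mult[OF gh(1,2) assms] gh(3) by simp
    moreover have "tgcd n h \<noteq> 0"
      using tgcd_monic[OF gh(2) assms] monic_nonzero by blast
    ultimately have "degree (tgcd n f) \<ge> Suc k"
      using gh(1) monic_nonzero by (auto simp: degree_mult_eq monic_def)
    moreover have "f \<in> topspace (tuples e n)"
      using tup_mult_in[OF gh(1,2)] gh(3) e by metis
    ultimately show "f \<in> topspace (tuples e n) - gcd_le e n k"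
      by (auto simp: gcd_le_def)
  next
    fix f assume "f \<in> topspace (tuples e n) - gcd_le e n k"
    then have f: "f \<in> topspace (tuples e n)" "Suc k \<le> degree (tgcd n f)"
      unfolding gcd_le_def by (blast, simp add: not_le Suc_le_eq)
    obtain g where g: "g \<in> monic (Suc k)" "g dvd tgcd n f"
      using monic_split[OF tgcd_monic[OF f(1) assms] f(2)] by blast
    obtain h where "h \<in> topspace (tuples (e - Suc k) n)" "f = tup_mult n (g, h)"
      using tup_mult_divisor[OF f(1) g assms] by blast
    then show "f \<in> tup_mult n ` topspace ?P"
      using g(1) by auto
  qed
  ultimately show ?thesis
    by (metis (no_types, lifting) closedin_def double_diff gcd_le_def mem_Collect_eq subsetI order_refl)
qed

text \<open>Over a single stratum, multiplication is closed, continuous and surjective, hence a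
  quotient map. Continuity of the gcd can be tested after composing with it, where the gcd becomes a
  projection.\<close>

lemma continuous_map_tgcd:
  assumes "n > 0" "k \<le> e"
  shows "continuous_map (subtopology (tuples e n) (gcd_eq e n k)) (monic_polys k) (tgcd n)"
proof -
  let ?P = "prod_topology (monic_polys k) (tuples (e - k) n)"
  let ?U = "monic k \<times> hol (e - k) n"
  have e: "e = k + (e - k)"
    using assms by simp
  have cl: "closed_map ?P (tuples e n) (tup_mult n)" "continuous_map ?P (tuples e n) (tup_mult n)"
    using closed_map_tup_mult[OF assms(1), of k "e - k"] continuous_map_tup_mult[of k "e - k" n] e by metis+
  have gcd: "tgcd n (tup_mult n (g, h)) = g * tgcd n h" "degree (g * tgcd n h) = k + degree (tgcd n h)"
    if gh: "g \<in> monic k" "h \<in> topspace (tuples (e - k) n)" for g h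
    using tgcd_tup_mult[OF gh assms(1)] tgcd_monic[OF gh(2) assms(1)] gh(1) monic_nonzero
    by (auto simp: degree_mult_eq monic_def)
  \<comment> \<open>A closed map stays closed on the full preimage of a subset, so \<open>?U\<close>
    has to be exactly that preimage.\<close>
  have U: "{x \<in> topspace ?P. tup_mult n x \<in> gcd_eq e n k} = ?U"
  proof (rule Set.set_eqI)
    fix x :: "complex poly \<times> (nat \<Rightarrow> complex poly)"
    obtain g h where [simp]: "x = (g, h)"
      by (metis surj_pair)
    have "tup_mult n (g, h) \<in> gcd_eq e n k \<longleftrightarrow> h \<in> hol (e - k) n"
      if "g \<in> monic k" "h \<in> topspace (tuples (e - k) n)"
      using gcd[OF that] tup_mult_in[OF that] that(2) e unfolding gcd_eq_def hol_def by simp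
    moreover have "hol (e - k) n \<subseteq> topspace (tuples (e - k) n)"
      unfolding hol_def by blast
    ultimately show "x \<in> {x \<in> topspace ?P. tup_mult n x \<in> gcd_eq e n k} \<longleftrightarrow> x \<in> ?U"
      unfolding mem_Collect_eq topspace_prod_topology topspace_monic \<open>x = (g, h)\<close> mem_Times_iff fst_conv snd_conv
      by blast
  qed
  have topU: "topspace (subtopology ?P ?U) = ?U"
    unfolding topspace_subtopology U[symmetric] by blast
  have topS: "topspace (subtopology (tuples e n) (gcd_eq e n k)) = gcd_eq e n k"
    unfolding topspace_subtopology gcd_eq_def by blast
  have maps: "tup_mult n ` ?U \<subseteq> gcd_eq e n k"
    unfolding U[symmetric] by blast
  have "f \<in> tup_mult n ` ?U" if "f \<in> gcd_eq e n k" for f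
  proof -
    have f: "f \<in> topspace (tuples e n)" "degree (tgcd n f) = k"
      using that unfolding gcd_eq_def by blast+
    have m: "tgcd n f \<in> monic k"
      using tgcd_monic[OF f(1) assms(1)] f(2) by simp
    obtain h where h: "h \<in> topspace (tuples (e - k) n)" "f = tup_mult n (tgcd n f, h)"
      using tup_mult_divisor[OF f(1) m dvd_refl assms(1)] by blast
    have "(tgcd n f, h) \<in> topspace ?P"
      unfolding topspace_prod_topology topspace_monic using m h(1) by blast
    then have "(tgcd n f, h) \<in> ?U"
      unfolding U[symmetric] mem_Collect_eq using h(2) that by simp
    then show ?thesis
      using h(2) by blast
  qed
  then have surj: "tup_mult n ` topspace (subtopology ?P ?U) = topspace (subtopology (tuples e n) (gcd_eq e n k))"
    unfolding topU topS using maps by blast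
  have "quotient_map (subtopology ?P ?U) (subtopology (tuples e n) (gcd_eq e n k)) (tup_mult n)"
  proof (rule continuous_closed_imp_quotient_map[OF _ _ surj])
    show "closed_map (subtopology ?P ?U) (subtopology (tuples e n) (gcd_eq e n k)) (tup_mult n)"
      by (rule closed_map_restriction[OF cl(1) U])
    show "continuous_map (subtopology ?P ?U) (subtopology (tuples e n) (gcd_eq e n k)) (tup_mult n)"
      unfolding continuous_map_in_subtopology topU
      using continuous_map_from_subtopology[OF cl(2)] maps by blast
  qed
  \<comment> \<open>On \<open>?U\<close> the cofactor has gcd 1, so the gcd of the product is its
    first factor.\<close>
  moreover have "continuous_map (subtopology ?P ?U) (monic_polys k) (tgcd n \<circ> tup_mult n)"
  proof (rule continuous_map_eq)
    show "continuous_map (subtopology ?P ?U) (monic_polys k) fst"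
      by (rule continuous_map_from_subtopology[OF continuous_map_fst])
    fix x assume "x \<in> topspace (subtopology ?P ?U)"
    then obtain g h where x: "x = (g, h)" "g \<in> monic k" "h \<in> hol (e - k) n"
      unfolding topU by blast
    then have "h \<in> topspace (tuples (e - k) n)"
      unfolding hol_def by blast
    then show "fst x = (tgcd n \<circ> tup_mult n) x"
      using gcd(1)[OF x(2)] hol_tgcd[OF x(3) assms(1)] x(1) by simp
  qed
  ultimately show ?thesis
    by (rule continuous_compose_quotient_map)
qed

section \<open>Division with remainder by a monic polynomial\<close>

definition low :: "nat \<Rightarrow> complex poly set" where
  "low k = {r. \<forall>i\<ge>k. coeff r i = 0}"

text \<open>A copy of complex \<open>k\<close>-space. It serves twice: as the space of remainders
  modulo a monic polynomial of degree \<open>k\<close> and as the space of differences of two such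
  polynomials.\<close>

definition low_polys :: "nat \<Rightarrow> complex poly topology" where
  "low_polys k = subtopology poly_topology (low k)"

lemma topspace_low_polys [simp]: "topspace (low_polys k) = low k"
  by (simp add: low_polys_def)

lemma zero_low [simp]: "0 \<in> low k"
  by (simp add: low_def)

lemma low_degree: "r \<in> low k \<longleftrightarrow> r = 0 \<or> degree r < k"
proof
  assume "r \<in> low k"
  then show "r = 0 \<or> degree r < k"
    using leading_coeff_neq_0 unfolding low_def by (metis (mono_tags) linorder_not_less mem_Collect_eq)
qed (auto simp: low_def coeff_eq_0)

lemma continuous_map_into_low:
  "continuous_map X (low_polys k) f \<longleftrightarrow> continuous_map X poly_topology f \<and> f \<in> topspace X \<rightarrow> low k"
  by (simp add: low_polys_def continuous_map_in_subtopology image_subset_iff_funcset)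

lemma continuous_map_cong:
  assumes "\<And>x. x \<in> topspace X \<Longrightarrow> f x = g x"
  shows "continuous_map X Y f \<longleftrightarrow> continuous_map X Y g"
  using continuous_map_eq[of X Y f g] continuous_map_eq[of X Y g f] assms by auto

text \<open>Long division, one coefficient at a time. The bound \<open>N\<close> on the degrees is
  uniform in the parameter, so one induction serves all points at once.\<close>

lemma continuous_map_div_mod_monic:
  assumes g: "continuous_map X (monic_polys k) g" and "continuous_map X poly_topology p"
    and "\<And>x i. x \<in> topspace X \<Longrightarrow> i \<ge> N \<Longrightarrow> coeff (p x) i = 0"
  shows "continuous_map X poly_topology (\<lambda>x. p x div g x) \<and> continuous_map X poly_topology (\<lambda>x. p x mod g x)"
  using assms(2,3)
proof (induction N arbitrary: p)
  case 0
  then have "p x = 0" if "x \<in> topspace X" for x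
    using that by (intro poly_eqI) auto
  then have "continuous_map X poly_topology (\<lambda>x. p x div g x) \<longleftrightarrow> continuous_map X poly_topology (\<lambda>x. 0)"
    "continuous_map X poly_topology (\<lambda>x. p x mod g x) \<longleftrightarrow> continuous_map X poly_topology (\<lambda>x. 0)"
    by (simp_all cong: continuous_map_cong)
  then show ?case
    by simp
next
  case (Suc N)
  have gm: "g x \<in> monic k" if "x \<in> topspace X" for x
    using g that by (auto simp: continuous_map_into_monic)
  show ?case
  proof (cases "N < k")
    case True
    have dm: "p x div g x = 0" "p x mod g x = p x" if x: "x \<in> topspace X" for x
    proof -
      have "p x \<in> low k"
        using Suc.prems(2)[OF x] True by (auto simp: low_def)
      then have "p x = 0 \<or> degree (p x) < degree (g x)"
        using gm[OF x] by (auto simp: low_degree monic_def)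
      then show "p x div g x = 0" "p x mod g x = p x"
        by (auto simp: div_poly_less mod_poly_less)
    qed
    have "continuous_map X poly_topology (\<lambda>x. p x div g x) \<longleftrightarrow> continuous_map X poly_topology (\<lambda>x. 0)"
      "continuous_map X poly_topology (\<lambda>x. p x mod g x) \<longleftrightarrow> continuous_map X poly_topology p"
      using dm by (simp_all cong: continuous_map_cong)
    then show ?thesis
      using Suc.prems(1) by simp
  next
    case False
    \<comment> \<open>The leading term of the quotient. As \<open>g\<close> is monic, its
      coefficient is one of \<open>p\<close> itself and depends continuously on the
      parameter.\<close>
    define m where "m x = monom (coeff (p x) N) (N - k)" for x
    have mc: "continuous_map X poly_topology m"
      using Suc.prems(1) unfolding m_def by (intro continuous_map_monom) (simp add: continuous_map_into_poly)
    have gc: "continuous_map X poly_topology g"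
      using g by (rule continuous_map_from_monic)
    let ?q = "\<lambda>x. p x - m x * g x"
    have "coeff (?q x) i = 0" if x: "x \<in> topspace X" "i \<ge> N" for x i
    proof -
      have "coeff (m x * g x) i = coeff (p x) N * coeff (g x) (i - (N - k))"
        using that False by (simp add: m_def coeff_monom_mult)
      moreover have "coeff (g x) (i - (N - k)) = (if i = N then 1 else 0)"
        using coeff_monic[OF gm[OF x(1)]] that False by auto
      ultimately show ?thesis
        using Suc.prems(2)[OF x(1), of i] that by auto
    qed
    moreover have "continuous_map X poly_topology ?q"
      by (intro continuous_map_poly_diff continuous_map_poly_mult Suc.prems mc gc)
    ultimately have IH: "continuous_map X poly_topology (\<lambda>x. ?q x div g x)" "continuous_map X poly_topology (\<lambda>x. ?q x mod g x)"
      using Suc.IH by auto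
    have dm: "p x div g x = m x + ?q x div g x" "p x mod g x = ?q x mod g x" if "x \<in> topspace X" for x
    proof -
      have p: "p x = ?q x + m x * g x" by simp
      show "p x div g x = m x + ?q x div g x"
        by (subst p, subst div_mult_self1) (use monic_nonzero[OF gm[OF that]] in auto)
      show "p x mod g x = ?q x mod g x"
        by (subst p, subst mod_mult_self1) simp
    qed
    have "continuous_map X poly_topology (\<lambda>x. p x div g x) \<longleftrightarrow> continuous_map X poly_topology (\<lambda>x. m x + ?q x div g x)"
      "continuous_map X poly_topology (\<lambda>x. p x mod g x) \<longleftrightarrow> continuous_map X poly_topology (\<lambda>x. ?q x mod g x)"
      using dm by (simp_all cong: continuous_map_cong)
    then show ?thesis
      using IH mc by (simp add: continuous_map_poly_add)
  qed
qed

abbreviation low_tuples :: "nat \<Rightarrow> nat \<Rightarrow> (nat \<Rightarrow> complex poly) topology" where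
  "low_tuples k n \<equiv> product_topology (\<lambda>_. low_polys k) {..<n}"

text \<open>The inverse of componentwise division with remainder by \<open>g\<close>; the remainder
  vanishes exactly where \<open>g\<close> divides the whole tuple.\<close>

definition div_coords :: "nat \<Rightarrow> (complex poly \<times> (nat \<Rightarrow> complex poly)) \<times> (nat \<Rightarrow> complex poly) \<Rightarrow>
    complex poly \<times> (nat \<Rightarrow> complex poly)" where
  "div_coords n = (\<lambda>((g, h), r). (g, \<lambda>j\<in>{..<n}. g * h j + r j))"

lemma monic_add_low:
  assumes "p \<in> monic e" "r \<in> low k" "k \<le> e"
  shows "p + r \<in> monic e"
proof (rule monicI)
  show "coeff (p + r) e = 1"
    using assms coeff_monic[of p e] by (simp add: low_def)
  show "coeff (p + r) i = 0" if "i > e" for i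
    using assms coeff_monic(2)[OF assms(1) that] that by (simp add: low_def)
qed

lemma monic_div_mod:
  assumes "p \<in> monic e" "g \<in> monic k" "k \<le> e"
  shows "p div g \<in> monic (e - k)" "p mod g \<in> low k"
proof -
  have "p mod g = 0 \<or> degree (p mod g) < degree g"
    using monic_nonzero[OF assms(2)] degree_mod_less by blast
  then show low: "p mod g \<in> low k"
    using assms(2) by (auto simp: low_degree monic_def)
  have "- (p mod g) \<in> low k"
    using low by (simp add: low_def)
  then have "p + - (p mod g) \<in> monic e"
    using assms by (intro monic_add_low)
  moreover have "p + - (p mod g) = g * (p div g)"
    by (simp add: minus_mod_eq_mult_div)
  ultimately show "p div g \<in> monic (e - k)"
    using monic_mult_cancel[OF assms(2), of "p div g" "e - k"] assms(3) by simp
qed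

text \<open>Uniqueness of quotient and remainder gives the bijection; continuity of the inverse is
  continuity of division by a monic polynomial.\<close>

lemma homeomorphic_map_div_coords:
  assumes "k \<le> e"
  shows "homeomorphic_map (prod_topology (prod_topology (monic_polys k) (tuples (e - k) n)) (low_tuples k n))
     (prod_topology (monic_polys k) (tuples e n)) (div_coords n)"
proof (rule homeomorphic_maps_imp_map)
  let ?S = "prod_topology (prod_topology (monic_polys k) (tuples (e - k) n)) (low_tuples k n)"
  let ?T = "prod_topology (monic_polys k) (tuples e n)"
  let ?g = "\<lambda>(g, f). ((g, \<lambda>j\<in>{..<n}. f j div g), \<lambda>j\<in>{..<n}. f j mod g)"
  have S: "g \<in> monic k \<and> (\<forall>j<n. h j \<in> monic (e - k) \<and> r j \<in> low k)"
    if "((g, h), r) \<in> topspace ?S" for g h r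
    using that by (auto simp: PiE_def Pi_def)
  have T: "g \<in> monic k \<and> (\<forall>j<n. f j \<in> monic e)" if "(g, f) \<in> topspace ?T" for g f
    using that by (auto simp: PiE_def Pi_def)
  show "homeomorphic_maps ?S ?T (div_coords n) ?g"
    unfolding homeomorphic_maps_def
  proof (intro conjI ballI)
    have 1: "continuous_map ?S (monic_polys k) (\<lambda>x. fst (fst x))"
      using continuous_map_compose[OF continuous_map_fst continuous_map_fst] by (simp add: comp_def)
    have 2: "continuous_map ?S (monic_polys (e - k)) (\<lambda>x. snd (fst x) j)" if "j < n" for j
      using continuous_map_compose[OF continuous_map_fst continuous_map_snd_component[of j "{..<n}"]] that
      unfolding comp_def by (metis lessThan_iff)
    have 3: "continuous_map ?S (low_polys k) (\<lambda>x. snd x j)" if "j < n" for j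
      using that by (intro continuous_map_snd_component) simp
    have "continuous_map ?S (monic_polys e) (\<lambda>x. fst (fst x) * snd (fst x) j + snd x j)" if j: "j < n" for j
      unfolding continuous_map_into_monic
    proof
      show "continuous_map ?S poly_topology (\<lambda>x. fst (fst x) * snd (fst x) j + snd x j)"
        using 1 2[OF j] 3[OF j]
        by (intro continuous_map_poly_add continuous_map_poly_mult)
          (auto dest: continuous_map_from_monic simp: continuous_map_into_low)
      have "g * h j + r j \<in> monic e" if "((g, h), r) \<in> topspace ?S" for g h r
        using S[OF that] monic_mult[of g k "h j" "e - k"] j assms by (auto intro: monic_add_low)
      then show "(\<lambda>x. fst (fst x) * snd (fst x) j + snd x j) \<in> topspace ?S \<rightarrow> monic e"
        by fastforce
    qed
    then show "continuous_map ?S ?T (div_coords n)"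
      unfolding div_coords_def using 1 by (auto simp: continuous_map_paired continuous_map_componentwise case_prod_unfold)
    have fst: "continuous_map ?T (monic_polys k) fst"
      by (rule continuous_map_fst)
    have snd: "continuous_map ?T (monic_polys e) (\<lambda>x. snd x j)" if "j < n" for j
      using that by (intro continuous_map_snd_component) simp
    have dm: "continuous_map ?T (monic_polys (e - k)) (\<lambda>x. snd x j div fst x)"
      "continuous_map ?T (low_polys k) (\<lambda>x. snd x j mod fst x)" if j: "j < n" for j
    proof -
      have c: "continuous_map ?T poly_topology (\<lambda>x. snd x j div fst x) \<and> continuous_map ?T poly_topology (\<lambda>x. snd x j mod fst x)"
      proof (rule continuous_map_div_mod_monic[OF fst])
        show "continuous_map ?T poly_topology (\<lambda>x. snd x j)"
          using snd[OF j] by (rule continuous_map_from_monic)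
        show "coeff (snd x j) i = 0" if "x \<in> topspace ?T" "i \<ge> Suc e" for x i
          using T[of "fst x" "snd x"] that j coeff_monic(2)[of "snd x j" e i] by auto
      qed
      have "snd x j div fst x \<in> monic (e - k) \<and> snd x j mod fst x \<in> low k" if "x \<in> topspace ?T" for x
        using T[of "fst x" "snd x"] that j monic_div_mod[OF _ _ assms, of "snd x j" "fst x"] by auto
      then show "continuous_map ?T (monic_polys (e - k)) (\<lambda>x. snd x j div fst x)"
        "continuous_map ?T (low_polys k) (\<lambda>x. snd x j mod fst x)"
        using c by (auto simp: continuous_map_into_monic continuous_map_into_low)
    qed
    then show "continuous_map ?T ?S ?g"
      using fst by (auto simp: continuous_map_paired continuous_map_componentwise case_prod_unfold)
    show "?g (div_coords n x) = x" if x: "x \<in> topspace ?S" for x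
    proof -
      obtain g h r where [simp]: "x = ((g, h), r)"
        by (metis surj_pair)
      have dm: "(g * h j + r j) div g = h j \<and> (g * h j + r j) mod g = r j" if "j < n" for j
      proof -
        have g: "g \<noteq> 0" and r: "r j = 0 \<or> degree (r j) < degree g"
          using S x that monic_nonzero by (auto simp: low_degree monic_def)
        then have "r j div g = 0" "r j mod g = r j"
          by (auto simp: div_poly_less mod_poly_less)
        then show ?thesis
          using g by simp
      qed
      have "h \<in> extensional {..<n}" "r \<in> extensional {..<n}"
        using x by (auto simp: PiE_def)
      then show ?thesis
        using dm by (auto simp: div_coords_def fun_eq_iff extensional_def)
    qed
    show "div_coords n (?g x) = x" if x: "x \<in> topspace ?T" for x
    proof -
      obtain g f where [simp]: "x = (g, f)"
        by (metis surj_pair)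
      have "f \<in> extensional {..<n}"
        using x by (auto simp: PiE_def)
      then show ?thesis
        by (auto simp: div_coords_def fun_eq_iff extensional_def)
    qed
  qed
qed

section \<open>Suspension by spaces of remainders\<close>

lemma Hausdorff_poly_topology: "Hausdorff_space poly_topology"
proof (rule Hausdorff_space_injective_preimage)
  show "continuous_map poly_topology (product_topology (\<lambda>_. euclidean) UNIV) coeff"
    by (simp add: continuous_map_componentwise_UNIV continuous_map_coeff)
  show "inj_on coeff (topspace poly_topology)"
    by (auto simp: inj_on_def poly_eq_iff)
  show "Hausdorff_space (product_topology (\<lambda>_. euclidean :: complex topology) (UNIV :: nat set))"
    by (simp add: Hausdorff_space_product_topology)
qed

lemma Hausdorff_low_polys: "Hausdorff_space (low_polys k)"
  unfolding low_polys_def by (rule Hausdorff_space_subtopology[OF Hausdorff_poly_topology])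

lemma closedin_zero_low: "closedin (low_polys k) {0}"
  using closedin_Hausdorff_sing_eq[OF Hausdorff_low_polys] by simp

definition zero_tup :: "nat \<Rightarrow> nat \<Rightarrow> complex poly" where
  "zero_tup n = (\<lambda>j\<in>{..<n}. 0)"

lemma zero_tup_low: "zero_tup n \<in> topspace (low_tuples k n)"
  by (auto simp: zero_tup_def)

lemma closedin_zero_tup: "closedin (low_tuples k n) {zero_tup n}"
  using closedin_Hausdorff_sing_eq[of "low_tuples k n" "zero_tup n"] zero_tup_low[of n k]
  by (simp add: Hausdorff_space_product_topology Hausdorff_low_polys)

lemma homeomorphic_map_low_Suc:
  "homeomorphic_map (low_polys (Suc k)) (prod_topology (low_polys k) euclidean)
     (\<lambda>p. (p - monom (coeff p k) k, coeff p k))"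
proof (rule homeomorphic_maps_imp_map)
  let ?S = "low_polys (Suc k)" and ?T = "prod_topology (low_polys k) (euclidean :: complex topology)"
  let ?g = "\<lambda>(q, c). q + monom c k"
  show "homeomorphic_maps ?S ?T (\<lambda>p. (p - monom (coeff p k) k, coeff p k)) ?g"
    unfolding homeomorphic_maps_def
  proof (intro conjI ballI)
    have id: "continuous_map ?S poly_topology (\<lambda>p. p)"
      using continuous_map_id[of ?S, unfolded continuous_map_into_low id_def] by blast
    have c: "continuous_map ?S euclidean (\<lambda>p. coeff p k)"
      using id by (simp add: continuous_map_into_poly)
    have "p - monom (coeff p k) k \<in> low k" if "p \<in> low (Suc k)" for p
    proof -
      have "coeff (p - monom (coeff p k) k) i = 0" if "i \<ge> k" for i
        using \<open>p \<in> low (Suc k)\<close> that by (cases "i = k") (auto simp: low_def)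
      then show ?thesis
        unfolding low_def by blast
    qed
    then show "continuous_map ?S ?T (\<lambda>p. (p - monom (coeff p k) k, coeff p k))"
      unfolding continuous_map_paired continuous_map_into_low
      by (intro conjI continuous_map_poly_diff continuous_map_monom id c) auto
    have "continuous_map ?T poly_topology fst"
      using continuous_map_fst[of "low_polys k" "euclidean :: complex topology"]
      by (simp add: continuous_map_into_low)
    then have "continuous_map ?T poly_topology (\<lambda>x. fst x + monom (snd x) k)"
      by (intro continuous_map_poly_add continuous_map_monom continuous_map_snd)
    moreover have "q + monom c k \<in> low (Suc k)" if "q \<in> low k" for q c
      using that by (auto simp: low_def)
    ultimately show "continuous_map ?T ?S ?g"
      by (auto simp: continuous_map_into_low case_prod_unfold)
    show "?g (p - monom (coeff p k) k, coeff p k) = p" if "p \<in> topspace ?S" for p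
      by simp
    show "(?g x - monom (coeff (?g x) k) k, coeff (?g x) k) = x" if "x \<in> topspace ?T" for x
      using that by (cases x) (auto simp: low_def)
  qed
qed

text \<open>Splitting off the top coefficient adds one complex coordinate, that is, two real
  suspensions.\<close>

lemma susp_low:
  assumes A: "openin X A" "openin X' A'" and f: "continuous_map X X' f" "f \<in> A \<rightarrow> A'"
  shows "hiso (i + 2 * int k) (prod_topology X (low_polys k)) (nz X A (low_polys k) 0)
      (prod_topology X' (low_polys k)) (nz X' A' (low_polys k) 0) (map_prod f id) \<longleftrightarrow> hiso i X A X' A' f"
proof (induction k)
  case 0
  have V: "topspace (low_polys 0) = {0}"
    by (auto simp: low_def poly_eq_iff)
  have "i + 2 * int 0 = i"
    by simp
  then show ?case
    using susp_point[OF V f A[THEN openin_subset], of i] by (simp only:)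
next
  case (Suc k)
  have sub: "A \<subseteq> topspace X" "A' \<subseteq> topspace X'"
    using A by (simp_all add: openin_subset)
  let ?V = "low_polys k"
  have "map_prod f id \<in> nz X A ?V 0 \<rightarrow> nz X' A' ?V 0"
    using pair_map_nz[OF f, of ?V 0] nz_subset[of X A ?V 0] by (auto simp: pair_map_def)
  then have "hiso (i + 2 * int k + 2) (prod_topology (prod_topology X ?V) euclidean)
        (nz (prod_topology X ?V) (nz X A ?V 0) (euclidean :: complex topology) 0)
       (prod_topology (prod_topology X' ?V) euclidean)
        (nz (prod_topology X' ?V) (nz X' A' ?V 0) euclidean 0) (map_prod (map_prod f id) id) \<longleftrightarrow>
      hiso (i + 2 * int k) (prod_topology X ?V) (nz X A ?V 0) (prod_topology X' ?V) (nz X' A' ?V 0) (map_prod f id)"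
    by (intro susp_complex openin_nz A closedin_zero_low continuous_map_map_prod_id f)
  note * = this
  have i: "i + 2 * int (Suc k) = i + 2 * int k + 2"
    by simp
  have z: "0 \<in> topspace (low_polys (Suc k))" "(0 - monom (coeff 0 k) k, coeff 0 k) = (0, 0 :: complex)"
    by auto
  show ?case
    unfolding i hiso_nz_split[OF homeomorphic_map_low_Suc z f sub] using * Suc by (simp only:)
qed

lemma homeomorphic_map_low_tuples_Suc:
  "homeomorphic_map (low_tuples k (Suc n)) (prod_topology (low_tuples k n) (low_polys k))
     (\<lambda>r. (restrict r {..<n}, r n))"
proof (rule homeomorphic_maps_imp_map)
  let ?S = "low_tuples k (Suc n)" and ?T = "prod_topology (low_tuples k n) (low_polys k)"
  let ?g = "\<lambda>(r, p). \<lambda>j\<in>{..<Suc n}. if j = n then p else r j"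
  show "homeomorphic_maps ?S ?T (\<lambda>r. (restrict r {..<n}, r n)) ?g"
    unfolding homeomorphic_maps_def
  proof (intro conjI ballI)
    have "continuous_map ?S (low_polys k) (\<lambda>r. r j)" if "j < Suc n" for j
      using that by (intro continuous_map_product_projection) auto
    then show "continuous_map ?S ?T (\<lambda>r. (restrict r {..<n}, r n))"
      by (auto simp: continuous_map_paired continuous_map_componentwise)
    have "continuous_map ?T (low_polys k) (\<lambda>x. if j = n then snd x else fst x j)" if "j < Suc n" for j
    proof (cases "j = n")
      case True
      then show ?thesis by (simp add: continuous_map_snd)
    next
      case False
      then have "j \<in> {..<n}" using that by auto
      from continuous_map_compose[OF continuous_map_fst continuous_map_product_projection[OF this]] False
      show ?thesis by (simp add: comp_def)
    qed
    then show "continuous_map ?T ?S ?g"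
      by (auto simp: continuous_map_componentwise case_prod_unfold)
    show "?g (restrict r {..<n}, r n) = r" if "r \<in> topspace ?S" for r
      using that by (auto simp: fun_eq_iff PiE_def extensional_def)
    show "(restrict (?g x) {..<n}, ?g x n) = x" if "x \<in> topspace ?T" for x
      using that by (cases x) (auto simp: fun_eq_iff PiE_def extensional_def)
  qed
qed

text \<open>Induction over the components; the shift is the real dimension 2kn of the space of
  remainders.\<close>

lemma susp_low_tuples:
  assumes A: "openin X A" "openin X' A'" and f: "continuous_map X X' f" "f \<in> A \<rightarrow> A'"
  shows "hiso (i + 2 * int k * int n) (prod_topology X (low_tuples k n)) (nz X A (low_tuples k n) (zero_tup n))
      (prod_topology X' (low_tuples k n)) (nz X' A' (low_tuples k n) (zero_tup n)) (map_prod f id)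
    \<longleftrightarrow> hiso i X A X' A' f"
proof (induction n)
  case 0
  have V: "topspace (low_tuples k 0) = {zero_tup 0}"
    by (auto simp: zero_tup_def)
  have "i + 2 * int k * int 0 = i"
    by simp
  then show ?case
    using susp_point[OF V f A[THEN openin_subset], of i] by (simp only:)
next
  case (Suc n)
  have sub: "A \<subseteq> topspace X" "A' \<subseteq> topspace X'"
    using A by (simp_all add: openin_subset)
  let ?V = "low_tuples k n" and ?z = "zero_tup n"
  have "map_prod f id \<in> nz X A ?V ?z \<rightarrow> nz X' A' ?V ?z"
    using pair_map_nz[OF f, of ?V ?z] nz_subset[of X A ?V ?z] by (auto simp: pair_map_def)
  then have *: "hiso (i + 2 * int k * int n + 2 * int k) (prod_topology (prod_topology X ?V) (low_polys k))
        (nz (prod_topology X ?V) (nz X A ?V ?z) (low_polys k) 0)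
       (prod_topology (prod_topology X' ?V) (low_polys k))
        (nz (prod_topology X' ?V) (nz X' A' ?V ?z) (low_polys k) 0) (map_prod (map_prod f id) id) \<longleftrightarrow>
      hiso (i + 2 * int k * int n) (prod_topology X ?V) (nz X A ?V ?z) (prod_topology X' ?V) (nz X' A' ?V ?z) (map_prod f id)"
    by (intro susp_low openin_nz A closedin_zero_tup continuous_map_map_prod_id f)
  have i: "i + 2 * int k * int (Suc n) = i + 2 * int k * int n + 2 * int k"
    by (simp add: algebra_simps)
  have z: "(restrict (zero_tup (Suc n)) {..<n}, zero_tup (Suc n) n) = (?z, 0)"
    by (auto simp: zero_tup_def)
  note split = hiso_nz_split[OF homeomorphic_map_low_tuples_Suc[of k n] zero_tup_low[of "Suc n" k], OF z f sub]
  show ?case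
    unfolding i split using * Suc by (simp only:)
qed

text \<open>\<open>P - Q\<close> is closed in \<open>P\<close> and lies in the open set
  \<open>P \<inter> N\<close>, so it can be excised. Two neighbourhoods of the same closed set are
  later compared through their intersection.\<close>

lemma hiso_excision_open:
  assumes P: "openin E P" and Q: "openin E Q" "Q \<subseteq> P" and N: "openin E (P \<inter> N)" "P - Q \<subseteq> N"
  shows "hiso i (subtopology E Q) (Q \<inter> N) (subtopology E P) (P \<inter> N) id"
proof -
  let ?X = "subtopology E P"
  have PE: "P \<subseteq> topspace E"
    using P by (rule openin_subset)
  have "openin ?X Q"
    using Q by (metis inf.absorb_iff2 inf_commute openin_subtopology_Int2)
  then have "closedin ?X (P - Q)"
    using PE by (metis closedin_def Diff_subset double_diff subset_refl topspace_subtopology_subset \<open>Q \<subseteq> P\<close>)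
  then have 1: "?X closure_of (P - Q) = P - Q"
    by (simp add: closure_of_closedin)
  have "openin ?X (P \<inter> (P \<inter> N))"
    using N(1) by (rule openin_subtopology_Int2)
  then have 2: "?X interior_of (P \<inter> N) = P \<inter> N"
    by (simp add: interior_of_openin)
  have eq: "P - (P - Q) = Q" "(P \<inter> N) - (P - Q) = Q \<inter> N" "P \<inter> Q = Q"
    using Q(2) by auto
  have "hom_induced i (subtopology ?X (P - (P - Q))) ((P \<inter> N) - (P - Q)) (subtopology ?X P) (P \<inter> N) id
    \<in> iso (relative_homology_group i (subtopology ?X (P - (P - Q))) ((P \<inter> N) - (P - Q)))
        (relative_homology_group i (subtopology ?X P) (P \<inter> N))"
    using N(2) by (intro homology_excision_axiom) (auto simp: 1 2)
  then have "hom_induced i (subtopology E Q) (Q \<inter> N) ?X (P \<inter> N) id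
    \<in> iso (relative_homology_group i (subtopology E Q) (Q \<inter> N)) (relative_homology_group i ?X (P \<inter> N))"
    by (simp only: eq subtopology_subtopology inf_idem)
  then show ?thesis
    using Q by (auto simp: hiso_def pair_map_def continuous_map_in_subtopology continuous_map_from_subtopology)
qed

section \<open>The Thom isomorphism of a stratum\<close>

text \<open>
  Multiplication identifies the part in \<open>W\<close> of the stratum where the greatest common divisor has
  degree \<open>k\<close> with \<open>G \<times> (R \<inter> hol (e - k) n)\<close>.
\<close>

definition stratum_data :: "nat \<Rightarrow> nat \<Rightarrow> nat \<Rightarrow> (nat \<Rightarrow> complex poly) set \<Rightarrow> complex poly set \<Rightarrow>
    (nat \<Rightarrow> complex poly) set \<Rightarrow> bool" where
  "stratum_data n e k W G R \<longleftrightarrow> n > 0 \<and> 1 \<le> k \<and> k \<le> e \<and>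
     openin (tuples e n) W \<and> openin (monic_polys k) G \<and> openin (tuples (e - k) n) R \<and>
     (\<forall>g\<in>monic k. \<forall>h\<in>hol (e - k) n. tup_mult n (g, h) \<in> W \<longleftrightarrow> g \<in> G \<and> h \<in> R)"

definition div_space :: "nat \<Rightarrow> nat \<Rightarrow> nat \<Rightarrow>
    ((complex poly \<times> (nat \<Rightarrow> complex poly)) \<times> (nat \<Rightarrow> complex poly)) topology" where
  "div_space n e k = prod_topology (prod_topology (monic_polys k) (tuples (e - k) n)) (low_tuples k n)"

definition nonzero_rem :: "nat \<Rightarrow> ('a \<times> (nat \<Rightarrow> complex poly)) set" where
  "nonzero_rem n = {x. snd x \<noteq> zero_tup n}"

text \<open>The product of \<open>monic k\<close> with \<open>W \<inter> gcd_le e n k\<close>, read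
  in division coordinates. The polynomial \<open>g\<close> is an auxiliary variable and need not
  divide the tuple.\<close>

definition div_nbhd :: "nat \<Rightarrow> nat \<Rightarrow> nat \<Rightarrow> (nat \<Rightarrow> complex poly) set \<Rightarrow>
    ((complex poly \<times> (nat \<Rightarrow> complex poly)) \<times> (nat \<Rightarrow> complex poly)) set" where
  "div_nbhd n e k W = {x \<in> topspace (div_space n e k). snd (div_coords n x) \<in> W \<inter> gcd_le e n k}"

definition zero_section :: "nat \<Rightarrow> nat \<Rightarrow> nat \<Rightarrow> complex poly set \<Rightarrow> (nat \<Rightarrow> complex poly) set \<Rightarrow>
    (complex poly \<times> (nat \<Rightarrow> complex poly)) set" where
  "zero_section n e k G R = G \<times> (R \<inter> hol (e - k) n)"

lemma hol_eq_gcd_le: "hol e n = gcd_le e n 0"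
  unfolding hol_def gcd_le_def by simp

lemma openin_hol: "n > 0 \<Longrightarrow> openin (tuples e n) (hol e n)"
  by (simp only: hol_eq_gcd_le openin_gcd_le)

lemma topspace_div_space:
  "topspace (div_space n e k) = (monic k \<times> topspace (tuples (e - k) n)) \<times> topspace (low_tuples k n)"
  by (simp add: div_space_def)

lemma div_coords_zero: "div_coords n ((g, h), zero_tup n) = (g, tup_mult n (g, h))"
  by (auto simp: div_coords_def tup_mult_def zero_tup_def)

lemma degree_tgcd_tup_mult:
  assumes "g \<in> monic k" "h \<in> topspace (tuples m n)" "n > 0"
  shows "degree (tgcd n (tup_mult n (g, h))) = k + degree (tgcd n h)"
  using tgcd_tup_mult[OF assms] tgcd_monic[OF assms(2,3)] assms(1) monic_nonzero
  by (auto simp: degree_mult_eq monic_def)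

lemma tup_mult_mem_gcd_le:
  assumes "g \<in> monic k" "h \<in> topspace (tuples (e - k) n)" "n > 0" "k \<le> e"
  shows "tup_mult n (g, h) \<in> gcd_le e n k \<longleftrightarrow> h \<in> hol (e - k) n"
proof -
  have "tup_mult n (g, h) \<in> topspace (tuples e n)"
    using tup_mult_in[OF assms(1,2)] assms(4) by (simp only: le_add_diff_inverse)
  then show ?thesis
    using degree_tgcd_tup_mult[OF assms(1-3)] assms(2) unfolding gcd_le_def hol_def by simp
qed

lemma hol_subset: "hol e n \<subseteq> topspace (tuples e n)"
  unfolding hol_def by blast

text \<open>With vanishing remainder the tuple is \<open>g\<close> times \<open>h\<close>, whose gcd
  has degree \<open>k\<close> plus that of \<open>h\<close>. The bound \<open>k\<close> therefore
  forces \<open>h\<close> into \<open>hol\<close>, and there \<open>stratum_data\<close> decides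
  membership in \<open>W\<close>.\<close>

lemma zero_rem_iff:
  assumes "stratum_data n e k W G R" and x: "snd x = zero_tup n"
  shows "x \<in> div_nbhd n e k W \<longleftrightarrow> x \<in> zero_section n e k G R \<times> topspace (low_tuples k n)"
proof -
  have d: "n > 0" "k \<le> e" "\<And>g h. g \<in> monic k \<Longrightarrow> h \<in> hol (e - k) n \<Longrightarrow> tup_mult n (g, h) \<in> W \<longleftrightarrow> g \<in> G \<and> h \<in> R"
    and G: "G \<subseteq> monic k"
    using assms(1) openin_subset[of "monic_polys k" G] unfolding stratum_data_def by auto
  obtain g h where x: "x = ((g, h), zero_tup n)"
    using x by (metis prod.collapse)
  show ?thesis
    unfolding x div_nbhd_def mem_Collect_eq div_coords_zero snd_conv topspace_div_space zero_section_def mem_Times_iff fst_conv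
    using d G zero_tup_low[of n k] tup_mult_mem_gcd_le[of g k h e n] hol_subset[of "e - k" n] by blast
qed

lemma openin_div_nbhd:
  assumes "stratum_data n e k W G R"
  shows "openin (div_space n e k) (div_nbhd n e k W)"
proof -
  have d: "n > 0" "k \<le> e" "openin (tuples e n) W"
    using assms unfolding stratum_data_def by auto
  have "continuous_map (div_space n e k) (prod_topology (monic_polys k) (tuples e n)) (div_coords n)"
    unfolding div_space_def using homeomorphic_imp_continuous_map[OF homeomorphic_map_div_coords[OF d(2)]] .
  then have "continuous_map (div_space n e k) (tuples e n) (\<lambda>x. snd (div_coords n x))"
    using continuous_map_compose[OF _ continuous_map_snd] unfolding comp_def by blast
  then show ?thesis
    unfolding div_nbhd_def using openin_gcd_le[OF d(1)] d(3) by (intro openin_continuous_map_preimage openin_Int)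
qed

lemma openin_nonzero_rem:
  assumes "openin (div_space n e k) Q"
  shows "openin (div_space n e k) (Q \<inter> nonzero_rem n)"
proof -
  have "openin (low_tuples k n) (topspace (low_tuples k n) - {zero_tup n})"
    using closedin_zero_tup by blast
  then have "openin (div_space n e k) {x \<in> topspace (div_space n e k). snd x \<in> topspace (low_tuples k n) - {zero_tup n}}"
    unfolding div_space_def by (rule openin_continuous_map_preimage[OF continuous_map_snd])
  then have "openin (div_space n e k) (Q \<inter> {x \<in> topspace (div_space n e k). snd x \<in> topspace (low_tuples k n) - {zero_tup n}})"
    using assms by (rule openin_Int[rotated])
  moreover have "Q \<inter> {x \<in> topspace (div_space n e k). snd x \<in> topspace (low_tuples k n) - {zero_tup n}} = Q \<inter> nonzero_rem n"
    using openin_subset[OF assms] unfolding topspace_div_space nonzero_rem_def by fastforce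
  ultimately show ?thesis
    by (simp only:)
qed

lemma openin_zero_section:
  assumes "stratum_data n e k W G R"
  shows "openin (prod_topology (monic_polys k) (tuples (e - k) n)) (zero_section n e k G R)"
  using assms openin_hol[of n "e - k"] unfolding zero_section_def stratum_data_def
  by (auto simp only: openin_prod_Times_iff intro: openin_Int)

text \<open>The tube is a product with the remainders, and its nonzero part is \<open>nz\<close>
  over the empty subspace. This is the form to which the iterated suspension applies.\<close>

lemma tubular_eq:
  assumes "stratum_data n e k W G R"
  defines "B \<equiv> subtopology (prod_topology (monic_polys k) (tuples (e - k) n)) (zero_section n e k G R)"
  shows "prod_topology B (low_tuples k n) =
      subtopology (div_space n e k) (zero_section n e k G R \<times> topspace (low_tuples k n))"
    and "nz B {} (low_tuples k n) (zero_tup n) = (zero_section n e k G R \<times> topspace (low_tuples k n)) \<inter> nonzero_rem n"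
proof -
  show "prod_topology B (low_tuples k n) =
      subtopology (div_space n e k) (zero_section n e k G R \<times> topspace (low_tuples k n))"
    unfolding B_def div_space_def subtopology_Times subtopology_topspace ..
  have "topspace B = zero_section n e k G R"
    unfolding B_def using openin_subset[OF openin_zero_section[OF assms(1)]] by (rule topspace_subtopology_subset)
  then show "nz B {} (low_tuples k n) (zero_tup n) = (zero_section n e k G R \<times> topspace (low_tuples k n)) \<inter> nonzero_rem n"
    unfolding nz_def nonzero_rem_def by auto
qed

text \<open>The neighbourhood \<open>P\<close> and the product tube \<open>Q\<close> agree along
  vanishing remainder. Whatever separates them lies in \<open>N\<close> and can be excised on either
  side.\<close>

lemma thom_excision:
  assumes "stratum_data n e k W G R"
  defines "E \<equiv> div_space n e k" and "N \<equiv> nonzero_rem n"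
    and "P \<equiv> div_nbhd n e k W" and "Q \<equiv> zero_section n e k G R \<times> topspace (low_tuples k n)"
  shows "hiso i (subtopology E (P \<inter> Q)) (P \<inter> Q \<inter> N) (subtopology E P) (P \<inter> N) id"
    and "hiso i (subtopology E (P \<inter> Q)) (P \<inter> Q \<inter> N) (subtopology E Q) (Q \<inter> N) id"
proof -
  have P: "openin E P"
    unfolding E_def P_def by (rule openin_div_nbhd[OF assms(1)])
  have Q: "openin E Q"
    unfolding E_def div_space_def Q_def using openin_zero_section[OF assms(1)]
    by (simp only: openin_prod_Times_iff openin_topspace simp_thms)
  have "x \<in> P \<longleftrightarrow> x \<in> Q" if "x \<notin> N" for x
    using zero_rem_iff[OF assms(1), of x] that unfolding P_def Q_def N_def nonzero_rem_def by blast
  then have *: "P - P \<inter> Q \<subseteq> N" "Q - P \<inter> Q \<subseteq> N"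
    by blast+
  have PN: "openin E (P \<inter> N)" "openin E (Q \<inter> N)"
    using P Q openin_nonzero_rem unfolding E_def N_def by blast+
  show "hiso i (subtopology E (P \<inter> Q)) (P \<inter> Q \<inter> N) (subtopology E P) (P \<inter> N) id"
    by (rule hiso_excision_open[OF P _ _ PN(1) *(1)]) (use P Q in \<open>auto intro: openin_Int\<close>)
  show "hiso i (subtopology E (P \<inter> Q)) (P \<inter> Q \<inter> N) (subtopology E Q) (Q \<inter> N) id"
    by (rule hiso_excision_open[OF Q _ _ PN(2) *(2)]) (use P Q in \<open>auto intro: openin_Int\<close>)
qed

lemma image_preimage_subset: "B \<subseteq> f ` A \<Longrightarrow> f ` {x \<in> A. f x \<in> B} = B"
  by blast

lemma image_Collect_Int: "f ` {x \<in> A. f x \<in> C} = f ` A \<inter> C"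
  by blast

text \<open>A monic \<open>g\<close> of degree \<open>k\<close> that divides a tuple with gcd of
  degree at most \<open>k\<close> is that gcd. So the zero section in division coordinates is the
  graph of the gcd over the stratum.\<close>

lemma hiso_div_coords:
  assumes "stratum_data n e k W G R"
  defines "X \<equiv> W \<inter> gcd_le e n k"
  shows "hiso i (subtopology (div_space n e k) (div_nbhd n e k W)) (div_nbhd n e k W \<inter> nonzero_rem n)
     (subtopology (prod_topology (monic_polys k) (tuples e n)) (monic k \<times> X))
     ((monic k \<times> X) \<inter> {(g, f). tgcd n f \<noteq> g}) (div_coords n)"
proof (rule hiso_homeomorphism)
  let ?T = "prod_topology (monic_polys k) (tuples e n)"
  have d: "n > 0" "k \<le> e" "openin (tuples e n) W"
    using assms unfolding stratum_data_def by auto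
  have h: "homeomorphic_map (div_space n e k) ?T (div_coords n)"
    unfolding div_space_def using homeomorphic_map_div_coords[OF d(2)] .
  have inj: "inj_on (div_coords n) (topspace (div_space n e k))"
    and surj: "div_coords n ` topspace (div_space n e k) = topspace ?T"
    using homeomorphic_imp_injective_map[OF h] homeomorphic_imp_surjective_map[OF h] by auto
  have XT: "X \<subseteq> topspace (tuples e n)"
    unfolding X_def gcd_le_def by blast
  have T: "topspace ?T = monic k \<times> topspace (tuples e n)"
    by simp
  have fst: "fst (div_coords n x) = fst (fst x)" for x
    by (auto simp: div_coords_def case_prod_unfold)
  have pre: "div_nbhd n e k W = {x \<in> topspace (div_space n e k). div_coords n x \<in> monic k \<times> X}"
  proof -
    have "fst (div_coords n x) \<in> monic k" if "x \<in> topspace (div_space n e k)" for x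
      using imageI[OF that, of "div_coords n"] unfolding surj T mem_Times_iff by blast
    then show ?thesis
      unfolding div_nbhd_def X_def mem_Times_iff by blast
  qed
  have im: "div_coords n ` div_nbhd n e k W = monic k \<times> X"
  proof -
    have "monic k \<times> X \<subseteq> div_coords n ` topspace (div_space n e k)"
      unfolding surj T using XT by blast
    then show ?thesis
      unfolding pre by (rule image_preimage_subset)
  qed
  show "homeomorphic_map (subtopology (div_space n e k) (div_nbhd n e k W)) (subtopology ?T (monic k \<times> X)) (div_coords n)"
    unfolding pre using h by (rule homeomorphic_map_subtopologies_alt) blast
  have sub: "div_nbhd n e k W \<subseteq> topspace (div_space n e k)"
    unfolding div_nbhd_def by blast
  then show "div_nbhd n e k W \<inter> nonzero_rem n \<subseteq> topspace (subtopology (div_space n e k) (div_nbhd n e k W))"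
    unfolding topspace_subtopology by blast
  have key: "snd x = zero_tup n \<longleftrightarrow> tgcd n (snd (div_coords n x)) = fst (div_coords n x)"
    if x: "x \<in> div_nbhd n e k W" for x
  proof -
    obtain g h r where xe: "x = ((g, h), r)"
      by (metis surj_pair)
    have tx: "g \<in> monic k" "h \<in> topspace (tuples (e - k) n)" "r \<in> topspace (low_tuples k n)"
      using x sub unfolding xe topspace_div_space by blast+
    define f where "f = snd (div_coords n x)"
    have f: "f \<in> topspace (tuples e n)" "degree (tgcd n f) \<le> k"
      using x unfolding div_nbhd_def f_def gcd_le_def by blast+
    have fj: "f j = g * h j + r j" if "j < n" for j
      using that by (simp add: f_def xe div_coords_def)
    have r: "r j = 0 \<or> degree (r j) < degree g" if "j < n" for j
    proof -
      have "r j \<in> low k"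
        using tx(3) that by (simp add: PiE_def Pi_def)
      moreover have "degree g = k"
        using tx(1) by (simp add: monic_def)
      ultimately show ?thesis
        by (simp add: low_degree)
    qed
    have "tgcd n f = g \<longleftrightarrow> g dvd tgcd n f"
    proof
      assume g: "g dvd tgcd n f"
      then obtain q where q: "tgcd n f = g * q"
        by (auto elim: dvdE)
      have m: "tgcd n f \<in> monic (degree (tgcd n f))"
        by (rule tgcd_monic[OF f(1) d(1)])
      have "degree (tgcd n f) = k"
        using dvd_imp_degree_le[OF g] monic_nonzero[OF m] f(2) tx(1) by (auto simp: monic_def)
      then have "g * q \<in> monic (k + 0)"
        using m q by simp
      then have "q = 1"
        using monic_mult_cancel[OF tx(1), of q 0] monic_0 by auto
      then show "tgcd n f = g"
        using q by simp
    qed auto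
    also have "\<dots> \<longleftrightarrow> (\<forall>j<n. g dvd f j)"
      by (rule dvd_tgcd_iff)
    also have "\<dots> \<longleftrightarrow> (\<forall>j<n. r j = 0)"
    proof -
      have "g dvd f j \<longleftrightarrow> r j = 0" if "j < n" for j
      proof -
        have "g dvd f j \<longleftrightarrow> g dvd r j"
          using fj[OF that] by (metis dvd_add_right_iff dvd_triv_left)
        also have "\<dots> \<longleftrightarrow> r j = 0"
          using r[OF that] dvd_imp_degree_le[of g "r j"] by (cases "r j = 0") auto
        finally show ?thesis .
      qed
      then show ?thesis by blast
    qed
    also have "\<dots> \<longleftrightarrow> r = zero_tup n"
      using tx(3) by (auto simp: zero_tup_def fun_eq_iff PiE_def extensional_def)
    finally show ?thesis
      unfolding f_def fst by (simp add: xe)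
  qed
  show "div_coords n ` (div_nbhd n e k W \<inter> nonzero_rem n) = (monic k \<times> X) \<inter> {(g, f). tgcd n f \<noteq> g}"
  proof -
    have "div_nbhd n e k W \<inter> nonzero_rem n = {x \<in> div_nbhd n e k W. div_coords n x \<in> {(g, f). tgcd n f \<noteq> g}}"
      unfolding nonzero_rem_def using key by (auto simp: case_prod_unfold)
    then show ?thesis
      unfolding im[symmetric] image_Collect_Int[symmetric] by (rule arg_cong)
  qed
qed

text \<open>
  Subtracting an extension \<open>\<gamma>\<close> of the greatest common divisor moves its graph to the zero
  section.
\<close>

lemma hiso_translate:
  assumes X: "X \<subseteq> gcd_le e n k" and n: "n > 0" and k: "1 \<le> k"
    and \<gamma>: "continuous_map (subtopology (tuples e n) X) (low_polys k) \<gamma>"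
    and \<gamma>_eq: "\<And>f. f \<in> X \<inter> gcd_eq e n k \<Longrightarrow> \<gamma> f = tgcd n f - monom 1 k"
  shows "hiso i (subtopology (prod_topology (monic_polys k) (tuples e n)) (monic k \<times> X))
     ((monic k \<times> X) \<inter> {(g, f). tgcd n f \<noteq> g})
     (prod_topology (subtopology (tuples e n) X) (low_polys k))
     (nz (subtopology (tuples e n) X) (X \<inter> gcd_le e n (k - 1)) (low_polys k) 0)
     (\<lambda>(g, f). (f, g - monom 1 k - \<gamma> f))"
proof (rule hiso_homeomorphism)
  let ?X = "subtopology (tuples e n) X"
  let ?S = "subtopology (prod_topology (monic_polys k) (tuples e n)) (monic k \<times> X)"
  let ?T = "prod_topology ?X (low_polys k)"
  let ?p = "\<lambda>(g, f). (f, g - monom 1 k - \<gamma> f)"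
  let ?q = "\<lambda>(f, v). (v + monom 1 k + \<gamma> f, f)"
  have XT: "X \<subseteq> topspace (tuples e n)"
    using X unfolding gcd_le_def by blast
  have tX: "topspace ?X = X"
    using XT by (rule topspace_subtopology_subset)
  have S: "?S = prod_topology (monic_polys k) ?X"
  proof -
    have "?S = prod_topology (subtopology (monic_polys k) (topspace (monic_polys k))) ?X"
      unfolding subtopology_Times topspace_monic ..
    then show ?thesis
      by (simp only: subtopology_topspace)
  qed
  have tS: "topspace (prod_topology (monic_polys k) ?X) = monic k \<times> X"
    unfolding topspace_prod_topology tX topspace_monic ..
  have tT: "topspace ?T = X \<times> low k"
    unfolding topspace_prod_topology tX topspace_low_polys ..
  have low: "\<gamma> f \<in> low k" if "f \<in> X" for f
    using \<gamma> that tX unfolding continuous_map_into_low by (simp add: Pi_iff)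
  have ml: "g - monom 1 k \<in> low k" if "g \<in> monic k" for g
  proof -
    have "coeff (g - monom 1 k) i = 0" if "i \<ge> k" for i
      using coeff_monic[OF \<open>g \<in> monic k\<close>] that by (cases "i = k") auto
    then show ?thesis unfolding low_def by blast
  qed
  have lm: "v + monom 1 k \<in> monic k" if "v \<in> low k" for v
    using that by (intro monicI) (auto simp: low_def)
  have ldiff: "u - v \<in> low k" "u + v \<in> low k" if "u \<in> low k" "v \<in> low k" for u v
    using that by (auto simp: low_def)
  have madd: "g + v \<in> monic k" if "g \<in> monic k" "v \<in> low k" for g v
    using that by (intro monic_add_low) auto
  have \<gamma>c: "continuous_map ?X poly_topology \<gamma>"
    using \<gamma> unfolding continuous_map_into_low by blast
  have "homeomorphic_maps (prod_topology (monic_polys k) ?X) ?T ?p ?q"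
    unfolding homeomorphic_maps_def
  proof (intro conjI ballI)
    have 1: "continuous_map (prod_topology (monic_polys k) ?X) poly_topology fst"
      by (rule continuous_map_from_monic[OF continuous_map_fst])
    have 2: "continuous_map (prod_topology (monic_polys k) ?X) poly_topology (\<lambda>x. \<gamma> (snd x))"
      using continuous_map_compose[OF continuous_map_snd \<gamma>c] unfolding comp_def .
    have 3: "continuous_map (prod_topology (monic_polys k) ?X) (low_polys k) (\<lambda>x. fst x - monom 1 k - \<gamma> (snd x))"
      unfolding continuous_map_into_low
    proof
      show "continuous_map (prod_topology (monic_polys k) ?X) poly_topology (\<lambda>x. fst x - monom 1 k - \<gamma> (snd x))"
        by (intro continuous_map_poly_diff 1 2) simp
      show "(\<lambda>x. fst x - monom 1 k - \<gamma> (snd x)) \<in> topspace (prod_topology (monic_polys k) ?X) \<rightarrow> low k"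
        unfolding tS using ml low ldiff by auto
    qed
    then show "continuous_map (prod_topology (monic_polys k) ?X) ?T ?p"
      unfolding case_prod_unfold continuous_map_paired using continuous_map_snd by blast
    have 1: "continuous_map ?T poly_topology snd"
      using continuous_map_snd[of ?X "low_polys k"] unfolding continuous_map_into_low by blast
    have 2: "continuous_map ?T poly_topology (\<lambda>x. \<gamma> (fst x))"
      using continuous_map_compose[OF continuous_map_fst \<gamma>c] unfolding comp_def .
    have 3: "continuous_map ?T (monic_polys k) (\<lambda>x. snd x + monom 1 k + \<gamma> (fst x))"
      unfolding continuous_map_into_monic
    proof
      show "continuous_map ?T poly_topology (\<lambda>x. snd x + monom 1 k + \<gamma> (fst x))"
        by (intro continuous_map_poly_add 1 2) simp
      show "(\<lambda>x. snd x + monom 1 k + \<gamma> (fst x)) \<in> topspace ?T \<rightarrow> monic k"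
        unfolding tT using lm low madd by auto
    qed
    then show "continuous_map ?T (prod_topology (monic_polys k) ?X) ?q"
      unfolding case_prod_unfold continuous_map_paired using continuous_map_fst by blast
    show "?q (?p x) = x" if "x \<in> topspace (prod_topology (monic_polys k) ?X)" for x
      by (cases x) simp
    show "?p (?q x) = x" if "x \<in> topspace ?T" for x
      by (cases x) simp
  qed
  then show "homeomorphic_map ?S ?T ?p"
    unfolding S by (rule homeomorphic_maps_imp_map)
  show "(monic k \<times> X) \<inter> {(g, f). tgcd n f \<noteq> g} \<subseteq> topspace ?S"
    unfolding S tS by blast
  show "?p ` ((monic k \<times> X) \<inter> {(g, f). tgcd n f \<noteq> g}) = nz ?X (X \<inter> gcd_le e n (k - 1)) (low_polys k) 0"
  proof (intro equalityI subsetI)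
    fix y assume "y \<in> ?p ` ((monic k \<times> X) \<inter> {(g, f). tgcd n f \<noteq> g})"
    then obtain g f where y: "y = (f, g - monom 1 k - \<gamma> f)" "g \<in> monic k" "f \<in> X" "tgcd n f \<noteq> g"
      by auto
    \<comment> \<open>At height zero \<open>g\<close> equals \<open>monom 1 k + \<gamma> f\<close>.
      On the stratum this would be the gcd, contrary to \<open>tgcd n f \<noteq> g\<close>.\<close>
    have "f \<in> gcd_le e n (k - 1)" if "g - monom 1 k - \<gamma> f = 0"
    proof (rule ccontr)
      assume "f \<notin> gcd_le e n (k - 1)"
      then have "f \<in> gcd_eq e n k"
        using y(3) X k unfolding gcd_le_def gcd_eq_def by force
      then have "\<gamma> f = tgcd n f - monom 1 k"
        using \<gamma>_eq y(3) by blast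
      with that y(4) show False by simp
    qed
    then show "y \<in> nz ?X (X \<inter> gcd_le e n (k - 1)) (low_polys k) 0"
      using y ml low ldiff unfolding nz_def tX by auto
  next
    fix y assume "y \<in> nz ?X (X \<inter> gcd_le e n (k - 1)) (low_polys k) 0"
    then obtain f v where y: "y = (f, v)" "f \<in> X" "v \<in> low k" "f \<in> gcd_le e n (k - 1) \<or> v \<noteq> 0"
      unfolding nz_def tX by auto
    let ?g = "v + monom 1 k + \<gamma> f"
    have g: "?g \<in> monic k"
      using y lm low madd by auto
    \<comment> \<open>Equality would put \<open>f\<close> on the stratum, where the value of
      \<open>\<gamma>\<close> forces \<open>v = 0\<close>; both alternatives for
      \<open>(f, v)\<close> then fail.\<close>
    have "tgcd n f \<noteq> ?g"
    proof
      assume eq: "tgcd n f = ?g"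
      then have "degree (tgcd n f) = k"
        using g by (simp add: monic_def)
      then have "f \<in> gcd_eq e n k" "f \<notin> gcd_le e n (k - 1)"
        using y(2) XT k unfolding gcd_eq_def gcd_le_def by auto
      with y(2,4) \<gamma>_eq eq show False by force
    qed
    with g y(2) have "(?g, f) \<in> (monic k \<times> X) \<inter> {(g, f). tgcd n f \<noteq> g}"
      by blast
    then have "?p (?g, f) \<in> ?p ` ((monic k \<times> X) \<inter> {(g, f). tgcd n f \<noteq> g})"
      by (rule imageI)
    moreover have "?p (?g, f) = y"
      by (simp add: y)
    ultimately show "y \<in> ?p ` ((monic k \<times> X) \<inter> {(g, f). tgcd n f \<noteq> g})"
      by (simp only:)
  qed
qed

text \<open>Tietze's theorem is applied to real and imaginary parts of the coefficients. Only
  coefficients below \<open>k\<close> are kept, so the extension stays in \<open>low k\<close>; off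
  the stratum its values are arbitrary.\<close>

lemma tgcd_extension:
  assumes X: "X \<subseteq> gcd_le e n k" and n: "n > 0" and k: "1 \<le> k" "k \<le> e"
  obtains \<gamma> where "continuous_map (subtopology (tuples e n) X) (low_polys k) \<gamma>"
    "\<And>f. f \<in> X \<inter> gcd_eq e n k \<Longrightarrow> \<gamma> f = tgcd n f - monom 1 k"
proof -
  let ?X = "subtopology (tuples e n) X"
  define S where "S = X \<inter> gcd_eq e n k"
  have XT: "X \<subseteq> topspace (tuples e n)"
    using X unfolding gcd_le_def by blast
  have tX: "topspace ?X = X"
    using XT by (rule topspace_subtopology_subset)
  have normal: "normal_space ?X"
    by (intro metrizable_imp_normal_space metrizable_space_subtopology metrizable_tuples)
  have "openin ?X (X \<inter> gcd_le e n (k - 1))"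
    using openin_gcd_le[OF n] by (rule openin_subtopology_Int2)
  \<comment> \<open>Inside \<open>X\<close> the degree of the gcd is at most \<open>k\<close>, so
    the stratum is the complement of an open level and hence closed.\<close>
  moreover have "S = X - X \<inter> gcd_le e n (k - 1)"
    using X k unfolding S_def gcd_le_def gcd_eq_def by force
  ultimately have closed: "closedin ?X S"
    using closedin_diff[OF closedin_topspace[of ?X], of "X \<inter> gcd_le e n (k - 1)"] unfolding tX by simp
  have SX: "subtopology ?X S = subtopology (tuples e n) S"
    unfolding S_def subtopology_subtopology by (simp only: inf.left_idem)
  have "continuous_map (subtopology (tuples e n) S) (monic_polys k) (tgcd n)"
    using continuous_map_from_subtopology_mono[OF continuous_map_tgcd[OF n k(2)]] unfolding S_def by blast
  then have c: "continuous_map (subtopology ?X S) euclidean (\<lambda>f. coeff (tgcd n f) i)" for i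
    unfolding SX by (intro continuous_map_into_poly[THEN iffD1, THEN spec] continuous_map_from_monic)
  have "continuous_map (subtopology ?X S) euclideanreal (\<lambda>f. Re (coeff (tgcd n f) i))"
    "continuous_map (subtopology ?X S) euclideanreal (\<lambda>f. Im (coeff (tgcd n f) i))" for i
    using continuous_map_compose[OF c, of euclideanreal Re] continuous_map_compose[OF c, of euclideanreal Im]
    by (auto simp: comp_def continuous_intros)
  then have "\<exists>u. continuous_map ?X euclideanreal u \<and> (\<forall>f\<in>S. u f = Re (coeff (tgcd n f) i))"
    "\<exists>u. continuous_map ?X euclideanreal u \<and> (\<forall>f\<in>S. u f = Im (coeff (tgcd n f) i))" for i
    using Tietze_extension_realinterval[OF normal closed, of UNIV "\<lambda>f. Re (coeff (tgcd n f) i)"]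
      Tietze_extension_realinterval[OF normal closed, of UNIV "\<lambda>f. Im (coeff (tgcd n f) i)"]
    by (metis UNIV_not_empty is_interval_univ subset_UNIV)+
  then obtain u v where uv: "\<And>i. continuous_map ?X euclideanreal (u i)" "\<And>i. continuous_map ?X euclideanreal (v i)"
    "\<And>i f. f \<in> S \<Longrightarrow> u i f = Re (coeff (tgcd n f) i)" "\<And>i f. f \<in> S \<Longrightarrow> v i f = Im (coeff (tgcd n f) i)"
    by metis
  define \<gamma> where "\<gamma> f = (\<Sum>i<k. monom (complex_of_real (u i f) + \<i> * complex_of_real (v i f)) i)" for f
  have co: "coeff (\<gamma> f) i = (if i < k then complex_of_real (u i f) + \<i> * complex_of_real (v i f) else 0)" for f i
    by (simp add: \<gamma>_def coeff_sum)
  show ?thesis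
  proof
    have of_real: "continuous_map ?X euclidean (\<lambda>f. complex_of_real (w f))" if "continuous_map ?X euclideanreal w" for w
      using continuous_map_compose[OF that, of euclidean complex_of_real]
      by (simp add: comp_def continuous_on_of_real)
    have "continuous_map ?X euclidean (\<lambda>f. complex_of_real (u i f) + \<i> * complex_of_real (v i f))" for i
      by (intro continuous_map_add continuous_map_complex_mult of_real uv) simp
    then have "continuous_map ?X poly_topology \<gamma>"
      unfolding \<gamma>_def by (intro continuous_map_poly_sum continuous_map_monom) simp_all
    moreover have "\<gamma> f \<in> low k" for f
      by (simp add: low_def co)
    ultimately show "continuous_map ?X (low_polys k) \<gamma>"
      unfolding continuous_map_into_low by blast
    show "\<gamma> f = tgcd n f - monom 1 k" if "f \<in> X \<inter> gcd_eq e n k" for f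
    proof (rule poly_eqI)
      fix i
      have f: "f \<in> S" "f \<in> topspace (tuples e n)" "degree (tgcd n f) = k"
        using that unfolding S_def gcd_eq_def by blast+
      then have m: "tgcd n f \<in> monic k"
        using tgcd_monic[OF f(2) n] by simp
      have "complex_of_real (u i f) + \<i> * complex_of_real (v i f) = coeff (tgcd n f) i"
        using uv(3,4)[OF f(1)] complex_eq[of "coeff (tgcd n f) i"] by simp
      then show "coeff (\<gamma> f) i = coeff (tgcd n f - monom 1 k) i"
        using coeff_monic[OF m] by (auto simp: co)
    qed
  qed
qed

lemma hiso_inclusion_square:
  assumes "hiso i (subtopology E Q) (Q \<inter> N) (subtopology E P) (P \<inter> N) id"
    and "hiso i (subtopology E Q') (Q' \<inter> N) (subtopology E P') (P' \<inter> N) id"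
    and "P \<subseteq> P'" "Q \<subseteq> Q'"
  shows "hiso i (subtopology E Q) (Q \<inter> N) (subtopology E Q') (Q' \<inter> N) id \<longleftrightarrow>
    hiso i (subtopology E P) (P \<inter> N) (subtopology E P') (P' \<inter> N) id"
  by (rule hiso_square[OF _ _ assms(1,2)])
    (use assms(3,4) in \<open>auto simp: pair_map_def continuous_map_in_subtopology continuous_map_from_subtopology\<close>)

lemma pair_map_inclusion:
  "P \<subseteq> P' \<Longrightarrow> S \<subseteq> S' \<Longrightarrow> pair_map (subtopology E P) S (subtopology E P') S' id"
  by (auto simp: pair_map_def continuous_map_in_subtopology continuous_map_from_subtopology)

lemma continuous_map_inclusion:
  "P \<subseteq> P' \<Longrightarrow> continuous_map (subtopology E P) (subtopology E P') id"
  by (auto simp: continuous_map_in_subtopology continuous_map_from_subtopology)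

text \<open>
  The Thom isomorphism for the stratum of tuples whose greatest common divisor has degree \<open>k\<close>,
  phrased as naturality: the codimension is \<open>2kn - 2k\<close>.
\<close>

theorem hiso_stratum:
  assumes st: "stratum_data n e k W G R" and st': "stratum_data n e k W' G' R'"
    and sub: "W \<subseteq> W'" "G \<subseteq> G'" "R \<subseteq> R'"
    and hyp: "hiso i (subtopology (prod_topology (monic_polys k) (tuples (e - k) n)) (zero_section n e k G R)) {}
      (subtopology (prod_topology (monic_polys k) (tuples (e - k) n)) (zero_section n e k G' R')) {} id"
  shows "hiso (i + 2 * int k * int n - 2 * int k)
     (subtopology (tuples e n) (W \<inter> gcd_le e n k)) (W \<inter> gcd_le e n (k - 1))
     (subtopology (tuples e n) (W' \<inter> gcd_le e n k)) (W' \<inter> gcd_le e n (k - 1)) id"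
proof -
  let ?E = "div_space n e k" and ?N = "nonzero_rem n" and ?V = "low_tuples k n"
  let ?B = "prod_topology (monic_polys k) (tuples (e - k) n)"
  let ?j = "i + 2 * int k * int n"
  define P where "P = div_nbhd n e k W"
  define P' where "P' = div_nbhd n e k W'"
  define Q where "Q = zero_section n e k G R \<times> topspace ?V"
  define Q' where "Q' = zero_section n e k G' R' \<times> topspace ?V"
  define X where "X = W \<inter> gcd_le e n k"
  define X' where "X' = W' \<inter> gcd_le e n k"
  have n: "n > 0" and k: "1 \<le> k" "k \<le> e"
    using st unfolding stratum_data_def by blast+
  have PP: "P \<subseteq> P'" and QQ: "Q \<subseteq> Q'" and XX: "X \<subseteq> X'" and X'k: "X' \<subseteq> gcd_le e n k"
    unfolding P_def P'_def Q_def Q'_def X_def X'_def div_nbhd_def zero_section_def using sub by blast+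
  have zs: "zero_section n e k G R \<subseteq> zero_section n e k G' R'"
    unfolding zero_section_def using sub by blast
  let ?Z = "subtopology ?B (zero_section n e k G R)" and ?Z' = "subtopology ?B (zero_section n e k G' R')"
  have ZZ: "continuous_map ?Z ?Z' id"
    by (rule continuous_map_inclusion[OF zs])
  \<comment> \<open>Suspending the hypothesis by the remainders turns it into a statement about
    product tubes, 2kn degrees higher.\<close>
  have "hiso ?j (prod_topology ?Z ?V) (nz ?Z {} ?V (zero_tup n)) (prod_topology ?Z' ?V) (nz ?Z' {} ?V (zero_tup n))
      (map_prod id id)"
    using susp_low_tuples[of ?Z "{}" ?Z' "{}" id i k n] hyp ZZ by (simp only: openin_empty Pi_empty) blast
  then have "hiso ?j (subtopology ?E Q) (Q \<inter> ?N) (subtopology ?E Q') (Q' \<inter> ?N) id"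
    unfolding tubular_eq[OF st] tubular_eq[OF st'] Q_def[symmetric] Q'_def[symmetric] prod.map_id0 .
  \<comment> \<open>The product tubes are exchanged for the actual neighbourhoods through their
    intersections.\<close>
  moreover have ex: "hiso ?j (subtopology ?E (P \<inter> Q)) (P \<inter> Q \<inter> ?N) (subtopology ?E P) (P \<inter> ?N) id"
      "hiso ?j (subtopology ?E (P \<inter> Q)) (P \<inter> Q \<inter> ?N) (subtopology ?E Q) (Q \<inter> ?N) id"
    unfolding P_def Q_def by (rule thom_excision[OF st])+
  moreover have ex': "hiso ?j (subtopology ?E (P' \<inter> Q')) (P' \<inter> Q' \<inter> ?N) (subtopology ?E P') (P' \<inter> ?N) id"
      "hiso ?j (subtopology ?E (P' \<inter> Q')) (P' \<inter> Q' \<inter> ?N) (subtopology ?E Q') (Q' \<inter> ?N) id"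
    unfolding P'_def Q'_def by (rule thom_excision[OF st'])+
  ultimately have hP: "hiso ?j (subtopology ?E P) (P \<inter> ?N) (subtopology ?E P') (P' \<inter> ?N) id"
    using hiso_inclusion_square[OF ex(1) ex'(1) PP] hiso_inclusion_square[OF ex(2) ex'(2) QQ] PP QQ by blast
  let ?T = "prod_topology (monic_polys k) (tuples e n)" and ?C = "{(g, f). tgcd n f \<noteq> g}"
  let ?M = "monic k \<times> X" and ?M' = "monic k \<times> X'"
  have MM: "?M \<subseteq> ?M'"
    using XX by blast
  \<comment> \<open>Back from division coordinates to pairs of an auxiliary \<open>g\<close> and a
    tuple, with the graph of the gcd removed.\<close>
  have "hiso ?j (subtopology ?E P) (P \<inter> ?N) (subtopology ?T ?M) (?M \<inter> ?C) (div_coords n)"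
    "hiso ?j (subtopology ?E P') (P' \<inter> ?N) (subtopology ?T ?M') (?M' \<inter> ?C) (div_coords n)"
    unfolding P_def P'_def X_def X'_def using hiso_div_coords[OF st] hiso_div_coords[OF st'] by blast+
  note hiso_square[OF _ _ this, of id id]
  moreover have "pair_map (subtopology ?E P) (P \<inter> ?N) (subtopology ?E P') (P' \<inter> ?N) id"
    "pair_map (subtopology ?T ?M) (?M \<inter> ?C) (subtopology ?T ?M') (?M' \<inter> ?C) id"
    by (rule pair_map_inclusion; use PP MM in blast)+
  ultimately have hM: "hiso ?j (subtopology ?T ?M) (?M \<inter> ?C) (subtopology ?T ?M') (?M' \<inter> ?C) id"
    using hP by simp
  \<comment> \<open>A single extension over the larger space \<open>X'\<close> is used for both
    translations, so that they commute with the inclusion.\<close>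
  obtain \<gamma> where \<gamma>: "continuous_map (subtopology (tuples e n) X') (low_polys k) \<gamma>"
    "\<And>f. f \<in> X' \<inter> gcd_eq e n k \<Longrightarrow> \<gamma> f = tgcd n f - monom 1 k"
    using tgcd_extension[OF X'k n k] by blast
  let ?X = "subtopology (tuples e n) X" and ?X' = "subtopology (tuples e n) X'"
  let ?A = "X \<inter> gcd_le e n (k - 1)" and ?A' = "X' \<inter> gcd_le e n (k - 1)"
  let ?L = "low_polys k"
  let ?t = "\<lambda>(g, f). (f, g - monom 1 k - \<gamma> f)"
  have t: "hiso ?j (subtopology ?T ?M) (?M \<inter> ?C) (prod_topology ?X ?L) (nz ?X ?A ?L 0) ?t"
    by (rule hiso_translate[OF _ n k(1)])
      (use X'k XX \<gamma> continuous_map_from_subtopology_mono[OF \<gamma>(1)] in blast)+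
  have t': "hiso ?j (subtopology ?T ?M') (?M' \<inter> ?C) (prod_topology ?X' ?L) (nz ?X' ?A' ?L 0) ?t"
    by (rule hiso_translate[OF X'k n k(1) \<gamma>])
  have XXc: "continuous_map ?X ?X' id"
    by (rule continuous_map_inclusion[OF XX])
  have AA: "id \<in> ?A \<rightarrow> ?A'"
    using XX by auto
  have "hiso ?j (prod_topology ?X ?L) (nz ?X ?A ?L 0) (prod_topology ?X' ?L) (nz ?X' ?A' ?L 0) (map_prod id id)"
  proof (rule hiso_square[OF hiso_pair_map[OF hM] pair_map_nz[OF XXc AA] t t', THEN iffD1])
    show "map_prod id id (?t x) = ?t (id x)" for x
      by (simp add: case_prod_unfold)
  qed (rule hM)
  moreover have "openin ?X ?A" "openin ?X' ?A'"
    using openin_gcd_le[OF n] by (blast intro: openin_subtopology_Int2)+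
  \<comment> \<open>After the translation the auxiliary factor is a suspension by
    \<open>low k\<close>; undoing it costs 2k degrees.\<close>
  ultimately have "hiso (?j - 2 * int k) ?X ?A ?X' ?A' id"
    using susp_low[of ?X ?A ?X' ?A' id "?j - 2 * int k" k] XXc AA by simp
  moreover have "gcd_le e n (k - 1) \<subseteq> gcd_le e n k"
    unfolding gcd_le_def by force
  then have "?A = W \<inter> gcd_le e n (k - 1)" "?A' = W' \<inter> gcd_le e n (k - 1)"
    unfolding X_def X'_def by blast+
  ultimately show ?thesis
    unfolding X_def X'_def by (simp only:)
qed

section \<open>Moving roots\<close>

definition roots_in :: "complex set \<Rightarrow> nat \<Rightarrow> complex poly set" where
  "roots_in U d = {p \<in> monic d. set_mset (proots p) \<subseteq> U}"

definition root_polys :: "complex set \<Rightarrow> nat \<Rightarrow> complex poly topology" where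
  "root_polys U d = subtopology (monic_polys d) (roots_in U d)"

lemma roots_in_monic: "p \<in> roots_in U d \<Longrightarrow> p \<in> monic d"
  by (simp add: roots_in_def)

lemma roots_in_iff: "p \<in> roots_in U d \<longleftrightarrow> p \<in> monic d \<and> (\<forall>z. poly p z = 0 \<longrightarrow> z \<in> U)"
  using monic_nonzero[of p d] by (auto simp: roots_in_def subset_eq)

lemma topspace_root_polys [simp]: "topspace (root_polys U d) = roots_in U d"
  by (auto simp: root_polys_def roots_in_def)

lemma roots_in_UNIV: "roots_in UNIV d = monic d"
  by (auto simp: roots_in_def)

lemma roots_in_mult:
  assumes "p \<in> monic a" "q \<in> monic b"
  shows "p * q \<in> roots_in U (a + b) \<longleftrightarrow> p \<in> roots_in U a \<and> q \<in> roots_in U b"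
  using assms monic_mult[OF assms] by (auto simp: roots_in_iff)

lemma proots_mult_monic: "p \<in> monic a \<Longrightarrow> q \<in> monic b \<Longrightarrow> proots (p * q) = proots p + proots q"
  by (rule proots_mult) (auto dest: monic_nonzero)

lemma monic_1: "l \<in> monic 1 \<longleftrightarrow> (\<exists>a. l = [:-a, 1:])"
proof
  assume "l \<in> monic 1"
  then obtain a q where "l = [:-a, 1:] * q" "q \<in> monic 0"
    using monic_factor[of l 0] by auto
  then show "\<exists>a. l = [:-a, 1:]"
    by (auto simp: monic_0)
qed (use monic_linear in blast)

lemma linear_roots_in: "[:-a, 1:] \<in> roots_in U 1 \<longleftrightarrow> a \<in> U"
  using monic_linear[of a] by (auto simp: roots_in_iff)

lemma continuous_map_into_root_polys:
  "continuous_map X (root_polys U d) f \<longleftrightarrow> continuous_map X poly_topology f \<and> f \<in> topspace X \<rightarrow> roots_in U d"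
  unfolding root_polys_def continuous_map_in_subtopology continuous_map_into_monic
  by (auto simp: roots_in_def)

lemma homeomorphic_map_singleton_tuple:
  "homeomorphic_map X (product_topology (\<lambda>_. X) {..<1::nat}) (\<lambda>x. \<lambda>j\<in>{..<1}. x)"
proof (rule homeomorphic_maps_imp_map)
  show "homeomorphic_maps X (product_topology (\<lambda>_. X) {..<1::nat}) (\<lambda>x. \<lambda>j\<in>{..<1}. x) (\<lambda>f. f 0)"
    unfolding homeomorphic_maps_def
    by (auto simp: continuous_map_componentwise PiE_def extensional_def fun_eq_iff
        intro: continuous_map_product_projection)
qed

text \<open>The case of tuples with a single component.\<close>

lemma proper_map_monic_mult:
  "proper_map (prod_topology (monic_polys a) (monic_polys b)) (monic_polys (a + b)) (\<lambda>(p, q). p * q)"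
proof -
  let ?s = "\<lambda>(x :: complex poly). \<lambda>j\<in>{..<1::nat}. x"
  have 1: "proper_map (prod_topology (monic_polys a) (monic_polys b)) (prod_topology (monic_polys a) (tuples b 1))
      (\<lambda>(p, q). (id p, ?s q))"
    unfolding proper_map_prod
    using homeomorphic_imp_proper_map[OF homeomorphic_map_singleton_tuple[of "monic_polys b"]]
    by (simp add: proper_map_id[unfolded id_def])
  have "homeomorphic_map (tuples (a + b) 1) (monic_polys (a + b)) (\<lambda>f. f 0)"
  proof (rule homeomorphic_maps_imp_map)
    show "homeomorphic_maps (tuples (a + b) 1) (monic_polys (a + b)) (\<lambda>f. f 0) ?s"
      unfolding homeomorphic_maps_def
      by (auto simp: continuous_map_componentwise PiE_def extensional_def fun_eq_iff
          intro: continuous_map_product_projection)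
  qed
  then have 2: "proper_map (tuples (a + b) 1) (monic_polys (a + b)) (\<lambda>f. f 0)"
    by (rule homeomorphic_imp_proper_map)
  have "proper_map (prod_topology (monic_polys a) (monic_polys b)) (monic_polys (a + b))
      ((\<lambda>f. f 0) \<circ> (tup_mult 1 \<circ> (\<lambda>(p, q). (id p, ?s q))))"
    by (rule proper_map_compose[OF proper_map_compose[OF 1 proper_map_tup_mult] 2]) simp
  moreover have "(\<lambda>f. f 0) \<circ> (tup_mult 1 \<circ> (\<lambda>(p, q). (id p, ?s q))) = (\<lambda>(p, q). p * q)"
    by (auto simp: fun_eq_iff tup_mult_def)
  ultimately show ?thesis
    by (simp only:)
qed

lemma continuous_map_monic_mult:
  "continuous_map (prod_topology (monic_polys a) (monic_polys b)) (monic_polys (a + b)) (\<lambda>(p, q). p * q)"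
proof -
  have "continuous_map (prod_topology (monic_polys a) (monic_polys b)) poly_topology (\<lambda>x. fst x * snd x)"
    by (intro continuous_map_poly_mult continuous_map_from_monic[OF continuous_map_fst]
        continuous_map_from_monic[OF continuous_map_snd])
  then show ?thesis
    unfolding continuous_map_into_monic case_prod_unfold by (auto intro: monic_mult)
qed

lemma root_polys_prod:
  "prod_topology (root_polys U a) (root_polys V b) =
    subtopology (prod_topology (monic_polys a) (monic_polys b)) (roots_in U a \<times> roots_in V b)"
  unfolding root_polys_def subtopology_Times ..

text \<open>A product has its roots in \<open>U\<close> exactly if both factors do, and properness
  restricts to full preimages.\<close>

lemma proper_map_roots_mult:
  "proper_map (prod_topology (root_polys U a) (root_polys U b)) (root_polys U (a + b)) (\<lambda>(p, q). p * q)"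
proof -
  have "{x \<in> topspace (prod_topology (monic_polys a) (monic_polys b)). (case x of (p, q) \<Rightarrow> p * q) \<in> roots_in U (a + b)} =
      roots_in U a \<times> roots_in U b"
    using roots_in_mult[of _ a _ b U] roots_in_monic by auto
  then show ?thesis
    unfolding root_polys_prod unfolding root_polys_def
    by (rule proper_map_restriction[OF proper_map_monic_mult])
qed

lemma continuous_map_roots_mult:
  "continuous_map (prod_topology (root_polys U a) (root_polys U b)) (root_polys U (a + b)) (\<lambda>(p, q). p * q)"
  using continuous_map_monic_mult[of a b] roots_in_mult[of _ a _ b U] roots_in_monic
  unfolding root_polys_prod unfolding root_polys_def
  by (fastforce simp: continuous_map_in_subtopology continuous_map_from_subtopology)

definition root_map :: "(complex \<Rightarrow> complex) \<Rightarrow> complex poly \<Rightarrow> complex poly" where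
  "root_map \<theta> p = (\<Prod>x\<in>#proots p. [:- \<theta> x, 1:])"

lemma root_map_1 [simp]: "root_map \<theta> 1 = 1"
  by (simp add: root_map_def)

lemma root_map_linear_mult:
  "q \<in> monic d \<Longrightarrow> root_map \<theta> ([:-a, 1:] * q) = [:- \<theta> a, 1:] * root_map \<theta> q"
  using proots_mult_monic[OF monic_linear, of q d a] unfolding root_map_def
  by (simp only: proots_linear_factor) simp

lemma root_map_roots_in:
  assumes "p \<in> roots_in U d" "\<And>x. x \<in> U \<Longrightarrow> \<theta> x \<in> V"
  shows "root_map \<theta> p \<in> roots_in V d"
proof -
  have e: "root_map \<theta> p = (\<Prod>x\<in>#image_mset \<theta> (proots p). [:- x, 1:])"
    by (simp add: root_map_def image_mset.compositionality comp_def)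
  have "size (proots p) = d"
    using assms(1) by (auto simp: roots_in_def monic_def size_proots_complex)
  then show ?thesis
    using prod_roots[of "image_mset \<theta> (proots p)"] assms unfolding e
    by (auto simp: roots_in_def monic_def)
qed

lemma root_map_compose: "root_map \<theta> (root_map \<eta> p) = root_map (\<theta> \<circ> \<eta>) p"
proof -
  have "root_map \<eta> p = (\<Prod>x\<in>#image_mset \<eta> (proots p). [:- x, 1:])"
    by (simp add: root_map_def image_mset.compositionality comp_def)
  then have "proots (root_map \<eta> p) = image_mset \<eta> (proots p)"
    by (simp only: prod_roots(4))
  then show ?thesis
    unfolding root_map_def[of _ "root_map \<eta> p"] by (simp add: root_map_def image_mset.compositionality comp_def)
qed

lemma root_map_ident:
  assumes "p \<in> roots_in U d" "\<And>x. x \<in> U \<Longrightarrow> \<theta> x = x"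
  shows "root_map \<theta> p = p"
proof -
  have "root_map \<theta> p = (\<Prod>x\<in>#proots p. [:- x, 1:])"
    unfolding root_map_def using assms by (intro arg_cong[of _ _ prod_mset] image_mset_cong) (auto simp: roots_in_def)
  moreover have "lead_coeff p = 1"
    using assms(1) unfolding roots_in_def monic_def by blast
  ultimately show ?thesis
    using complex_poly_decompose_multiset[of p] by (simp only: smult_1_left)
qed

text \<open>Proper maps, unlike closed ones, remain closed after taking the product with
  \<open>T\<close>. This provides the parameter needed for homotopies; surjectivity is the splitting
  off of a root.\<close>

lemma quotient_roots_mult:
  "quotient_map (prod_topology T (prod_topology (root_polys U 1) (root_polys U d))) (prod_topology T (root_polys U (Suc d)))
     (\<lambda>(t, x). (id t, (\<lambda>(p, q). p * q) x))"
proof (rule continuous_closed_imp_quotient_map)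
  let ?S = "prod_topology T (prod_topology (root_polys U 1) (root_polys U d))"
  let ?R = "prod_topology T (root_polys U (Suc d))"
  let ?m = "\<lambda>(p, q). p * (q :: complex poly)"
  have pm: "proper_map (prod_topology (root_polys U 1) (root_polys U d)) (root_polys U (Suc d)) ?m"
    and cm: "continuous_map (prod_topology (root_polys U 1) (root_polys U d)) (root_polys U (Suc d)) ?m"
    using proper_map_roots_mult[of U 1 d] continuous_map_roots_mult[of U 1 d] by simp_all
  show "closed_map ?S ?R (\<lambda>(t, x). (id t, ?m x))"
    using pm by (intro proper_imp_closed_map) (simp only: proper_map_prod proper_map_id simp_thms)
  show "continuous_map ?S ?R (\<lambda>(t, x). (id t, ?m x))"
  proof -
    have e: "(\<lambda>(t, x). (id t, ?m x)) = (\<lambda>x. (fst x, ?m (snd x)))"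
      by (simp add: fun_eq_iff)
    show ?thesis
      using continuous_map_compose[OF continuous_map_snd cm, of T]
      unfolding e continuous_map_paired comp_def by (blast intro: continuous_map_fst)
  qed
  show "(\<lambda>(t, x). (id t, ?m x)) ` topspace ?S = topspace ?R"
  proof (intro equalityI subsetI)
    fix y assume "y \<in> topspace ?R"
    then obtain t p where y: "y = (t, p)" "t \<in> topspace T" "p \<in> roots_in U (Suc d)"
      by auto
    then obtain a q where p: "p = [:-a, 1:] * q" "q \<in> monic d"
      using monic_factor[OF roots_in_monic] by blast
    then have "[:-a, 1:] \<in> roots_in U 1" "q \<in> roots_in U d"
      using roots_in_mult[OF monic_linear[of a] p(2), of U] y(3) by simp_all
    then have "(t, ([:-a, 1:], q)) \<in> topspace ?S"
      using y(2) by simp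
    moreover have "y = (\<lambda>(t, x). (id t, ?m x)) (t, ([:-a, 1:], q))"
      using y p by simp
    ultimately show "y \<in> (\<lambda>(t, x). (id t, ?m x)) ` topspace ?S"
      by (rule rev_image_eqI)
  next
    fix y assume "y \<in> (\<lambda>(t, x). (id t, ?m x)) ` topspace ?S"
    then obtain t p q where "y = (t, p * q)" "t \<in> topspace T" "p \<in> roots_in U 1" "q \<in> roots_in U d"
      by auto
    then show "y \<in> topspace ?R"
      using roots_in_mult[of p 1 q d U] roots_in_monic by auto
  qed
qed

text \<open>
  Moving the roots of a polynomial is continuous because multiplication by linear factors is a
  quotient map.
\<close>

lemma continuous_map_root_map:
  fixes \<theta> :: "'t \<Rightarrow> complex \<Rightarrow> complex"
  assumes \<theta>: "continuous_map (prod_topology T (top_of_set U)) euclidean (\<lambda>(t, x). \<theta> t x)"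
  shows "continuous_map (prod_topology T (root_polys U d)) poly_topology (\<lambda>(t, p). root_map (\<theta> t) p)"
proof (induction d)
  case 0
  have "root_map (\<theta> (fst x)) (snd x) = 1" if "x \<in> topspace (prod_topology T (root_polys U 0))" for x
    using that by (cases x) (auto simp: roots_in_def monic_0)
  then have "continuous_map (prod_topology T (root_polys U 0)) poly_topology (\<lambda>x. root_map (\<theta> (fst x)) (snd x)) \<longleftrightarrow>
      continuous_map (prod_topology T (root_polys U 0)) poly_topology (\<lambda>x. 1)"
    by (rule continuous_map_cong)
  then show ?case
    by (simp add: case_prod_unfold)
next
  case (Suc d)
  let ?S = "prod_topology T (prod_topology (root_polys U 1) (root_polys U d))"
  let ?m = "\<lambda>(t :: 't, x). (id t, (\<lambda>(p, q). p * (q :: complex poly)) x)"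
  \<comment> \<open>Reads off the root of a monic linear polynomial.\<close>
  let ?r = "\<lambda>l. - coeff l 0"
  let ?F = "\<lambda>(t, p). root_map (\<theta> t) p"
  have c1: "continuous_map ?S T fst" "continuous_map ?S (root_polys U 1) (\<lambda>x. fst (snd x))"
    "continuous_map ?S (root_polys U d) (\<lambda>x. snd (snd x))"
    using continuous_map_compose[OF continuous_map_snd continuous_map_fst]
      continuous_map_compose[OF continuous_map_snd continuous_map_snd]
    unfolding comp_def by (blast intro: continuous_map_fst)+
  have rU: "?r l \<in> U" if l: "l \<in> roots_in U 1" for l
  proof -
    obtain a where "l = [:-a, 1:]"
      using roots_in_monic[OF l] monic_1 by blast
    then show ?thesis
      using l linear_roots_in by auto
  qed
  have "continuous_map (root_polys U 1) euclidean ?r"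
    using continuous_map_id[of "root_polys U 1", unfolded continuous_map_into_root_polys continuous_map_into_poly]
    by (auto intro: continuous_map_minus)
  then have "continuous_map (root_polys U 1) (top_of_set U) ?r"
    using rU by (auto simp: continuous_map_in_subtopology)
  then have "continuous_map ?S (top_of_set U) (\<lambda>x. ?r (fst (snd x)))"
    using continuous_map_compose[OF c1(2)] unfolding comp_def by blast
  then have "continuous_map ?S (prod_topology T (top_of_set U)) (\<lambda>x. (fst x, ?r (fst (snd x))))"
    using c1(1) by (simp only: continuous_map_paired simp_thms)
  from continuous_map_compose[OF this \<theta>]
  have "continuous_map ?S euclidean (\<lambda>x. \<theta> (fst x) (?r (fst (snd x))))"
    by (simp add: comp_def)
  then have l: "continuous_map ?S poly_topology (\<lambda>x. [:- \<theta> (fst x) (?r (fst (snd x))), 1:])"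
    unfolding continuous_map_into_poly
  proof (intro allI)
    fix i
    assume *: "continuous_map ?S euclidean (\<lambda>x. \<theta> (fst x) (?r (fst (snd x))))"
    show "continuous_map ?S euclidean (\<lambda>x. coeff [:- \<theta> (fst x) (?r (fst (snd x))), 1:] i)"
      using continuous_map_minus[OF *] by (cases i) (auto simp: coeff_pCons split: nat.split)
  qed
  have "continuous_map ?S (prod_topology T (root_polys U d)) (\<lambda>x. (fst x, snd (snd x)))"
    using c1 by (simp only: continuous_map_paired simp_thms)
  from continuous_map_compose[OF this Suc.IH]
  have "continuous_map ?S poly_topology (\<lambda>x. root_map (\<theta> (fst x)) (snd (snd x)))"
    by (simp add: comp_def)
  with l have "continuous_map ?S poly_topology (\<lambda>x. [:- \<theta> (fst x) (?r (fst (snd x))), 1:] * root_map (\<theta> (fst x)) (snd (snd x)))"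
    by (rule continuous_map_poly_mult)
  moreover have "[:- \<theta> (fst x) (?r (fst (snd x))), 1:] * root_map (\<theta> (fst x)) (snd (snd x)) = (?F \<circ> ?m) x"
    if "x \<in> topspace ?S" for x
  proof -
    obtain t l q where x: "x = (t, l, q)"
      by (metis surj_pair)
    then have lq: "l \<in> monic 1" "q \<in> monic d"
      using that roots_in_monic by auto
    then obtain a where a: "l = [:-a, 1:]"
      using monic_1 by blast
    show ?thesis
      using root_map_linear_mult[OF lq(2), of "\<theta> t" a] by (simp only: x a comp_def) simp
  qed
  ultimately have "continuous_map ?S poly_topology (?F \<circ> ?m)"
    by (rule continuous_map_eq)
  then show ?case
    by (rule continuous_compose_quotient_map[OF quotient_roots_mult])
qed

text \<open>All roots move along segments to one point \<open>c\<close> of the convex set, which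
  deforms every polynomial to a power of a linear one.\<close>

lemma contractible_root_polys:
  assumes "convex U" "U \<noteq> {}"
  shows "contractible_space (root_polys U d)"
proof -
  obtain c where c: "c \<in> U"
    using assms by blast
  define \<theta> where "\<theta> t x = complex_of_real (1 - t) * x + complex_of_real t * c" for t :: real and x
  let ?T = "top_of_set {0..1::real}" and ?X = "root_polys U d"
  have "continuous_map (prod_topology ?T (top_of_set U)) euclidean (\<lambda>(t, x). \<theta> t x)"
  proof -
    have "continuous_on ({0..1} \<times> U) (\<lambda>(t, x). \<theta> t x)"
      unfolding \<theta>_def case_prod_unfold by (intro continuous_intros)
    then show ?thesis
      by (simp add: subtopology_Times[symmetric] euclidean_product_topology)
  qed
  then have cont: "continuous_map (prod_topology ?T ?X) poly_topology (\<lambda>(t, p). root_map (\<theta> t) p)"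
    by (rule continuous_map_root_map)
  have U: "\<theta> t x \<in> U" if "t \<in> {0..1}" "x \<in> U" for t x
    using convexD[OF assms(1) that(2) c, of "1 - t" t] that by (simp add: \<theta>_def scaleR_conv_of_real)
  have "homotopic_with (\<lambda>x. True) ?X ?X id (\<lambda>x. [:- c, 1:] ^ d)"
  proof (subst homotopic_with, simp, intro exI conjI ballI)
    show "continuous_map (prod_topology ?T ?X) ?X (\<lambda>(t, p). root_map (\<theta> t) p)"
      unfolding continuous_map_into_root_polys using cont U by (auto intro: root_map_roots_in)
    show "(\<lambda>(t, p). root_map (\<theta> t) p) (0, p) = id p" if "p \<in> topspace ?X" for p
      using that root_map_ident[of p U d "\<theta> 0"] by (simp add: \<theta>_def)
    show "(\<lambda>(t, p). root_map (\<theta> t) p) (1, p) = [:- c, 1:] ^ d" if "p \<in> topspace ?X" for p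
      using that by (simp add: \<theta>_def root_map_def roots_in_def monic_def size_proots_complex)
  qed simp
  then show ?thesis
    unfolding contractible_space_def by blast
qed

section \<open>Openness of conditions on roots\<close>

lemma root_of_linear:
  "continuous_map (monic_polys 1) euclidean (\<lambda>l. - coeff l 0)"
proof -
  have "continuous_map (monic_polys 1) euclidean (\<lambda>l. coeff l 0)"
    using continuous_map_id[of "monic_polys 1", unfolded continuous_map_into_monic continuous_map_into_poly]
    unfolding id_def by blast
  then show ?thesis
    by (rule continuous_map_minus)
qed

lemma roots_in_1: "roots_in U 1 = {l \<in> monic 1. - coeff l 0 \<in> U}"
proof (rule Set.set_eqI)
  fix l
  show "l \<in> roots_in U 1 \<longleftrightarrow> l \<in> {l \<in> monic 1. - coeff l 0 \<in> U}"
  proof (cases "l \<in> monic 1")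
    case True
    then obtain a where "l = [:-a, 1:]"
      unfolding monic_1 by blast
    then show ?thesis
      using linear_roots_in[of a U] True by simp
  qed (use roots_in_monic in blast)
qed

lemma closed_map_monic_mult:
  "closed_map (prod_topology (monic_polys 1) (monic_polys d)) (monic_polys (Suc d)) (\<lambda>(p, q). p * q)"
  using proper_imp_closed_map[OF proper_map_monic_mult[of 1 d]] by simp

text \<open>In positive degree the complement is the image, under closed multiplication, of the
  pairs whose linear factor has its root outside \<open>U\<close>.\<close>

lemma openin_roots_in:
  assumes "open U"
  shows "openin (monic_polys d) (roots_in U d)"
proof (cases d)
  case 0
  have "roots_in U 0 = topspace (monic_polys 0)"
    by (auto simp: roots_in_def monic_0)
  then show ?thesis
    unfolding 0 by (simp only: openin_topspace)
next
  case (Suc e)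
  let ?P = "prod_topology (monic_polys 1) (monic_polys e)"
  have "closedin (monic_polys 1) {l \<in> topspace (monic_polys 1). - coeff l 0 \<in> - U}"
    using assms by (intro closedin_continuous_map_preimage[OF root_of_linear]) (simp add: closed_closedin[symmetric] closed_Compl)
  then have "closedin (monic_polys 1) (roots_in (- U) 1)"
    unfolding roots_in_1 topspace_monic .
  then have "closedin ?P (roots_in (- U) 1 \<times> topspace (monic_polys e))"
    by (simp only: closedin_prod_Times_iff closedin_topspace simp_thms)
  then have "closedin (monic_polys (Suc e)) ((\<lambda>(p, q). p * q) ` (roots_in (- U) 1 \<times> monic e))"
    using closed_map_monic_mult unfolding closed_map_def topspace_monic by blast
  moreover have "(\<lambda>(p, q). p * q) ` (roots_in (- U) 1 \<times> monic e) = monic (Suc e) - roots_in U (Suc e)"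
  proof (intro equalityI subsetI)
    fix p assume "p \<in> (\<lambda>(p, q). p * q) ` (roots_in (- U) 1 \<times> monic e)"
    then obtain l q where "p = l * q" "l \<in> roots_in (- U) 1" "q \<in> monic e"
      by auto
    then obtain a where a: "p = [:-a, 1:] * q" "a \<notin> U" "q \<in> monic e"
      using monic_1 roots_in_monic linear_roots_in by (metis ComplD)
    then have "poly p a = 0" "p \<in> monic (Suc e)"
      using monic_mult[OF monic_linear a(3)] by auto
    then show "p \<in> monic (Suc e) - roots_in U (Suc e)"
      using a(2) by (auto simp: roots_in_iff)
  next
    fix p assume p: "p \<in> monic (Suc e) - roots_in U (Suc e)"
    then obtain a where a: "poly p a = 0" "a \<notin> U"
      by (auto simp: roots_in_iff)
    then obtain q where q: "p = [:-a, 1:] * q"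
      by (metis dvdE poly_eq_0_iff_dvd)
    then have "q \<in> monic e"
      using monic_mult_cancel[OF monic_linear, of a q e] p by auto
    moreover have "[:-a, 1:] \<in> roots_in (- U) 1"
      using a(2) linear_roots_in by blast
    ultimately show "p \<in> (\<lambda>(p, q). p * q) ` (roots_in (- U) 1 \<times> monic e)"
      using q by force
  qed
  ultimately have "closedin (monic_polys (Suc e)) (monic (Suc e) - roots_in U (Suc e))"
    by (simp only:)
  then have "openin (monic_polys (Suc e)) (topspace (monic_polys (Suc e)) - (monic (Suc e) - roots_in U (Suc e)))"
    by blast
  moreover have "topspace (monic_polys (Suc e)) - (monic (Suc e) - roots_in U (Suc e)) = roots_in U (Suc e)"
    using roots_in_monic by auto
  ultimately show ?thesis
    unfolding Suc by (simp only:)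
qed

text \<open>The component of the thickened image: the root added by stabilization may vary in
  \<open>D\<close>, and the count with multiplicity makes it unique and simple when \<open>D\<close>
  and \<open>U\<close> are disjoint.\<close>

definition one_root :: "complex set \<Rightarrow> complex set \<Rightarrow> nat \<Rightarrow> complex poly set" where
  "one_root U D e = {p \<in> monic e. size (filter_mset (\<lambda>z. z \<in> D) (proots p)) = 1 \<and> set_mset (proots p) \<subseteq> U \<union> D}"

lemma one_root_0: "one_root U D 0 = {}"
  by (auto simp: one_root_def monic_0)

lemma filter_mset_size_0_iff: "size (filter_mset P M) = 0 \<longleftrightarrow> (\<forall>x\<in>#M. \<not> P x)"
  by (induction M) auto

lemma one_root_mult:
  assumes "g \<in> monic k" "h \<in> monic m" "g \<in> roots_in U k" "D \<inter> U = {}"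
  shows "g * h \<in> one_root U D (k + m) \<longleftrightarrow> h \<in> one_root U D m"
proof -
  have "size (filter_mset (\<lambda>z. z \<in> D) (proots g)) = 0"
    unfolding filter_mset_size_0_iff using assms(3,4) by (auto simp: roots_in_def)
  then have "filter_mset (\<lambda>z. z \<in> D) (proots g) = {#}"
    by (simp only: size_eq_0_iff_empty)
  then have f: "filter_mset (\<lambda>z. z \<in> D) (proots (g * h)) = filter_mset (\<lambda>z. z \<in> D) (proots h)"
    by (simp only: proots_mult_monic[OF assms(1,2)] filter_union_mset add_0_left)
  have s: "set_mset (proots (g * h)) \<subseteq> U \<union> D \<longleftrightarrow> set_mset (proots h) \<subseteq> U \<union> D"
    using assms(3) by (auto simp: proots_mult_monic[OF assms(1,2)] roots_in_def)
  show ?thesis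
    unfolding one_root_def mem_Collect_eq f s using monic_mult[OF assms(1,2)] assms(2) by blast
qed

lemma one_root_linear_mult:
  assumes q: "q \<in> monic d" and DU: "D \<inter> U = {}"
  shows "[:-a, 1:] * q \<in> one_root U D (Suc d) \<longleftrightarrow> (a \<in> D \<and> q \<in> roots_in U d) \<or> (a \<in> U \<and> q \<in> one_root U D d)"
proof -
  have pr: "proots ([:-a, 1:] * q) = add_mset a (proots q)"
    using proots_mult_monic[OF monic_linear q, of a] by (simp only: proots_linear_factor) simp
  have m: "[:-a, 1:] * q \<in> monic (Suc d)"
    using monic_mult[OF monic_linear q, of a] by simp
  have z: "size (filter_mset (\<lambda>z. z \<in> D) (proots q)) = 0 \<longleftrightarrow> (\<forall>x\<in>#proots q. x \<notin> D)"
    by (rule filter_mset_size_0_iff)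
  show ?thesis
    unfolding one_root_def roots_in_def mem_Collect_eq pr using m q DU z by auto
qed

text \<open>Whichever linear factor is split off, membership of the product is decided by the open
  set \<open>?V\<close> of pairs. The complement is therefore the image of a closed set under closed
  multiplication.\<close>

lemma openin_one_root:
  assumes "open U" "open D" and DU: "D \<inter> U = {}"
  shows "openin (monic_polys e) (one_root U D e)"
proof (induction e)
  case 0
  then show ?case by (simp add: one_root_0)
next
  case (Suc d)
  let ?P = "prod_topology (monic_polys 1) (monic_polys d)"
  let ?m = "\<lambda>(p, q). p * (q :: complex poly)"
  let ?V = "roots_in D 1 \<times> roots_in U d \<union> roots_in U 1 \<times> one_root U D d"
  have "openin ?P ?V"
    using Suc openin_roots_in[OF assms(1)] openin_roots_in[OF assms(2)]
    by (intro openin_Un) (simp_all only: openin_prod_Times_iff simp_thms)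
  then have "closedin ?P (topspace ?P - ?V)"
    by blast
  then have "closedin (monic_polys (Suc d)) (?m ` (topspace ?P - ?V))"
    using closed_map_monic_mult unfolding closed_map_def by blast
  then have "openin (monic_polys (Suc d)) (topspace (monic_polys (Suc d)) - ?m ` (topspace ?P - ?V))"
    by blast
  moreover have "topspace (monic_polys (Suc d)) - ?m ` (topspace ?P - ?V) = one_root U D (Suc d)"
  proof -
    have key: "[:-a, 1:] * q \<in> one_root U D (Suc d) \<longleftrightarrow> ([:-a, 1:], q) \<in> ?V" if "q \<in> monic d" for a q
      using one_root_linear_mult[OF that DU, of a] by (simp add: linear_roots_in[unfolded One_nat_def])
    show ?thesis
    proof (intro equalityI subsetI)
      fix p assume p: "p \<in> topspace (monic_polys (Suc d)) - ?m ` (topspace ?P - ?V)"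
      then obtain a q where aq: "p = [:-a, 1:] * q" "q \<in> monic d"
        using monic_factor[of p d] by auto
      have "([:-a, 1:], q) \<in> ?V"
      proof (rule ccontr)
        assume "([:-a, 1:], q) \<notin> ?V"
        then have "([:-a, 1:], q) \<in> topspace ?P - ?V"
          using aq(2) monic_linear[of a] by simp
        then have "p \<in> ?m ` (topspace ?P - ?V)"
          by (rule rev_image_eqI) (simp add: aq(1))
        with p show False by blast
      qed
      then show "p \<in> one_root U D (Suc d)"
        using key[OF aq(2)] aq(1) by blast
    next
      fix p assume p: "p \<in> one_root U D (Suc d)"
      have "p \<notin> ?m ` (topspace ?P - ?V)"
      proof
        assume "p \<in> ?m ` (topspace ?P - ?V)"
        then obtain l q where lq: "p = l * q" "l \<in> monic 1" "q \<in> monic d" "(l, q) \<notin> ?V"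
          by auto
        then obtain a where "l = [:-a, 1:]"
          using monic_1 by blast
        with lq key[OF lq(3), of a] p show False
          by blast
      qed
      then show "p \<in> topspace (monic_polys (Suc d)) - ?m ` (topspace ?P - ?V)"
        using p by (simp add: one_root_def)
    qed
  qed
  ultimately show ?case
    by (simp only:)
qed

section \<open>Homological stability\<close>

text \<open>The unique root in \<open>D\<close> can be split off. Among all splittings of such
  polynomials, those with linear root in \<open>D\<close> form an open and closed part, so
  multiplication stays closed there.\<close>

lemma homeomorphic_map_one_root:
  assumes "open U" "open D" and DU: "D \<inter> U = {}"
  shows "homeomorphic_map (prod_topology (root_polys D 1) (root_polys U d))
    (subtopology (monic_polys (Suc d)) (one_root U D (Suc d))) (\<lambda>(p, q). p * q)"
proof (rule bijective_closed_imp_homeomorphic_map)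
  let ?P = "prod_topology (monic_polys 1) (monic_polys d)"
  let ?m = "\<lambda>(p, q). p * (q :: complex poly)"
  let ?V1 = "roots_in D 1 \<times> roots_in U d" and ?V2 = "roots_in U 1 \<times> one_root U D d"
  let ?W = "one_root U D (Suc d)"
  have key: "[:-a, 1:] * q \<in> ?W \<longleftrightarrow> ([:-a, 1:], q) \<in> ?V1 \<union> ?V2" if "q \<in> monic d" for a q
    using one_root_linear_mult[OF that DU, of a] by (simp add: linear_roots_in[unfolded One_nat_def])
  have pre: "{x \<in> topspace ?P. ?m x \<in> ?W} = ?V1 \<union> ?V2"
  proof (rule Set.set_eqI)
    fix x :: "complex poly \<times> complex poly"
    obtain l q where [simp]: "x = (l, q)"
      by (metis surj_pair)
    have sub: "?V1 \<union> ?V2 \<subseteq> monic 1 \<times> monic d"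
      using roots_in_monic by (auto simp: one_root_def)
    show "x \<in> {x \<in> topspace ?P. ?m x \<in> ?W} \<longleftrightarrow> x \<in> ?V1 \<union> ?V2"
    proof (cases "l \<in> monic 1 \<and> q \<in> monic d")
      case True
      then obtain a where "l = [:-a, 1:]"
        using monic_1 by blast
      then have "l * q \<in> ?W \<longleftrightarrow> (l, q) \<in> ?V1 \<union> ?V2"
        using key[of q a] True by blast
      then show ?thesis
        using True by simp
    next
      case False
      then show ?thesis
        using sub by auto
    qed
  qed
  have src: "prod_topology (root_polys D 1) (root_polys U d) = subtopology (subtopology ?P (?V1 \<union> ?V2)) ?V1"
    unfolding root_polys_prod subtopology_subtopology by (rule arg_cong[of _ _ "subtopology ?P"]) blast
  have disj: "?V1 \<inter> ?V2 = {}"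
  proof -
    have "l \<notin> roots_in U 1" if l: "l \<in> roots_in D 1" for l
    proof -
      obtain a where "l = [:-a, 1:]"
        using roots_in_monic[OF l] monic_1 by blast
      then show ?thesis
        using l DU linear_roots_in by blast
    qed
    then show ?thesis by blast
  qed
  have "openin ?P ?V2"
    using openin_roots_in[OF assms(1)] openin_one_root[OF assms] by (simp only: openin_prod_Times_iff simp_thms)
  \<comment> \<open>The other splittings, with linear root in \<open>U\<close>, form an open part,
    so \<open>?V1\<close> is closed in the full preimage.\<close>
  then have o: "openin (subtopology ?P (?V1 \<union> ?V2)) ((?V1 \<union> ?V2) \<inter> ?V2)"
    by (rule openin_subtopology_Int2)
  have tV: "topspace (subtopology ?P (?V1 \<union> ?V2)) = ?V1 \<union> ?V2"
    unfolding pre[symmetric] topspace_subtopology by blast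
  have "closedin (subtopology ?P (?V1 \<union> ?V2)) (topspace (subtopology ?P (?V1 \<union> ?V2)) - (?V1 \<union> ?V2) \<inter> ?V2)"
    using o by blast
  moreover have "topspace (subtopology ?P (?V1 \<union> ?V2)) - (?V1 \<union> ?V2) \<inter> ?V2 = ?V1"
    unfolding tV using disj by blast
  ultimately have c: "closedin (subtopology ?P (?V1 \<union> ?V2)) ?V1"
    by (simp only:)
  have cl: "closed_map (subtopology ?P (?V1 \<union> ?V2)) (subtopology (monic_polys (Suc d)) ?W) ?m"
    by (rule closed_map_restriction[OF closed_map_monic_mult pre])
  show "closed_map (prod_topology (root_polys D 1) (root_polys U d)) (subtopology (monic_polys (Suc d)) ?W) ?m"
    unfolding src by (rule closed_map_from_subtopology[OF cl c])
  have tS: "topspace (prod_topology (root_polys D 1) (root_polys U d)) = ?V1"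
    by simp
  have tW: "topspace (subtopology (monic_polys (Suc d)) ?W) = ?W"
    by (auto simp: one_root_def)
  have maps: "?m ` ?V1 \<subseteq> ?W"
    using pre by blast
  show "continuous_map (prod_topology (root_polys D 1) (root_polys U d)) (subtopology (monic_polys (Suc d)) ?W) ?m"
    unfolding continuous_map_in_subtopology tS
    using continuous_map_from_subtopology[OF continuous_map_monic_mult[of 1 d]] maps
    unfolding root_polys_prod plus_1_eq_Suc image_subset_iff_funcset by blast
  show "?m ` topspace (prod_topology (root_polys D 1) (root_polys U d)) = topspace (subtopology (monic_polys (Suc d)) ?W)"
    unfolding tS tW
  proof (rule equalityI[OF maps], rule subsetI)
    fix p assume p: "p \<in> ?W"
    then have "size (filter_mset (\<lambda>z. z \<in> D) (proots p)) \<noteq> 0" and pm: "p \<in> monic (Suc d)"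
      by (auto simp: one_root_def)
    then obtain a where a: "a \<in># proots p" "a \<in> D"
      unfolding filter_mset_size_0_iff by blast
    then have "poly p a = 0"
      using pm monic_nonzero by auto
    then obtain q where q: "p = [:-a, 1:] * q"
      by (metis dvdE poly_eq_0_iff_dvd)
    then have qm: "q \<in> monic d"
      using monic_mult_cancel[OF monic_linear, of a q d] pm by simp
    have "([:-a, 1:], q) \<in> ?V1"
      using key[OF qm, of a] p q a(2) DU linear_roots_in[of a U] by blast
    then show "p \<in> ?m ` ?V1"
      by (rule rev_image_eqI) (simp add: q)
  qed
  show "inj_on ?m (topspace (prod_topology (root_polys D 1) (root_polys U d)))"
    unfolding tS
  proof (rule inj_onI)
    fix x y assume xy: "x \<in> ?V1" "y \<in> ?V1" "?m x = ?m y"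
    then obtain l q l' q' where e: "x = (l, q)" "y = (l', q')" "l \<in> roots_in D 1" "l' \<in> roots_in D 1"
      "q \<in> roots_in U d" "q' \<in> roots_in U d" "l * q = l' * q'"
      by auto
    obtain a a' where a: "l = [:-a, 1:]" "l' = [:-a', 1:]"
      using e roots_in_monic monic_1 by metis
    then have "a \<in> D" "a' \<in> D"
      using e linear_roots_in by auto
    have "poly (l' * q') a = 0"
      using e(7) a by (metis mult_zero_left poly_mult poly_eq_0_iff_dvd dvd_refl)
    \<comment> \<open>The roots of \<open>q'\<close> lie in \<open>U\<close>, which misses
      \<open>D\<close>, so \<open>a\<close> has to be the root of \<open>l'\<close>.\<close>
    moreover have "poly q' a \<noteq> 0"
      using e(6) \<open>a \<in> D\<close> DU by (auto simp: roots_in_iff)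
    ultimately have "a = a'"
      using a by simp
    then have "l = l'" using a by simp
    moreover have "l \<noteq> 0" using a by simp
    ultimately show "x = y"
      using e by simp
  qed
qed

section \<open>Contractible spaces and contractible factors\<close>

lemma contractible_one_root:
  assumes "open U" "convex U" "U \<noteq> {}" "open D" "convex D" "D \<noteq> {}" "D \<inter> U = {}"
  shows "contractible_space (subtopology (monic_polys (Suc d)) (one_root U D (Suc d)))"
proof -
  have "contractible_space (prod_topology (root_polys D 1) (root_polys U d))"
    using contractible_root_polys assms by (simp add: contractible_space_prod_topology)
  then show ?thesis
    using homeomorphic_map_imp_homeomorphic_space[OF homeomorphic_map_one_root[of U D d]]
      homeomorphic_space_contractibility assms by blast
qed

lemma roots_in_nonempty:
  assumes "U \<noteq> {}"
  shows "roots_in U d \<noteq> {}"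
proof -
  obtain a where a: "a \<in> U" using assms by blast
  have "[:-a, 1:] ^ d \<in> roots_in U d"
  proof (induction d)
    case (Suc d)
    then have "[:-a, 1:] * [:-a, 1:] ^ d \<in> roots_in U (1 + d)"
      using roots_in_mult[OF monic_linear roots_in_monic] linear_roots_in a by blast
    then show ?case by simp
  qed (auto simp: roots_in_def monic_0)
  then show ?thesis by blast
qed

lemma hiso_contractible:
  assumes f: "continuous_map X Y f" and "contractible_space X" "contractible_space Y"
    and "topspace X \<noteq> {}"
  shows "hiso i X {} Y {} f"
proof -
  obtain a where a: "a \<in> topspace X" using assms by blast
  have g: "continuous_map Y X (\<lambda>_. a)"
    using a by simp
  have "homotopic_with (\<lambda>x. True) X X ((\<lambda>_. a) \<circ> f) id" "homotopic_with (\<lambda>x. True) Y Y (f \<circ> (\<lambda>_. a)) id"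
    using continuous_map_compose[OF f g] continuous_map_compose[OF g f] assms(2,3)
    by (auto intro!: homotopic_into_contractible_space)
  then show ?thesis
    by (intro hiso_homotopy_equivalence[OF f _ g]) auto
qed

lemma hiso_snd_contractible:
  assumes "contractible_space X" "topspace X \<noteq> {}"
  shows "hiso i (prod_topology X Y) {} Y {} snd"
proof -
  obtain a where a: "a \<in> topspace X" using assms by blast
  let ?s = "\<lambda>y. (a, y)"
  have s: "continuous_map Y (prod_topology X Y) ?s"
    using a by (simp add: continuous_map_paired)
  have "homotopic_with (\<lambda>x. True) X X (\<lambda>_. a) id"
    using assms a by (auto intro!: homotopic_into_contractible_space)
  then have "homotopic_with (\<lambda>x. True) (prod_topology X Y) (prod_topology X Y)
      (\<lambda>z. ((\<lambda>_. a) (fst z), id (snd z))) (\<lambda>z. (id (fst z), id (snd z)))"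
    by (rule homotopic_with_prod_topology[where p = "\<lambda>_. True" and q = "\<lambda>_. True"]) auto
  then have "homotopic_with (\<lambda>x. True) (prod_topology X Y) (prod_topology X Y) (?s \<circ> snd) id"
    by (simp add: comp_def id_def)
  then show ?thesis
    by (intro hiso_homotopy_equivalence[OF continuous_map_snd _ s]) (auto intro!: homotopic_with_equal simp: comp_def)
qed

text \<open>The half-planes and the discs around the new points, reduced to open convex sets.
  Disjointness of \<open>D 0\<close> and \<open>D 1\<close> prevents the added roots from becoming
  common to all components.\<close>

locale half_plane_system =
  fixes n :: nat and U U' :: "complex set" and D :: "nat \<Rightarrow> complex set"
  assumes n: "n \<ge> 2" and U: "open U" "convex U" "U \<noteq> {}" and U': "open U'" "convex U'"
    and UU': "U \<subseteq> U'" and D: "\<And>j. j < n \<Longrightarrow> open (D j)" "\<And>j. j < n \<Longrightarrow> convex (D j)"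
      "\<And>j. j < n \<Longrightarrow> D j \<noteq> {}" "\<And>j. j < n \<Longrightarrow> D j \<subseteq> U'" "\<And>j. j < n \<Longrightarrow> D j \<inter> U = {}"
    and D01: "D 0 \<inter> D 1 = {}"
begin

text \<open>
  \<open>small e\<close> is the thickened image of the stabilization map. A root common to all components
  lies in \<open>U\<close>, since otherwise it would lie in \<open>D 0 \<inter> D 1 = {}\<close>; hence \<open>small e\<close> is
  stratified like \<open>big e\<close>.
\<close>

definition small :: "nat \<Rightarrow> (nat \<Rightarrow> complex poly) set" where
  "small e = PiE {..<n} (\<lambda>j. one_root U (D j) e)"

definition big :: "nat \<Rightarrow> (nat \<Rightarrow> complex poly) set" where
  "big e = PiE {..<n} (\<lambda>j. roots_in U' e)"

lemma small_subset: "small e \<subseteq> topspace (tuples e n)"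
  by (auto simp: small_def one_root_def PiE_def Pi_def)

lemma big_subset: "big e \<subseteq> topspace (tuples e n)"
  using roots_in_monic by (auto simp: big_def PiE_def Pi_def)

lemma small_big: "small e \<subseteq> big e"
  using D(4) UU' unfolding small_def big_def one_root_def roots_in_def by (intro PiE_mono) fastforce

lemma openin_small: "openin (tuples e n) (small e)"
  unfolding small_def using openin_one_root[OF U(1) D(1) D(5)] by (simp add: openin_PiE)

lemma openin_big: "openin (tuples e n) (big e)"
  unfolding big_def using openin_roots_in[OF U'(1)] by (simp add: openin_PiE)

lemma tup_mult_big:
  assumes "g \<in> monic k" "h \<in> topspace (tuples m n)"
  shows "tup_mult n (g, h) \<in> big (k + m) \<longleftrightarrow> g \<in> roots_in U' k \<and> h \<in> big m"
proof -
  have h: "h j \<in> monic m" if "j < n" for j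
    using tuples_monic[OF assms(2) that] .
  have "tup_mult n (g, h) \<in> big (k + m) \<longleftrightarrow> (\<forall>j<n. g * h j \<in> roots_in U' (k + m))"
    by (auto simp: tup_mult_def big_def PiE_iff)
  also have "\<dots> \<longleftrightarrow> (\<forall>j<n. g \<in> roots_in U' k \<and> h j \<in> roots_in U' m)"
    using roots_in_mult[OF assms(1) h] by blast
  also have "\<dots> \<longleftrightarrow> g \<in> roots_in U' k \<and> h \<in> big m"
  proof -
    have "0 < n"
      using n by simp
    then have "(\<forall>j<n. g \<in> roots_in U' k \<and> h j \<in> roots_in U' m) \<longleftrightarrow> g \<in> roots_in U' k \<and> (\<forall>j<n. h j \<in> roots_in U' m)"
      by blast
    moreover have "h \<in> big m \<longleftrightarrow> (\<forall>j<n. h j \<in> roots_in U' m)"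
      using assms(2) by (auto simp: big_def PiE_iff)
    ultimately show ?thesis by blast
  qed
  finally show ?thesis .
qed

lemma tup_mult_small:
  assumes g: "g \<in> monic k" and h: "h \<in> topspace (tuples m n)"
  shows "tup_mult n (g, h) \<in> small (k + m) \<longleftrightarrow> g \<in> roots_in U k \<and> h \<in> small m"
proof -
  have hm: "h j \<in> monic m" if "j < n" for j
    using tuples_monic[OF h that] .
  have "tup_mult n (g, h) \<in> small (k + m) \<longleftrightarrow> (\<forall>j<n. g * h j \<in> one_root U (D j) (k + m))"
    by (auto simp: tup_mult_def small_def PiE_iff)
  also have "\<dots> \<longleftrightarrow> g \<in> roots_in U k \<and> (\<forall>j<n. h j \<in> one_root U (D j) m)"
  proof -
    have "g \<in> roots_in U k" if *: "\<forall>j<n. g * h j \<in> one_root U (D j) (k + m)"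
    proof -
      have "z \<in> U" if "z \<in># proots g" for z
      proof -
        have "z \<in> U \<union> D j" if "j < n" for j
        proof -
          have "z \<in># proots (g * h j)"
            using \<open>z \<in># proots g\<close> by (simp add: proots_mult_monic[OF g hm[OF that]])
          then show ?thesis
            using * that unfolding one_root_def by blast
        qed
        from this[of 0] this[of 1] show ?thesis
          using n D01 by auto
      qed
      then show ?thesis
        using g by (auto simp: roots_in_def)
    qed
    then show ?thesis
      using one_root_mult[OF g hm _ D(5)] by blast
  qed
  also have "\<dots> \<longleftrightarrow> g \<in> roots_in U k \<and> h \<in> small m"
    using h by (auto simp: small_def PiE_iff)
  finally show ?thesis .
qed

lemma stratum_data_small:
  assumes "1 \<le> k" "k \<le> e"
  shows "stratum_data n e k (small e) (roots_in U k) (small (e - k))"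
proof -
  have "e = k + (e - k)" using assms by simp
  then show ?thesis
    using tup_mult_small[of _ k _ "e - k"] hol_subset assms n
    unfolding stratum_data_def by (auto simp: openin_small openin_roots_in[OF U(1)] subset_eq)
qed

lemma stratum_data_big:
  assumes "1 \<le> k" "k \<le> e"
  shows "stratum_data n e k (big e) (roots_in U' k) (big (e - k))"
proof -
  have "e = k + (e - k)" using assms by simp
  then show ?thesis
    using tup_mult_big[of _ k _ "e - k"] hol_subset assms n
    unfolding stratum_data_def by (auto simp: openin_big openin_roots_in[OF U'(1)] subset_eq)
qed

text \<open>Both sides are products of contractible spaces. Positive degree matters: in degree 0 no
  polynomial has a root in \<open>D j\<close>, so \<open>small 0\<close> is empty.\<close>

lemma hiso_small_big: "hiso i (subtopology (tuples (Suc e) n) (small (Suc e))) {} (subtopology (tuples (Suc e) n) (big (Suc e))) {} id"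
proof (rule hiso_contractible)
  show "continuous_map (subtopology (tuples (Suc e) n) (small (Suc e))) (subtopology (tuples (Suc e) n) (big (Suc e))) id"
    by (rule continuous_map_inclusion[OF small_big])
  show "contractible_space (subtopology (tuples (Suc e) n) (small (Suc e)))"
    unfolding small_def subtopology_product_topology contractible_space_product_topology
    using contractible_one_root[OF U D(1,2,3,5)] by auto
  have "U' \<noteq> {}"
    using U UU' by blast
  then show "contractible_space (subtopology (tuples (Suc e) n) (big (Suc e)))"
    unfolding big_def subtopology_product_topology contractible_space_product_topology
    using contractible_root_polys[OF U'(2)] by (simp add: root_polys_def)
  have "one_root U (D j) (Suc e) \<noteq> {}" if j: "j < n" for j
  proof -
    obtain a q where "a \<in> D j" "q \<in> roots_in U e"
      using D(3)[OF j] roots_in_nonempty[OF U(3), of e] by blast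
    then show ?thesis
      using one_root_linear_mult[OF roots_in_monic[of q U e] D(5)[OF j], of a] by blast
  qed
  then have "small (Suc e) \<noteq> {}"
    unfolding small_def by (simp add: PiE_eq_empty_iff)
  then show "topspace (subtopology (tuples (Suc e) n) (small (Suc e))) \<noteq> {}"
    using small_subset by (simp only: topspace_subtopology_subset not_False_eq_True)
qed

text \<open>The spaces of greatest common divisors, with roots in \<open>U\<close> and in
  \<open>U'\<close>, are contractible factors and can be projected away.\<close>

lemma hiso_zero_section:
  assumes "hiso i (subtopology (tuples m n) (small m \<inter> hol m n)) {} (subtopology (tuples m n) (big m \<inter> hol m n)) {} id"
  shows "hiso i (subtopology (prod_topology (monic_polys k) (tuples m n)) (roots_in U k \<times> (small m \<inter> hol m n))) {}
    (subtopology (prod_topology (monic_polys k) (tuples m n)) (roots_in U' k \<times> (big m \<inter> hol m n))) {} id"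
proof -
  let ?A = "subtopology (tuples m n) (small m \<inter> hol m n)" and ?A' = "subtopology (tuples m n) (big m \<inter> hol m n)"
  have "U' \<noteq> {}"
    using U UU' by blast
  have RR: "roots_in U k \<subseteq> roots_in U' k"
    using UU' by (auto simp: roots_in_def)
  have "hiso i (prod_topology (root_polys U k) ?A) {} (prod_topology (root_polys U' k) ?A') {} id"
  proof (rule hiso_square[THEN iffD2])
    show "hiso i (prod_topology (root_polys U k) ?A) {} ?A {} snd"
      using contractible_root_polys[OF U(2,3)] roots_in_nonempty[OF U(3)] by (intro hiso_snd_contractible) auto
    show "hiso i (prod_topology (root_polys U' k) ?A') {} ?A' {} snd"
      using contractible_root_polys[OF U'(2) \<open>U' \<noteq> {}\<close>] roots_in_nonempty[OF \<open>U' \<noteq> {}\<close>] by (intro hiso_snd_contractible) auto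
    show "hiso i ?A {} ?A' {} id" by fact
    then show "pair_map ?A {} ?A' {} id"
      by (rule hiso_pair_map)
    show "pair_map (prod_topology (root_polys U k) ?A) {} (prod_topology (root_polys U' k) ?A') {} id"
      unfolding root_polys_def subtopology_Times[symmetric]
      using RR small_big by (intro pair_map_inclusion) blast+
  qed auto
  then show ?thesis
    unfolding root_polys_def subtopology_Times .
qed

text \<open>Strong induction on the degree: the stratum with gcd of degree \<open>k\<close> reduces
  to degree \<open>e - k\<close>. An inner downward induction on \<open>k\<close> removes the
  strata.\<close>

theorem hiso_small_big_hol:
  "i \<le> (2 * int n - 3) * int e - 1 \<Longrightarrow>
    hiso i (subtopology (tuples e n) (small e \<inter> hol e n)) {} (subtopology (tuples e n) (big e \<inter> hol e n)) {} id"
proof (induction e arbitrary: i rule: less_induct)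
  case (less e)
  let ?T = "tuples e n" and ?S = "\<lambda>k. small e \<inter> gcd_le e n k" and ?B = "\<lambda>k. big e \<inter> gcd_le e n k"
  let ?D = "(2 * int n - 3) * int e - 1"
  show ?case
  proof (cases e)
    case 0
    then show ?thesis
      using less.prems by (intro hiso_negative pair_map_inclusion) (use small_big in auto)
  next
    case (Suc e')
    have stratum: "hiso i (subtopology ?T (?S k)) (?S (k - 1)) (subtopology ?T (?B k)) (?B (k - 1)) id"
      if k: "1 \<le> k" "k \<le> e" and i: "i \<le> ?D + int k" for i k
    proof -
      \<comment> \<open>The degree in which the comparison of tuples of degree \<open>e - k\<close>
        is required, obtained by reversing the shift 2(n-1)k.\<close>
      define i' where "i' = i - 2 * int k * int n + 2 * int k"
      \<comment> \<open>The surplus \<open>k\<close> in the bound on \<open>i\<close> is the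
        difference between 2(n-1)k and (2n-3)k.\<close>
      have "i' \<le> (2 * int n - 3) * int (e - k) - 1"
        using i k by (simp add: i'_def of_nat_diff algebra_simps)
      then have "hiso i' (subtopology (tuples (e - k) n) (small (e - k) \<inter> hol (e - k) n)) {}
          (subtopology (tuples (e - k) n) (big (e - k) \<inter> hol (e - k) n)) {} id"
        using k by (intro less.IH) auto
      from hiso_zero_section[OF this, of k]
      have z: "hiso i' (subtopology (prod_topology (monic_polys k) (tuples (e - k) n)) (zero_section n e k (roots_in U k) (small (e - k)))) {}
          (subtopology (prod_topology (monic_polys k) (tuples (e - k) n)) (zero_section n e k (roots_in U' k) (big (e - k)))) {} id"
        unfolding zero_section_def .
      have RR: "roots_in U k \<subseteq> roots_in U' k"
        using UU' by (auto simp: roots_in_def)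
      have "i' + 2 * int k * int n - 2 * int k = i"
        by (simp add: i'_def)
      then show ?thesis
        using hiso_stratum[OF stratum_data_small[OF k] stratum_data_big[OF k] small_big RR small_big z] by (simp only:)
    qed
    have sub: "subtopology (subtopology ?T (W \<inter> gcd_le e n k)) (W \<inter> gcd_le e n (k - 1)) = subtopology ?T (W \<inter> gcd_le e n (k - 1))" for W k
    proof -
      have "gcd_le e n (k - 1) \<subseteq> gcd_le e n k"
        unfolding gcd_le_def by force
      then show ?thesis
        unfolding subtopology_subtopology by (intro arg_cong[of _ _ "subtopology ?T"]) blast
    qed
    have all: "W \<inter> gcd_le e n e = W" if "W \<subseteq> topspace ?T" for W
      using that degree_tgcd_le[of _ e n] n unfolding gcd_le_def by (auto simp del: topspace_product_topology)
    \<comment> \<open>Downwards from \<open>k = e\<close>, where no stratum is removed and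
      contractibility gives all degrees, to \<open>k = 0\<close>.\<close>
    have "k \<le> e \<Longrightarrow> i \<le> ?D + int k \<Longrightarrow> hiso i (subtopology ?T (?S k)) {} (subtopology ?T (?B k)) {} id" for i k
    proof (induction "e - k" arbitrary: k i)
      case 0
      then have "k = e" by simp
      then show ?case
        using hiso_small_big[of i e'] all[OF small_subset] all[OF big_subset] Suc by (simp only:)
    next
      case (Suc m)
      have IH: "hiso j (subtopology ?T (?S (Suc k))) {} (subtopology ?T (?B (Suc k))) {} id" if "j \<le> ?D + int (Suc k)" for j
        using Suc.hyps(2) that by (intro Suc.hyps(1)) auto
      have st: "hiso j (subtopology ?T (?S (Suc k))) (?S k) (subtopology ?T (?B (Suc k))) (?B k) id" if "j \<le> ?D + int (Suc k)" for j
        using stratum[of "Suc k" j] Suc.hyps(2) that by simp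
      \<comment> \<open>Degree \<open>i + 1\<close> of level \<open>Suc k\<close> and of the pair is
        within reach because their bound is one larger than that of level \<open>k\<close>.\<close>
      have "hiso i (subtopology (subtopology ?T (?S (Suc k))) (?S k)) {} (subtopology (subtopology ?T (?B (Suc k))) (?B k)) {} id"
        using Suc.prems(2) by (intro hiso_subspace IH st) auto
      then show ?case
        using sub[of _ "Suc k"] by simp
    qed
    moreover have "i \<le> ?D + int 0"
      using less.prems by simp
    ultimately show ?thesis
      unfolding hol_eq_gcd_le by blast
  qed
qed

end

section \<open>The stabilization map\<close>

definition roots_tuples :: "complex set \<Rightarrow> nat \<Rightarrow> nat \<Rightarrow> (nat \<Rightarrow> complex poly) topology" where
  "roots_tuples U d n = subtopology (product_topology (\<lambda>_. root_polys U d) {..<n}) (hol d n)"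

lemma roots_tuples_eq:
  "roots_tuples U d n = subtopology (tuples d n) (PiE {..<n} (\<lambda>_. roots_in U d) \<inter> hol d n)"
  unfolding roots_tuples_def root_polys_def
  by (simp only: subtopology_product_topology[symmetric] subtopology_subtopology)

lemma roots_in_tuples: "PiE {..<n} (\<lambda>_. roots_in U d) \<subseteq> topspace (tuples d n)"
  using roots_in_monic by (auto simp: PiE_def Pi_def)

lemma topspace_roots_tuples: "topspace (roots_tuples U d n) = PiE {..<n} (\<lambda>_. roots_in U d) \<inter> hol d n"
  unfolding roots_tuples_eq using hol_subset[of d n] by (intro topspace_subtopology_subset) blast

lemma Hol_eq_roots_tuples:
  assumes "n > 0"
  shows "Hol d n = roots_tuples UNIV d n"
proof -
  have "PiE {..<n} (\<lambda>_. roots_in UNIV d) \<inter> hol d n = hol d n"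
    using hol_subset[of d n] unfolding roots_in_UNIV by auto
  then show ?thesis
    unfolding Hol_eq[OF assms] roots_tuples_eq by simp
qed

lemma hol_iff:
  assumes "f \<in> topspace (tuples d n)" "n > 0"
  shows "f \<in> hol d n \<longleftrightarrow> \<not> (\<exists>z. \<forall>j<n. poly (f j) z = 0)"
  using degree_tgcd_0_iff[OF assms] assms(1) unfolding hol_def by blast

definition root_tup_map :: "nat \<Rightarrow> (complex \<Rightarrow> complex) \<Rightarrow> (nat \<Rightarrow> complex poly) \<Rightarrow> nat \<Rightarrow> complex poly" where
  "root_tup_map n \<theta> f = (\<lambda>j\<in>{..<n}. root_map \<theta> (f j))"

lemma continuous_map_root_map_fixed:
  assumes "continuous_on U \<theta>" "\<And>x. x \<in> U \<Longrightarrow> \<theta> x \<in> V"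
  shows "continuous_map (root_polys U d) (root_polys V d) (root_map \<theta>)"
proof -
  \<comment> \<open>A one-point parameter space specialises the result on families of maps to a
    single map.\<close>
  have "continuous_map (prod_topology (top_of_set {0::real}) (top_of_set U)) euclidean (\<lambda>(t, x). \<theta> x)"
    using continuous_map_compose[OF continuous_map_snd, of "top_of_set U" euclidean \<theta> "top_of_set {0::real}"] assms(1)
    by (simp add: comp_def case_prod_unfold)
  then have c: "continuous_map (prod_topology (top_of_set {0::real}) (root_polys U d)) poly_topology (\<lambda>(t, p). root_map \<theta> p)"
    by (rule continuous_map_root_map)
  have "continuous_map (root_polys U d) (prod_topology (top_of_set {0::real}) (root_polys U d)) (\<lambda>p. (0, p))"
    by (simp add: continuous_map_paired)
  from continuous_map_compose[OF this c]
  have "continuous_map (root_polys U d) poly_topology ((\<lambda>(t, p). root_map \<theta> p) \<circ> (\<lambda>p. (0::real, p)))" .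
  then show ?thesis
    using root_map_roots_in[of _ U d \<theta> V] assms(2) unfolding continuous_map_into_root_polys
    by (auto simp: comp_def)
qed

lemma proots_root_map: "proots (root_map \<theta> p) = image_mset \<theta> (proots p)"
proof -
  have "root_map \<theta> p = (\<Prod>x\<in>#image_mset \<theta> (proots p). [:- x, 1:])"
    by (simp add: root_map_def image_mset.compositionality comp_def)
  then show ?thesis
    by (simp only: prod_roots(4))
qed

text \<open>A common root of the moved components comes from a root of each component, and
  injectivity makes these preimages coincide.\<close>

lemma root_tup_map_hol:
  assumes f: "f \<in> topspace (roots_tuples U d n)" and \<theta>: "inj_on \<theta> U" "\<And>x. x \<in> U \<Longrightarrow> \<theta> x \<in> V" and n: "n > 0"
  shows "root_tup_map n \<theta> f \<in> topspace (roots_tuples V d n)"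
proof -
  have fj: "f j \<in> roots_in U d" if "j < n" for j
    using f that unfolding topspace_roots_tuples by auto
  have m: "root_map \<theta> (f j) \<in> roots_in V d" if "j < n" for j
    using root_map_roots_in[OF fj[OF that] \<theta>(2)] .
  then have P: "root_tup_map n \<theta> f \<in> PiE {..<n} (\<lambda>_. roots_in V d)"
    by (auto simp: root_tup_map_def)
  have no: "\<not> (\<exists>z. \<forall>j<n. poly (f j) z = 0)"
    using f hol_iff[OF _ n] hol_subset unfolding topspace_roots_tuples by blast
  have "\<not> (\<exists>w. \<forall>j<n. poly (root_map \<theta> (f j)) w = 0)"
  proof
    assume "\<exists>w. \<forall>j<n. poly (root_map \<theta> (f j)) w = 0"
    then obtain w where w: "\<And>j. j < n \<Longrightarrow> poly (root_map \<theta> (f j)) w = 0"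
      by blast
    have "\<exists>z. poly (f j) z = 0 \<and> z \<in> U \<and> w = \<theta> z" if j: "j < n" for j
    proof -
      have "w \<in># proots (root_map \<theta> (f j))"
        using w[OF j] monic_nonzero[OF roots_in_monic[OF m[OF j]]] by simp
      then obtain z where "z \<in># proots (f j)" "w = \<theta> z"
        unfolding proots_root_map by auto
      then show ?thesis
        using fj[OF j] monic_nonzero[OF roots_in_monic[OF fj[OF j]]] by (auto simp: roots_in_def)
    qed
    then obtain z where z: "\<And>j. j < n \<Longrightarrow> poly (f j) (z j) = 0 \<and> z j \<in> U \<and> w = \<theta> (z j)"
      by metis
    have "z j = z 0" if "j < n" for j
      using z[OF that] z[OF n] \<theta>(1) by (auto simp: inj_on_def)
    then have "\<forall>j<n. poly (f j) (z 0) = 0"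
      using z by metis
    with no show False by blast
  qed
  then have no': "\<not> (\<exists>w. \<forall>j<n. poly (root_tup_map n \<theta> f j) w = 0)"
    by (simp add: root_tup_map_def)
  have "root_tup_map n \<theta> f \<in> topspace (tuples d n)"
    using P roots_in_tuples by blast
  then have "root_tup_map n \<theta> f \<in> hol d n"
    using hol_iff[OF _ n] no' by blast
  with P show ?thesis
    unfolding topspace_roots_tuples by blast
qed

lemma homeomorphic_map_root_tup_map:
  assumes \<theta>: "continuous_on U \<theta>" "continuous_on V \<eta>" "\<And>x. x \<in> U \<Longrightarrow> \<theta> x \<in> V \<and> \<eta> (\<theta> x) = x"
    "\<And>y. y \<in> V \<Longrightarrow> \<eta> y \<in> U \<and> \<theta> (\<eta> y) = y" and n: "n > 0"
  shows "homeomorphic_map (roots_tuples U d n) (roots_tuples V d n) (root_tup_map n \<theta>)"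
proof (rule homeomorphic_maps_imp_map)
  have cont: "continuous_map (roots_tuples U d n) (roots_tuples V d n) (root_tup_map n \<theta>)"
    if "continuous_on U \<theta>" "inj_on \<theta> U" "\<And>x. x \<in> U \<Longrightarrow> \<theta> x \<in> V" for U V \<theta>
  proof -
    have "continuous_map (roots_tuples U d n) (root_polys V d) (\<lambda>f. root_map \<theta> (f j))" if j: "j < n" for j
    proof -
      have "continuous_map (roots_tuples U d n) (root_polys U d) (\<lambda>f. f j)"
        unfolding roots_tuples_def using j by (intro continuous_map_from_subtopology continuous_map_product_projection) simp
      from continuous_map_compose[OF this continuous_map_root_map_fixed[of U \<theta> V d]] show ?thesis
        using \<open>continuous_on U \<theta>\<close> \<open>\<And>x. x \<in> U \<Longrightarrow> \<theta> x \<in> V\<close> by (simp add: comp_def)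
    qed
    then have "continuous_map (roots_tuples U d n) (product_topology (\<lambda>_. root_polys V d) {..<n}) (root_tup_map n \<theta>)"
      unfolding continuous_map_componentwise by (auto simp: root_tup_map_def)
    moreover have "root_tup_map n \<theta> ` topspace (roots_tuples U d n) \<subseteq> hol d n"
      using root_tup_map_hol[OF _ that(2,3) n, of _ d] unfolding topspace_roots_tuples by blast
    ultimately show ?thesis
      unfolding roots_tuples_def[of V] continuous_map_in_subtopology image_subset_iff_funcset by blast
  qed
  have inj: "inj_on \<theta> U" "inj_on \<eta> V"
    using \<theta>(3,4) by (metis inj_on_inverseI)+
  have inv: "root_tup_map n \<eta> (root_tup_map n \<theta> f) = f"
    if "f \<in> topspace (roots_tuples U d n)" "\<And>x. x \<in> U \<Longrightarrow> \<eta> (\<theta> x) = x" for f U \<theta> \<eta>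
  proof
    fix j
    show "root_tup_map n \<eta> (root_tup_map n \<theta> f) j = f j"
    proof (cases "j < n")
      case True
      then have "f j \<in> roots_in U d"
        using that(1) unfolding topspace_roots_tuples by auto
      then have "root_map (\<eta> \<circ> \<theta>) (f j) = f j"
        using that(2) by (intro root_map_ident) auto
      then show ?thesis
        using True by (simp add: root_tup_map_def root_map_compose)
    next
      case False
      then show ?thesis
        using that(1) unfolding topspace_roots_tuples by (simp add: root_tup_map_def PiE_def extensional_def)
    qed
  qed
  show "homeomorphic_maps (roots_tuples U d n) (roots_tuples V d n) (root_tup_map n \<theta>) (root_tup_map n \<eta>)"
    unfolding homeomorphic_maps_def
  proof (intro conjI ballI)
    show "continuous_map (roots_tuples U d n) (roots_tuples V d n) (root_tup_map n \<theta>)"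
      using \<theta>(3) by (intro cont[OF \<theta>(1) inj(1)]) blast
    show "continuous_map (roots_tuples V d n) (roots_tuples U d n) (root_tup_map n \<eta>)"
      using \<theta>(4) by (intro cont[OF \<theta>(2) inj(2)]) blast
    show "root_tup_map n \<eta> (root_tup_map n \<theta> f) = f" if "f \<in> topspace (roots_tuples U d n)" for f
      using \<theta>(3) by (intro inv[OF that]) blast
    show "root_tup_map n \<theta> (root_tup_map n \<eta> f) = f" if "f \<in> topspace (roots_tuples V d n)" for f
      using \<theta>(4) by (intro inv[OF that]) blast
  qed
qed

section \<open>The thickened image and the addition of fixed roots\<close>

lemma homeomorphic_map_product_prod:
  assumes "\<And>i. i \<in> I \<Longrightarrow> homeomorphic_map (prod_topology (X i) (Y i)) (Z i) (m i)"
  shows "homeomorphic_map (prod_topology (product_topology X I) (product_topology Y I)) (product_topology Z I)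
    (\<lambda>(f, g). \<lambda>i\<in>I. m i (f i, g i))"
proof -
  obtain k where k: "\<And>i. i \<in> I \<Longrightarrow> homeomorphic_maps (prod_topology (X i) (Y i)) (Z i) (m i) (k i)"
    using assms unfolding homeomorphic_map_maps by metis
  have c: "\<And>i. i \<in> I \<Longrightarrow> continuous_map (prod_topology (X i) (Y i)) (Z i) (m i)"
    "\<And>i. i \<in> I \<Longrightarrow> continuous_map (Z i) (prod_topology (X i) (Y i)) (k i)"
    "\<And>i x. i \<in> I \<Longrightarrow> x \<in> topspace (prod_topology (X i) (Y i)) \<Longrightarrow> k i (m i x) = x"
    "\<And>i x. i \<in> I \<Longrightarrow> x \<in> topspace (Z i) \<Longrightarrow> m i (k i x) = x"
    using k unfolding homeomorphic_maps_def by blast+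
  let ?S = "prod_topology (product_topology X I) (product_topology Y I)" and ?T = "product_topology Z I"
  let ?m = "\<lambda>(f, g). \<lambda>i\<in>I. m i (f i, g i)" and ?k = "\<lambda>h. (\<lambda>i\<in>I. fst (k i (h i)), \<lambda>i\<in>I. snd (k i (h i)))"
  have "homeomorphic_maps ?S ?T ?m ?k"
    unfolding homeomorphic_maps_def
  proof (intro conjI ballI)
    have "continuous_map ?S (Z i) (\<lambda>x. m i (fst x i, snd x i))" if i: "i \<in> I" for i
    proof -
      have "continuous_map ?S (X i) (\<lambda>x. fst x i)" "continuous_map ?S (Y i) (\<lambda>x. snd x i)"
        using continuous_map_compose[OF continuous_map_fst continuous_map_product_projection[OF i]]
          continuous_map_compose[OF continuous_map_snd continuous_map_product_projection[OF i]]
        unfolding comp_def by blast+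
      then have "continuous_map ?S (prod_topology (X i) (Y i)) (\<lambda>x. (fst x i, snd x i))"
        by (simp only: continuous_map_paired simp_thms)
      from continuous_map_compose[OF this c(1)[OF i]] show ?thesis
        by (simp add: comp_def)
    qed
    then show "continuous_map ?S ?T ?m"
      unfolding continuous_map_componentwise case_prod_unfold by auto
    have "continuous_map ?T (X i) (\<lambda>h. fst (k i (h i)))" "continuous_map ?T (Y i) (\<lambda>h. snd (k i (h i)))" if i: "i \<in> I" for i
    proof -
      have "continuous_map ?T (Z i) (\<lambda>h. h i)"
        using i by (rule continuous_map_product_projection)
      from continuous_map_compose[OF this c(2)[OF i]]
      have *: "continuous_map ?T (prod_topology (X i) (Y i)) (\<lambda>h. k i (h i))"
        by (simp add: comp_def)
      show "continuous_map ?T (X i) (\<lambda>h. fst (k i (h i)))" "continuous_map ?T (Y i) (\<lambda>h. snd (k i (h i)))"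
        using continuous_map_compose[OF * continuous_map_fst] continuous_map_compose[OF * continuous_map_snd]
        unfolding comp_def .
    qed
    then show "continuous_map ?T ?S ?k"
      unfolding continuous_map_paired continuous_map_componentwise by auto
    show "?k (?m x) = x" if xS: "x \<in> topspace ?S" for x
    proof -
      obtain f g where x: "x = (f, g)" "f \<in> PiE I (\<lambda>i. topspace (X i))" "g \<in> PiE I (\<lambda>i. topspace (Y i))"
        using xS by auto
      have "k i (m i (f i, g i)) = (f i, g i)" if "i \<in> I" for i
        using x that by (intro c(3)) auto
      then show ?thesis
        using x by (auto simp: fun_eq_iff PiE_def extensional_def)
    qed
    show "?m (?k h) = h" if "h \<in> topspace ?T" for h
      using that c(4) by (auto simp: fun_eq_iff PiE_def extensional_def)
  qed
  then show ?thesis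
    by (rule homeomorphic_maps_imp_map)
qed

context half_plane_system
begin

definition add_roots :: "(nat \<Rightarrow> complex) \<Rightarrow> (nat \<Rightarrow> complex poly) \<Rightarrow> nat \<Rightarrow> complex poly" where
  "add_roots x f = (\<lambda>j\<in>{..<n}. [:- x j, 1:] * f j)"

text \<open>Splitting off the roots in the discs makes the thickened image a product of
  \<open>roots_tuples U d n\<close> with contractible spaces of linear factors. Adding the fixed
  roots \<open>x j\<close> is a section of this product.\<close>

lemma hiso_add_roots:
  assumes x: "\<And>j. j < n \<Longrightarrow> x j \<in> D j"
  shows "hiso i (roots_tuples U d n) {} (subtopology (tuples (Suc d) n) (small (Suc d) \<inter> hol (Suc d) n)) {} (add_roots x)"
proof -
  let ?L = "product_topology (\<lambda>j. root_polys (D j) 1) {..<n}"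
  let ?P = "product_topology (\<lambda>_. root_polys U d) {..<n}"
  let ?Q = "product_topology (\<lambda>j. subtopology (monic_polys (Suc d)) (one_root U (D j) (Suc d))) {..<n}"
  let ?m = "\<lambda>(l, f). \<lambda>j\<in>{..<n}. (\<lambda>(p, q). p * (q :: complex poly)) (l j, f j)"
  have "homeomorphic_map (prod_topology ?L ?P) ?Q ?m"
    by (rule homeomorphic_map_product_prod) (use homeomorphic_map_one_root[OF U(1) D(1) D(5)] in simp)
  then have "homeomorphic_map (subtopology (prod_topology ?L ?P) (topspace ?L \<times> hol d n)) (subtopology ?Q (hol (Suc d) n)) ?m"
  proof (rule homeomorphic_map_subtopologies_alt)
    fix y assume y: "y \<in> topspace (prod_topology ?L ?P)" "?m y \<in> topspace ?Q"
    obtain l f where yl: "y = (l, f)"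
      by (metis surj_pair)
    have l: "l j \<in> roots_in (D j) 1" and f: "f j \<in> roots_in U d" if "j < n" for j
      using y(1) that unfolding yl by auto
    have fT: "f \<in> topspace (tuples d n)"
      using y(1) roots_in_tuples[of n U d] unfolding yl by auto
    have mT: "?m y \<in> topspace (tuples (Suc d) n)"
      using y(2) by (auto simp: one_root_def PiE_iff)
    have n0: "n > 0"
      using n by simp
    \<comment> \<open>The new linear factors create no common root: one outside \<open>U\<close>
      would lie in both \<open>D 0\<close> and \<open>D 1\<close>, and inside \<open>U\<close> they
      do not vanish.\<close>
    have "(\<exists>z. \<forall>j<n. poly (?m y j) z = 0) \<longleftrightarrow> (\<exists>z. \<forall>j<n. poly (f j) z = 0)"
    proof
      assume "\<exists>z. \<forall>j<n. poly (?m y j) z = 0"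
      then obtain z where z: "\<And>j. j < n \<Longrightarrow> poly (l j) z = 0 \<or> poly (f j) z = 0"
        unfolding yl by auto
      have zl: "z \<in> D j" if "j < n" "poly (l j) z = 0" for j
        using l[OF that(1)] that(2) by (simp add: roots_in_iff)
      have zf: "z \<in> U" if "j < n" "poly (f j) z = 0" for j
        using f[OF that(1)] that(2) by (simp add: roots_in_iff)
      have "z \<in> U"
      proof (rule ccontr)
        assume "z \<notin> U"
        then have "z \<in> D 0" "z \<in> D 1"
          using z[of 0] z[of 1] zl[of 0] zl[of 1] zf[of 0] zf[of 1] n by auto
        then show False
          using D01 by blast
      qed
      then have "poly (f j) z = 0" if "j < n" for j
        using z[OF that] zl[OF that] D(5)[OF that] by blast
      then show "\<exists>z. \<forall>j<n. poly (f j) z = 0"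
        by blast
    qed (auto simp: yl)
    then have "?m y \<in> hol (Suc d) n \<longleftrightarrow> f \<in> hol d n"
      using hol_iff[OF mT n0] hol_iff[OF fT n0] by blast
    then show "?m y \<in> hol (Suc d) n \<longleftrightarrow> y \<in> topspace ?L \<times> hol d n"
      using y(1) unfolding yl topspace_prod_topology by blast
  qed
  moreover have "subtopology (prod_topology ?L ?P) (topspace ?L \<times> hol d n) = prod_topology ?L (roots_tuples U d n)"
    unfolding roots_tuples_def subtopology_Times subtopology_topspace ..
  moreover have "subtopology ?Q (hol (Suc d) n) = subtopology (tuples (Suc d) n) (small (Suc d) \<inter> hol (Suc d) n)"
    unfolding small_def by (simp only: subtopology_product_topology[symmetric] subtopology_subtopology)
  ultimately have m: "hiso i (prod_topology ?L (roots_tuples U d n)) {}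
      (subtopology (tuples (Suc d) n) (small (Suc d) \<inter> hol (Suc d) n)) {} ?m"
    by (intro hiso_homeomorphism) auto
  let ?l = "\<lambda>j\<in>{..<n}. [:- x j, 1:]"
  have l: "?l \<in> topspace ?L"
    using x linear_roots_in[of _ "D _"] by (auto simp: linear_roots_in[unfolded One_nat_def])
  have "contractible_space ?L"
    unfolding contractible_space_product_topology using contractible_root_polys D(2,3) by blast
  then have snd: "hiso i (prod_topology ?L (roots_tuples U d n)) {} (roots_tuples U d n) {} snd"
    using l by (intro hiso_snd_contractible) blast+
  have s: "pair_map (roots_tuples U d n) {} (prod_topology ?L (roots_tuples U d n)) {} (\<lambda>f. (?l, f))"
    using l by (simp add: pair_map_def continuous_map_paired)
  \<comment> \<open>Composed with the projection, which is an isomorphism in homology, this section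
    is the identity.\<close>
  have "hiso i (roots_tuples U d n) {} (prod_topology ?L (roots_tuples U d n)) {} (\<lambda>f. (?l, f))"
    by (rule hiso_square[OF s hiso_pair_map[OF hiso_id] hiso_id snd, THEN iffD2]) (auto intro: hiso_id)
  from hiso_compose[OF this m]
  have "hiso i (roots_tuples U d n) {} (subtopology (tuples (Suc d) n) (small (Suc d) \<inter> hol (Suc d) n)) {} (?m \<circ> (\<lambda>f. (?l, f)))" .
  moreover have "?m \<circ> (\<lambda>f. (?l, f)) = add_roots x"
    by (auto simp: fun_eq_iff add_roots_def)
  ultimately show ?thesis
    by (simp only:)
qed

lemma hiso_stabilization:
  assumes "\<And>j. j < n \<Longrightarrow> x j \<in> D j" and "i \<le> (2 * int n - 3) * (int d + 1) - 1"
  shows "hiso i (roots_tuples U d n) {} (roots_tuples U' (Suc d) n) {} (add_roots x)"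
proof -
  have "hiso i (subtopology (tuples (Suc d) n) (small (Suc d) \<inter> hol (Suc d) n)) {} (roots_tuples U' (Suc d) n) {} id"
    using hiso_small_big_hol[of i "Suc d"] assms(2) unfolding roots_tuples_eq big_def by (simp add: add.commute)
  from hiso_compose[OF hiso_add_roots[OF assms(1)] this] show ?thesis
    by simp
qed

end

text \<open>In terms of polynomials, adding the point \<open>x j\<close> to a multiset of roots is
  multiplication by a linear factor, between two changes of the plane.\<close>

lemma stab_eq:
  assumes "f \<in> topspace (Hol d n)"
  shows "stab n \<phi> \<psi> x f = root_tup_map n (inv_into UNIV \<psi>)
    (\<lambda>j\<in>{..<n}. [:- x j, 1:] * root_tup_map n \<phi> f j)"
proof
  fix j
  let ?\<eta> = "inv_into UNIV \<psi>"
  show "stab n \<phi> \<psi> x f j = root_tup_map n ?\<eta> (\<lambda>j\<in>{..<n}. [:- x j, 1:] * root_tup_map n \<phi> f j) j"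
  proof (cases "j < n")
    case True
    have "f j \<in> monic d"
      using assms True unfolding topspace_Hol monic_def by auto
    then have "f j \<in> roots_in UNIV d"
      by (simp add: roots_in_UNIV)
    then have "root_map \<phi> (f j) \<in> monic d"
      using root_map_roots_in[of "f j" UNIV d \<phi> UNIV] roots_in_monic by blast
    then have "root_map ?\<eta> ([:- x j, 1:] * root_map \<phi> (f j)) = [:- ?\<eta> (x j), 1:] * root_map (?\<eta> \<circ> \<phi>) (f j)"
      by (simp only: root_map_linear_mult root_map_compose)
    then show ?thesis
      using True by (simp add: stab_def from_roots_def E_map_def s_hat_def roots_def root_tup_map_def root_map_def
          image_mset.compositionality comp_def)
  next
    case False
    then show ?thesis
      by (simp add: stab_def from_roots_def root_tup_map_def)
  qed
qed

theorem theorem2p8: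
  fixes n d :: nat
    and \<phi> \<psi> :: "complex \<Rightarrow> complex"
    and x :: "nat \<Rightarrow> complex"
  assumes "n \<ge> 2" and "d \<ge> 1"
    and "stab_data d n \<phi> \<psi> x"
  shows "homology_equivalence_through ((2 * int n - 3) * (int d + 1) - 1)
           (Hol d n) (Hol (d + 1) n) (stab n \<phi> \<psi> x)"
proof -
  have n0: "n > 0"
    using assms(1) by simp
  let ?U = "U_half d" and ?U' = "U_half (d + 1)" and ?\<eta> = "inv_into UNIV \<psi>"
  have x: "real d < Re (x k)" "Re (x k) < real (d + 1)" if "k < n" for k
    using assms(3) that by (auto simp: stab_data_def)
  have x01: "x 0 \<noteq> x 1"
    using assms(1,3) inj_onD[of x "{..<n}" 0 1] by (auto simp: stab_data_def)
  \<comment> \<open>The first two entries keep the disc inside the strip between the boundary lines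
    of the half-planes; half the distance between \<open>x 0\<close> and \<open>x 1\<close>
    separates the first two discs.\<close>
  define r where "r j = Min {Re (x j) - real d, real (d + 1) - Re (x j), dist (x 0) (x 1) / 2}" for j
  define D where "D j = ball (x j) (r j)" for j
  have r: "0 < r j" "r j \<le> Re (x j) - real d" "r j \<le> real (d + 1) - Re (x j)" "r j \<le> dist (x 0) (x 1) / 2" if "j < n" for j
  proof -
    show "0 < r j"
      using x[OF that] x01 by (auto simp: r_def)
    show "r j \<le> Re (x j) - real d" "r j \<le> real (d + 1) - Re (x j)" "r j \<le> dist (x 0) (x 1) / 2"
      unfolding r_def by (rule Min_le; simp)+
  qed
  have D: "real d < Re z" "Re z < real (d + 1)" "dist (x j) z < dist (x 0) (x 1) / 2" if "j < n" "z \<in> D j" for j z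
  proof -
    have "\<bar>Re (x j) - Re z\<bar> < r j" "dist (x j) z < r j"
      using that(2) abs_Re_le_cmod[of "x j - z"] by (auto simp: D_def dist_norm)
    then show "real d < Re z" "Re z < real (d + 1)" "dist (x j) z < dist (x 0) (x 1) / 2"
      using r[OF that(1)] by auto
  qed
  have half: "open (U_half m)" "convex (U_half m)" for m
    unfolding U_half_def by (simp_all add: open_halfspace_Re_lt convex_halfspace_Re_lt)
  interpret half_plane_system n ?U ?U' D
  proof
    have "of_real (real d - 1) \<in> ?U"
      by (simp add: U_half_def)
    then show "?U \<noteq> {}" by blast
    show "D 0 \<inter> D 1 = {}"
    proof (rule ccontr)
      assume "D 0 \<inter> D 1 \<noteq> {}"
      then obtain z where "z \<in> D 0" "z \<in> D 1" by blast
      then have "dist (x 0) z + dist (x 1) z < dist (x 0) (x 1)"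
        using D(3)[of 0 z] D(3)[of 1 z] assms(1) by auto
      then show False
        using dist_triangle3[of "x 0" "x 1" z] by (simp add: dist_commute)
    qed
    show "?U \<subseteq> ?U'"
      by (auto simp: U_half_def)
    show "open (D j)" "convex (D j)" for j
      by (simp_all add: D_def)
    show "D j \<noteq> {}" if "j < n" for j
      using r[OF that] by (simp add: D_def)
    show "D j \<subseteq> ?U'" "D j \<inter> ?U = {}" if "j < n" for j
      using D(1,2)[OF that] by (fastforce simp: U_half_def)+
  qed (use assms(1) half in auto)
  have \<phi>: "homeomorphic_map euclidean (top_of_set ?U) \<phi>" and \<psi>: "homeomorphic_map euclidean (top_of_set ?U') \<psi>"
    using assms(3) by (auto simp: stab_data_def)
  \<comment> \<open>\<open>inv_into\<close> agrees on \<open>V\<close> with the continuous inverse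
    and so inherits its continuity there.\<close>
  have inv: "continuous_on UNIV \<theta> \<and> continuous_on V (inv_into UNIV \<theta>) \<and>
      (\<forall>x. \<theta> x \<in> V \<and> inv_into UNIV \<theta> (\<theta> x) = x) \<and> (\<forall>y\<in>V. \<theta> (inv_into UNIV \<theta> y) = y)"
    if h: "homeomorphic_map euclidean (top_of_set V) \<theta>" for \<theta> :: "complex \<Rightarrow> complex" and V
  proof -
    obtain g where g: "homeomorphic_maps euclidean (top_of_set V) \<theta> g"
      using h homeomorphic_map_maps by blast
    then have c: "continuous_on UNIV \<theta>" "\<And>x. \<theta> x \<in> V" "continuous_on V g" "\<And>x. g (\<theta> x) = x" "\<And>y. y \<in> V \<Longrightarrow> \<theta> (g y) = y"
      unfolding homeomorphic_maps_def by (auto simp: continuous_map_in_subtopology Pi_iff)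
    have inj: "inj \<theta>"
      using c(4) by (rule inj_on_inverseI)
    have "inv_into UNIV \<theta> y = g y" if "y \<in> V" for y
      using inv_into_f_f[OF inj, of "g y"] c(5)[OF that] by simp
    then show ?thesis
      using c inj continuous_on_cong[of V V "inv_into UNIV \<theta>" g] by auto
  qed
  have h\<phi>: "homeomorphic_map (Hol d n) (roots_tuples ?U d n) (root_tup_map n \<phi>)"
    unfolding Hol_eq_roots_tuples[OF n0] using inv[OF \<phi>]
    by (intro homeomorphic_map_root_tup_map[OF _ _ _ _ n0, where \<eta> = "inv_into UNIV \<phi>"]) auto
  have h\<psi>: "homeomorphic_map (roots_tuples ?U' (Suc d) n) (Hol (Suc d) n) (root_tup_map n ?\<eta>)"
    unfolding Hol_eq_roots_tuples[OF n0] using inv[OF \<psi>]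
    by (intro homeomorphic_map_root_tup_map[OF _ _ _ _ n0, where \<eta> = \<psi>]) auto
  have xD: "x j \<in> D j" if "j < n" for j
    using r[OF that] by (simp add: D_def)
  have st: "stab n \<phi> \<psi> x f = (root_tup_map n ?\<eta> \<circ> (add_roots x \<circ> root_tup_map n \<phi>)) f" if "f \<in> topspace (Hol d n)" for f
    using stab_eq[OF that] by (simp add: add_roots_def)
  have main: "hiso i (Hol d n) {} (Hol (Suc d) n) {} (stab n \<phi> \<psi> x)" if "i \<le> (2 * int n - 3) * (int d + 1) - 1" for i
  proof -
    have "hiso i (Hol d n) {} (roots_tuples ?U d n) {} (root_tup_map n \<phi>)"
      "hiso i (roots_tuples ?U' (Suc d) n) {} (Hol (Suc d) n) {} (root_tup_map n ?\<eta>)"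
      by (rule hiso_homeomorphism[OF h\<phi>] hiso_homeomorphism[OF h\<psi>]; simp)+
    then have "hiso i (Hol d n) {} (Hol (Suc d) n) {} (root_tup_map n ?\<eta> \<circ> (add_roots x \<circ> root_tup_map n \<phi>))"
      using hiso_stabilization[OF xD that] by (blast intro: hiso_compose)
    moreover have "hiso i (Hol d n) {} (Hol (Suc d) n) {} (stab n \<phi> \<psi> x) \<longleftrightarrow>
        hiso i (Hol d n) {} (Hol (Suc d) n) {} (root_tup_map n ?\<eta> \<circ> (add_roots x \<circ> root_tup_map n \<phi>))"
      by (rule hiso_eq) (rule st)
    ultimately show ?thesis
      by blast
  qed
  \<comment> \<open>The bound is thus at least -1, so \<open>main\<close> is available in degree -1,
    and the pair condition in \<open>hiso\<close> yields continuity.\<close>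
  have "0 \<le> (2 * int n - 3) * (int d + 1)"
    using assms(1) by (intro mult_nonneg_nonneg) auto
  then have "continuous_map (Hol d n) (Hol (Suc d) n) (stab n \<phi> \<psi> x)"
    using main[of "-1"] by (simp add: hiso_def pair_map_def)
  then show ?thesis
    using main unfolding homology_equivalence_through_def hiso_def by simp
qed

end
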